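(* Suppose (A1)–(A4) hold, that $r_0$ satisfies the RUC radius condition stated in the context, that $\delta,\rho>0$ satisfy $(c+1)\delta+\rho\le r_0$, and that $\theta\ge\theta_0:=28+\frac{1424}{(1-\eta)^2}+\frac{9600}{(1-\eta)^4}$. Run CGTVR-stag with $|\mathcal B_i^t|\equiv B_i=\tau_i=\sqrt{n_i}$ for each agent $i\in[m]$, and let $K_i$ be the number of times, among all the iterations, that agent $i$ early restarts its epoch, i.e. renews its epoch restart signal because $\|x_i^{t+1}-x_i^{\rm c}\|\ge\rho$ before running the full $\tau_i$ steps of the epoch. If $\delta$ and $\rho$ are selected such that $c\delta\le\rho/2$, then $$\mathbb E[K_i]\le\frac{16\,\Delta_f\,\tau_i}{\theta\rho^2}=\mathcal O(\sqrt{n_i})\qquad\text{for all } i\in[m].$$ If in addition there is an upper bound $\bar L>0$ such that $L_{\min}^t\le\bar L$ for all $t\ge0$, then the expected total sample consumption for finding some point $\bar x^{t_{\rm out}}$ such that $\mathbb E[\|\mathcal G(\bar x^{t_{\rm out}})\|^2]\le\mathcal O(\epsilon)$ can be upper bounded by $$\sum_{i=1}^m\mathcal O\big(n_i^{1.5}+n_i^{0.5}\epsilon^{-1}\big).$$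
   Context: **Notation.** $\|\cdot\|$ is the Euclidean norm for vectors and the spectral norm for matrices; $[m]=\{1,\dots,m\}$; $\mathbf 1$ is the all-one vector; $B(x,r)$ is the (closed) ball of center $x$ and radius $r$; $\mathcal P(\mathbb R^d)$ is the family of nonempty compact subsets of $\mathbb R^d$; $d_{\rm H}$ is the Hausdorff distance. A set function $F:\mathcal P(\mathbb R^d)\to\mathbb R_{++}$ is RUC (relative uniform continuous) if for every $\epsilon>0$ there is $\delta>0$ such that $\big|1-\max\{F(\mathcal X)/F(\mathcal Y),F(\mathcal Y)/F(\mathcal X)\}\big|\le\epsilon$ whenever $d_{\rm H}(\mathcal X,\mathcal Y)\le\delta$. **Problem.** Minimize $f(x)=\frac1m\sum_{i=1}^m f_i(x)$ over $x\in\mathbb R^d$, where $f_i=\frac1{n_i}\sum_{j=1}^{n_i}f_{i,j}$, $n_i$ is the local data size of agent $i$, and the functions are differentiable but possibly nonconvex. **Assumptions.** (A1) For each $i\in[m]$ there is $\mathbb L_i:\mathcal P(\mathbb R^d)\to\mathbb R_{++}$ with $\frac1{n_i}\sum_{j=1}^{n_i}\|\nabla f_{i,j}(x)-\nabla f_{i,j}(x')\|^2\le\mathbb L_i(\mathcal X)^2\|x-x'\|^2$ for all $x,x'\in\mathcal X$ and all $\mathcal X\in\mathcal P(\mathbb R^d)$; $\mathbb L_i(\mathcal X)\le\mathbb L_i(\mathcal Y)$ if $\mathcal X\subseteq\mathcal Y$; $\mathbb L_i(\mathcal X\cup\mathcal Y)=\max\{\mathbb L_i(\mathcal X),\mathbb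 L_i(\mathcal Y)\}$; and $\mathbb L_i\ge1$. (A2) Each $\mathbb L_i$ is RUC. (A3) $f^*:=\inf_x f(x)>-\infty$. (A4) The mixing matrix $W\in\mathbb R^{m\times m}$ of the undirected network with node set $[m]$ and edge set $\mathcal E$ satisfies $W_{ij}=0$ for all $(i,j)\notin\mathcal E$ and $W_{ij}>0$ otherwise, $W\mathbf 1=W^\top\mathbf 1=\mathbf 1$, and the second largest eigenvalue of $W$ equals $\eta\in(0,1)$. **Constants.** $\mathbb L:=\max_i\mathbb L_i$, $c:=\frac{2\sqrt{2m}}{1-\eta}$, $\gamma:=\min\{2,\frac{1+\eta}{2\eta}\}$. RUC radius condition: $r_0>0$ is such that $\gamma^{-1}\le\mathbb L_i(\mathcal X)/\mathbb L_i(\mathcal Y)\le\gamma$ for all $i\in[m]$ and all $\mathcal X,\mathcal Y$ with $d_{\rm H}(\mathcal X,\mathcal Y)\le r_0$ (such $r_0$ exists by (A2)). **Clipping.** For $\beta,\delta>0$: $\mathcal T_\beta^\delta(v)=v/\beta$ if $\|v\|\le\beta\delta$, and $\mathcal T_\beta^\delta(v)=\delta v/\|v\|$ otherwise. **Algorithm CGTVR-stag.** Inputs: common initial point $x_1^0=\dots=x_m^0=x^0$, clipping threshold $\delta>0$, epoch radius $\rho>0$, constants $\theta$ and $r_0$, maximum epoch length $\tau_i$ for each agent. Initialize $y_i^{-1}=g_i^{-1}=0$, ${\rm Flag}(i)=$ true, ${\rm Count}(i)=0$. For $t=0,1,\dots,T-1$, every agent $i$ does: (1) If ${\rm Flag}(i)$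 is true (a new local epoch starts): $g_i^t=\nabla f_i(x_i^t)$; record the check point $x_i^{\rm c}=x_i^t$; set $L_i^t=\mathbb L(B(x_i^t,r_0))$ and $\beta_i^t=\theta L_i^t$; set ${\rm Flag}(i)=$ false and ${\rm Count}(i)=0$. Otherwise: sample a batch $\mathcal B_i^t$, set $g_i^t=g_i^{t-1}+\frac1{|\mathcal B_i^t|}\sum_{j\in\mathcal B_i^t}(\nabla f_{i,j}(x_i^t)-\nabla f_{i,j}(x_i^{t-1}))$, and keep $L_i^t=L_i^{t-1}$, $\beta_i^t=\beta_i^{t-1}$. (2) $y_i^t=\sum_jW_{ij}y_j^{t-1}+g_i^t-g_i^{t-1}$. (3) $x_i^{t+1}=\sum_jW_{ij}x_j^t-\mathcal T^\delta_{\beta_i^t}(y_i^t)$. (4) If $\|x_i^{t+1}-x_i^{\rm c}\|\ge\rho$ or ${\rm Count}(i)=\tau_i-1$, renew the epoch restart signal: ${\rm Flag}(i)=$ true; otherwise increase ${\rm Count}(i)$ by 1. **Derived quantities.** $\bar x^t=\frac1m\sum_ix_i^t$; $L_{\min}^t=\min_iL_i^t$; $\beta_{\min}^t=\theta L_{\min}^t$; gradient mapping $\mathcal G(\bar x^t):=\beta_{\min}^t\,\mathcal T^\delta_{\beta_{\min}^t}(\nabla f(\bar x^t))$; $\Delta_f:=f(x^0)-f^*+\frac{5\sum_{i=1}^m\|\nabla f(x^0)-\nabla f_i(x^0)\|^2}{2m(1-\eta)L_{\min}^0}$. The time $t_{\rm out}$ is randomly selected from $\{0,1,\dots,T-1\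}$.
   Formalization: In (A4) the second largest eigenvalue η of W is read as its second largest singular value (second largest absolute eigenvalue if W is symmetric); with signed eigenvalues the claim fails, e.g. on a 6-cycle with weights 1/2. Also √n_i is rounded up when not an integer. *)

theory Defs
  imports "HOL-Analysis.Analysis" "HOL-Probability.Probability"
begin

section \<open>Gradients, Hausdorff distance, relative uniform continuity\<close>

definition grad :: "('a::euclidean_space \<Rightarrow> real) \<Rightarrow> 'a \<Rightarrow> 'a" where
  "grad f x = (THE D. GDERIV f x :> D)"

definition nonempty_compacts :: "'a::euclidean_space set set" where
  "nonempty_compacts = {X. X \<noteq> {} \<and> compact X}"

definition hausdorff_dist :: "'a::euclidean_space set \<Rightarrow> 'a set \<Rightarrow> real" where
  "hausdorff_dist X Y = max (SUP x\<in>X. infdist x Y) (SUP y\<in>Y. infdist y X)"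

definition RUC :: "('a::euclidean_space set \<Rightarrow> real) \<Rightarrow> bool" where
  "RUC F \<longleftrightarrow> (\<forall>\<epsilon>>0. \<exists>\<delta>>0. \<forall>X\<in>nonempty_compacts. \<forall>Y\<in>nonempty_compacts.
     hausdorff_dist X Y \<le> \<delta> \<longrightarrow> \<bar>1 - max (F X / F Y) (F Y / F X)\<bar> \<le> \<epsilon>)"


section \<open>The second largest eigenvalue of the mixing matrix\<close>

definition eigenspace :: "real^'n^'n \<Rightarrow> real \<Rightarrow> (real^'n) set" where
  "eigenspace A \<mu> = {v. A *v v = \<mu> *\<^sub>R v}"

definition eigenvalue :: "real^'n^'n \<Rightarrow> real \<Rightarrow> bool" where
  "eigenvalue A \<mu> \<longleftrightarrow> (\<exists>v. v \<noteq> 0 \<and> A *v v = \<mu> *\<^sub>R v)"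

text \<open>
  For symmetric \<open>A\<close>: the value \<open>\<mu>\<close> is the second entry of the decreasing list of the eigenvalues
  of \<open>A\<close>, each repeated according to its multiplicity.
\<close>
definition second_largest_eigenvalue :: "real^'n^'n \<Rightarrow> real \<Rightarrow> bool" where
  "second_largest_eigenvalue A \<mu> \<longleftrightarrow> eigenvalue A \<mu> \<and>
     (\<Sum>\<nu> | eigenvalue A \<nu> \<and> \<nu> > \<mu>. dim (eigenspace A \<nu>)) < 2 \<and>
     (\<Sum>\<nu> | eigenvalue A \<nu> \<and> \<nu> \<ge> \<mu>. dim (eigenspace A \<nu>)) \<ge> 2"

text \<open>
  A mixing matrix that is merely doubly stochastic can have non-real eigenvalues, and a real
  eigenvalue near \<open>-1\<close> obstructs consensus just as one near \<open>1\<close> does (a cycle of length six with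
  weights \<open>1/2\<close> has second largest signed eigenvalue \<open>1/2\<close> and never mixes).  The
  second largest eigenvalue of \<open>W\<close> is therefore understood in absolute value, in the sense of
  singular values: its square is the second largest eigenvalue of \<open>W\<^sup>T W\<close>.  For symmetric \<open>W\<close> this
  is the second largest absolute value in the list of eigenvalues of \<open>W\<close> itself (lemma
  \<open>second_largest_modulus_symmetric\<close> below).
\<close>
definition second_largest_modulus :: "real^'n^'n \<Rightarrow> real \<Rightarrow> bool" where
  "second_largest_modulus W \<eta> \<longleftrightarrow> 0 \<le> \<eta> \<and> second_largest_eigenvalue (transpose W ** W) (\<eta>\<^sup>2)"

lemma eigenspace_subspace: "subspace (eigenspace A \<mu>)"
  by (auto simp: subspace_def eigenspace_def algebra_simps matrix_vector_right_distrib
        matrix_vector_mult_scaleR)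

lemma eigenspace_trivial: "\<not> eigenvalue A \<mu> \<Longrightarrow> eigenspace A \<mu> = {0}"
  by (auto simp: eigenspace_def eigenvalue_def)

lemma symmetric_matrix_inner:
  fixes A :: "real^'n^'n"
  assumes "transpose A = A"
  shows "(A *v x) \<bullet> y = x \<bullet> (A *v y)"
  using assms by (metis dot_lmul_matrix vector_transpose_matrix)

lemma finite_eigenvalues_symmetric:
  fixes A :: "real^'n^'n"
  assumes "transpose A = A"
  shows "finite {\<mu>. eigenvalue A \<mu>}"
proof -
  define ev where "ev \<mu> = (SOME v. v \<noteq> 0 \<and> A *v v = \<mu> *\<^sub>R v)" for \<mu>
  have ev: "ev \<mu> \<noteq> 0 \<and> A *v ev \<mu> = \<mu> *\<^sub>R ev \<mu>" if "eigenvalue A \<mu>" for \<mu>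
    using someI_ex[OF that[unfolded eigenvalue_def]] by (simp add: ev_def)
  have orth: "ev \<mu> \<bullet> ev \<nu> = 0" if "eigenvalue A \<mu>" "eigenvalue A \<nu>" "\<mu> \<noteq> \<nu>" for \<mu> \<nu>
  proof -
    have "\<mu> * (ev \<mu> \<bullet> ev \<nu>) = \<nu> * (ev \<mu> \<bullet> ev \<nu>)"
      using symmetric_matrix_inner[OF assms, of "ev \<mu>" "ev \<nu>"] ev that by simp
    then show ?thesis using that by simp
  qed
  have inj: "inj_on ev {\<mu>. eigenvalue A \<mu>}"
    by (rule inj_onI) (metis ev inner_eq_zero_iff mem_Collect_eq orth)
  have "pairwise orthogonal (ev ` {\<mu>. eigenvalue A \<mu>})"
    by (auto simp: pairwise_def orthogonal_def intro!: orth)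
  moreover have "0 \<notin> ev ` {\<mu>. eigenvalue A \<mu>}"
    using ev by force
  ultimately have "independent (ev ` {\<mu>. eigenvalue A \<mu>})"
    using pairwise_orthogonal_independent by blast
  then have "finite (ev ` {\<mu>. eigenvalue A \<mu>})"
    using independent_imp_finite by blast
  then show ?thesis using inj finite_imageD by blast
qed

lemma eigenvalue_square_symmetric:
  fixes W :: "real^'n^'n"
  assumes sym: "transpose W = W"
  shows "eigenvalue (W ** W) \<kappa> \<longleftrightarrow> (\<exists>\<sigma>. eigenvalue W \<sigma> \<and> \<sigma>\<^sup>2 = \<kappa>)"
proof
  assume "eigenvalue (W ** W) \<kappa>"
  then obtain v where v: "v \<noteq> 0" "W *v (W *v v) = \<kappa> *\<^sub>R v"
    by (auto simp: eigenvalue_def matrix_vector_mul_assoc)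
  have "(W *v v) \<bullet> (W *v v) = \<kappa> * (v \<bullet> v)"
    using symmetric_matrix_inner[OF sym, of v "W *v v"] v(2) by simp
  then have "0 \<le> \<kappa>"
    using v(1) by (metis inner_ge_zero inner_gt_zero_iff linorder_not_le mult_neg_pos)
  define \<sigma> where "\<sigma> = sqrt \<kappa>"
  have l: "\<sigma>\<^sup>2 = \<kappa>" using \<open>0 \<le> \<kappa>\<close> by (simp add: \<sigma>_def)
  show "\<exists>\<sigma>. eigenvalue W \<sigma> \<and> \<sigma>\<^sup>2 = \<kappa>"
  proof (cases "W *v v + \<sigma> *\<^sub>R v = 0")
    case True
    then have "W *v v = (- \<sigma>) *\<^sub>R v" by (simp add: eq_neg_iff_add_eq_0)
    then have "eigenvalue W (- \<sigma>)" using v(1) by (auto simp: eigenvalue_def)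
    then show ?thesis using l by (intro exI[of _ "- \<sigma>"]) simp
  next
    case False
    have "W *v (W *v v + \<sigma> *\<^sub>R v) = \<sigma> *\<^sub>R (W *v v + \<sigma> *\<^sub>R v)"
      using v(2) l by (simp add: matrix_vector_right_distrib matrix_vector_mult_scaleR
          algebra_simps power2_eq_square flip: l)
    then show ?thesis using False l by (auto simp: eigenvalue_def)
  qed
next
  assume "\<exists>\<sigma>. eigenvalue W \<sigma> \<and> \<sigma>\<^sup>2 = \<kappa>"
  then obtain v \<sigma> where "v \<noteq> 0" "W *v v = \<sigma> *\<^sub>R v" "\<sigma>\<^sup>2 = \<kappa>"
    by (auto simp: eigenvalue_def)
  then have "(W ** W) *v v = \<kappa> *\<^sub>R v"
    by (simp add: matrix_vector_mult_scaleR power2_eq_square flip: matrix_vector_mul_assoc)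
  then show "eigenvalue (W ** W) \<kappa>" using \<open>v \<noteq> 0\<close> by (auto simp: eigenvalue_def)
qed

lemma dim_eigenspace_square_symmetric:
  fixes W :: "real^'n^'n"
  assumes sym: "transpose W = W"
  shows "dim (eigenspace (W ** W) (\<sigma>\<^sup>2)) = (\<Sum>\<nu>\<in>{\<sigma>, -\<sigma>}. dim (eigenspace W \<nu>))"
proof (cases "\<sigma> = 0")
  case True
  have "W *v v = 0" if "W *v (W *v v) = 0" for v
    using symmetric_matrix_inner[OF sym, of v "W *v v"] that by simp
  then have "eigenspace (W ** W) 0 = eigenspace W 0"
    by (auto simp: eigenspace_def simp flip: matrix_vector_mul_assoc)
  then show ?thesis using True by simp
next
  case False
  let ?S = "{x + y |x y. x \<in> eigenspace W \<sigma> \<and> y \<in> eigenspace W (-\<sigma>)}"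
  have "eigenspace (W ** W) (\<sigma>\<^sup>2) = ?S"
  proof (intro equalityI subsetI)
    fix v assume "v \<in> eigenspace (W ** W) (\<sigma>\<^sup>2)"
    then have v: "W *v (W *v v) = (\<sigma> * \<sigma>) *\<^sub>R v"
      by (simp add: eigenspace_def matrix_vector_mul_assoc power2_eq_square)
    define x where "x = (1/2) *\<^sub>R (v + (1/\<sigma>) *\<^sub>R (W *v v))"
    define y where "y = (1/2) *\<^sub>R (v - (1/\<sigma>) *\<^sub>R (W *v v))"
    have "v = x + y"
      by (simp add: x_def y_def algebra_simps flip: scaleR_add_left)
    moreover have "x \<in> eigenspace W \<sigma>" "y \<in> eigenspace W (-\<sigma>)"
      using False v by (simp_all add: x_def y_def eigenspace_def matrix_vector_right_distrib
          matrix_vector_mult_diff_distrib matrix_vector_mult_scaleR algebra_simps)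
    ultimately show "v \<in> ?S" by blast
  next
    fix v assume "v \<in> ?S"
    then obtain x y where xy: "v = x + y" "W *v x = \<sigma> *\<^sub>R x" "W *v y = (- \<sigma>) *\<^sub>R y"
      by (auto simp: eigenspace_def)
    have "W *v (W *v x) = \<sigma>\<^sup>2 *\<^sub>R x"
      unfolding xy matrix_vector_mult_scaleR by (simp add: power2_eq_square)
    moreover have "W *v (W *v y) = \<sigma>\<^sup>2 *\<^sub>R y"
      unfolding xy matrix_vector_mult_scaleR by (simp add: power2_eq_square)
    ultimately show "v \<in> eigenspace (W ** W) (\<sigma>\<^sup>2)"
      unfolding xy(1) by (simp add: eigenspace_def matrix_vector_right_distrib
          scaleR_right_distrib flip: matrix_vector_mul_assoc)
  qed
  moreover have "eigenspace W \<sigma> \<inter> eigenspace W (-\<sigma>) = {0}"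
  proof -
    have "v = 0" if "\<sigma> *\<^sub>R v = - (\<sigma> *\<^sub>R v)" for v :: "real^'n"
    proof -
      have "(2 * \<sigma>) *\<^sub>R v = 0" using that
        by (metis eq_neg_iff_add_eq_0 mult_2 scaleR_add_left)
      then show ?thesis using False by simp
    qed
    then show ?thesis by (auto simp: eigenspace_def)
  qed
  ultimately have "dim (eigenspace (W ** W) (\<sigma>\<^sup>2))
      = dim (eigenspace W \<sigma>) + dim (eigenspace W (-\<sigma>))"
    using dim_sums_Int[OF eigenspace_subspace eigenspace_subspace, of W \<sigma> W "-\<sigma>"] by simp
  then show ?thesis using False by simp
qed

lemma sum_dim_eigenspace_square_symmetric:
  fixes W :: "real^'n^'n"
  assumes sym: "transpose W = W"
  shows "(\<Sum>\<kappa> | eigenvalue (W ** W) \<kappa> \<and> P \<kappa>. dim (eigenspace (W ** W) \<kappa>)) =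
         (\<Sum>\<nu> | eigenvalue W \<nu> \<and> P (\<nu>\<^sup>2). dim (eigenspace W \<nu>))"
proof -
  let ?A = "{\<nu>. eigenvalue W \<nu> \<and> P (\<nu>\<^sup>2)}"
  have fin: "finite ?A"
    using finite_eigenvalues_symmetric[OF sym] by (rule rev_finite_subset) auto
  have img: "{\<kappa>. eigenvalue (W ** W) \<kappa> \<and> P \<kappa>} = (\<lambda>\<nu>. \<nu>\<^sup>2) ` ?A"
    by (auto simp: eigenvalue_square_symmetric[OF sym])
  have "dim (eigenspace (W ** W) \<kappa>) = (\<Sum>\<nu> | \<nu> \<in> ?A \<and> \<nu>\<^sup>2 = \<kappa>. dim (eigenspace W \<nu>))"
    if k: "\<kappa> \<in> (\<lambda>\<nu>. \<nu>\<^sup>2) ` ?A" for \<kappa>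
  proof -
    obtain \<sigma> where l: "\<kappa> = \<sigma>\<^sup>2" "\<sigma> \<in> ?A" using k by blast
    have "(\<Sum>\<nu> | \<nu> \<in> ?A \<and> \<nu>\<^sup>2 = \<kappa>. dim (eigenspace W \<nu>))
        = (\<Sum>\<nu>\<in>{\<sigma>, -\<sigma>}. dim (eigenspace W \<nu>))"
    proof (rule sum.mono_neutral_left)
      show "{\<nu> \<in> ?A. \<nu>\<^sup>2 = \<kappa>} \<subseteq> {\<sigma>, -\<sigma>}"
        using l by (auto simp: power2_eq_iff)
      show "\<forall>\<nu>\<in>{\<sigma>, -\<sigma>} - {\<nu> \<in> ?A. \<nu>\<^sup>2 = \<kappa>}. dim (eigenspace W \<nu>) = 0"
      proof
        fix \<nu> assume "\<nu> \<in> {\<sigma>, -\<sigma>} - {\<nu> \<in> ?A. \<nu>\<^sup>2 = \<kappa>}"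
        then have "\<not> eigenvalue W \<nu>" using l by auto
        then show "dim (eigenspace W \<nu>) = 0" by (simp add: eigenspace_trivial)
      qed
    qed simp
    then show ?thesis using dim_eigenspace_square_symmetric[OF sym] l by simp
  qed
  then show ?thesis
    unfolding img by (subst sum.image_gen[OF fin, where g = "\<lambda>\<nu>. \<nu>\<^sup>2"]) (simp cong: sum.cong)
qed

lemma second_largest_modulus_symmetric:
  fixes W :: "real^'n^'n"
  assumes sym: "transpose W = W"
  shows "second_largest_modulus W \<eta> \<longleftrightarrow> 0 \<le> \<eta> \<and> (eigenvalue W \<eta> \<or> eigenvalue W (- \<eta>)) \<and>
     (\<Sum>\<nu> | eigenvalue W \<nu> \<and> \<bar>\<nu>\<bar> > \<eta>. dim (eigenspace W \<nu>)) < 2 \<and>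
     (\<Sum>\<nu> | eigenvalue W \<nu> \<and> \<bar>\<nu>\<bar> \<ge> \<eta>. dim (eigenspace W \<nu>)) \<ge> 2"
proof (cases "0 \<le> \<eta>")
  case True
  have "eigenvalue (W ** W) (\<eta>\<^sup>2) \<longleftrightarrow> eigenvalue W \<eta> \<or> eigenvalue W (- \<eta>)"
    unfolding eigenvalue_square_symmetric[OF sym] by (metis power2_eq_iff)
  moreover have "\<eta>\<^sup>2 < \<nu>\<^sup>2 \<longleftrightarrow> \<eta> < \<bar>\<nu>\<bar>" "\<eta>\<^sup>2 \<le> \<nu>\<^sup>2 \<longleftrightarrow> \<eta> \<le> \<bar>\<nu>\<bar>" for \<nu>
    using True abs_le_square_iff[of \<eta> \<nu>] abs_le_square_iff[of \<nu> \<eta>] by auto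
  ultimately show ?thesis
    using True by (simp add: second_largest_modulus_def second_largest_eigenvalue_def sym
        sum_dim_eigenspace_square_symmetric[OF sym])
qed (simp add: second_largest_modulus_def)


section \<open>Problem data and standing assumptions\<close>

text \<open>
  The agents are the elements of the finite type \<open>'m\<close>, so \<open>m = CARD('m)\<close>; the local functions of
  agent \<open>i\<close> are \<open>loss P i j\<close> for \<open>j < data_size P i\<close>; \<open>init P\<close> is the common initial point.
\<close>
record ('m::finite, 'a) problem =
  data_size :: "'m \<Rightarrow> nat"
  loss :: "'m \<Rightarrow> nat \<Rightarrow> 'a \<Rightarrow> real"
  Lip :: "'m \<Rightarrow> 'a set \<Rightarrow> real"
  mixing :: "real^'m^'m"
  edges :: "('m \<times> 'm) set"
  init :: 'a

definition local_obj :: "('m::finite, 'a::euclidean_space) problem \<Rightarrow> 'm \<Rightarrow> 'a \<Rightarrow> real" where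
  "local_obj P i x = (\<Sum>j<data_size P i. loss P i j x) / real (data_size P i)"

definition objective :: "('m::finite, 'a::euclidean_space) problem \<Rightarrow> 'a \<Rightarrow> real" where
  "objective P x = (\<Sum>i\<in>UNIV. local_obj P i x) / real CARD('m)"

definition opt_value :: "('m::finite, 'a::euclidean_space) problem \<Rightarrow> real" where
  "opt_value P = (INF x. objective P x)"

definition Lip_max :: "('m::finite, 'a::euclidean_space) problem \<Rightarrow> 'a set \<Rightarrow> real" where
  "Lip_max P X = (MAX i. Lip P i X)"

definition differentiable_losses :: "('m::finite, 'a::euclidean_space) problem \<Rightarrow> bool" where
  "differentiable_losses P \<longleftrightarrow> (\<forall>i. data_size P i \<ge> 1 \<and>
     (\<forall>j<data_size P i. \<forall>x. loss P i j differentiable (at x)))"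

definition A1 :: "('m::finite, 'a::euclidean_space) problem \<Rightarrow> bool" where
  "A1 P \<longleftrightarrow> (\<forall>i. \<forall>X\<in>nonempty_compacts.
     (\<forall>x\<in>X. \<forall>x'\<in>X.
        (\<Sum>j<data_size P i. (norm (grad (loss P i j) x - grad (loss P i j) x'))\<^sup>2)
          / real (data_size P i) \<le> (Lip P i X)\<^sup>2 * (norm (x - x'))\<^sup>2) \<and>
     (\<forall>Y\<in>nonempty_compacts. X \<subseteq> Y \<longrightarrow> Lip P i X \<le> Lip P i Y) \<and>
     (\<forall>Y\<in>nonempty_compacts. Lip P i (X \<union> Y) = max (Lip P i X) (Lip P i Y)) \<and>
     Lip P i X \<ge> 1)"

definition A2 :: "('m::finite, 'a::euclidean_space) problem \<Rightarrow> bool" where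
  "A2 P \<longleftrightarrow> (\<forall>i. RUC (Lip P i))"

definition A3 :: "('m::finite, 'a::euclidean_space) problem \<Rightarrow> bool" where
  "A3 P \<longleftrightarrow> bdd_below (range (objective P))"

definition A4 :: "('m::finite, 'a::euclidean_space) problem \<Rightarrow> real \<Rightarrow> bool" where
  "A4 P \<eta> \<longleftrightarrow> sym (edges P) \<and>
     (\<forall>i j. ((i, j) \<notin> edges P \<longrightarrow> mixing P $ i $ j = 0) \<and>
            ((i, j) \<in> edges P \<longrightarrow> mixing P $ i $ j > 0)) \<and>
     mixing P *v 1 = 1 \<and> transpose (mixing P) *v 1 = 1 \<and>
     second_largest_modulus (mixing P) \<eta> \<and> 0 < \<eta> \<and> \<eta> < 1"

definition standing_assumptions :: "('m::finite, 'a::euclidean_space) problem \<Rightarrow> real \<Rightarrow> bool" where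
  "standing_assumptions P \<eta> \<longleftrightarrow> differentiable_losses P \<and> A1 P \<and> A2 P \<and> A3 P \<and> A4 P \<eta>"

definition RUC_radius :: "('m::finite, 'a::euclidean_space) problem \<Rightarrow> real \<Rightarrow> real \<Rightarrow> bool" where
  "RUC_radius P \<eta> r0 \<longleftrightarrow> r0 > 0 \<and>
     (let \<gamma> = min 2 ((1 + \<eta>) / (2 * \<eta>)) in
      \<forall>i. \<forall>X\<in>nonempty_compacts. \<forall>Y\<in>nonempty_compacts. hausdorff_dist X Y \<le> r0 \<longrightarrow>
        1 / \<gamma> \<le> Lip P i X / Lip P i Y \<and> Lip P i X / Lip P i Y \<le> \<gamma>)"

text \<open>
  Batch size and maximum epoch length \<open>\<surd>n\<^sub>i\<close>, rounded up when \<open>n\<^sub>i\<close> is not a perfect square.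
\<close>
definition batch_size :: "('m::finite, 'a::euclidean_space) problem \<Rightarrow> 'm \<Rightarrow> nat" where
  "batch_size P i = nat \<lceil>sqrt (real (data_size P i))\<rceil>"

abbreviation epoch_length :: "('m::finite, 'a::euclidean_space) problem \<Rightarrow> 'm \<Rightarrow> nat" where
  "epoch_length P i \<equiv> batch_size P i"


section \<open>The algorithm CGTVR-stag\<close>

definition clip :: "real \<Rightarrow> real \<Rightarrow> 'a::euclidean_space \<Rightarrow> 'a" where
  "clip \<beta> \<delta> v = (if norm v \<le> \<beta> * \<delta> then (1 / \<beta>) *\<^sub>R v else (\<delta> / norm v) *\<^sub>R v)"

text \<open>
  The state of one agent at the beginning of iteration \<open>t\<close>: the iterates \<open>x\<^sup>t\<close> and \<open>x\<^sup>t\<^sup>-\<^sup>1\<close>, the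
  tracker \<open>y\<^sup>t\<^sup>-\<^sup>1\<close>, the estimator \<open>g\<^sup>t\<^sup>-\<^sup>1\<close>, the constant \<open>L\<^sup>t\<^sup>-\<^sup>1\<close>, the check point, the restart
  signal and the counter.
\<close>
record 'a agent_state =
  cur :: 'a
  prev :: 'a
  track :: 'a
  est :: 'a
  lconst :: real
  check :: 'a
  flag :: bool
  cnt :: nat

text \<open>
  Every quantity of the method is a function of the array \<open>\<omega>\<close> of batches, \<open>\<omega> (i, t)\<close> being the
  batch available to agent \<open>i\<close> at iteration \<open>t\<close>; a batch is ignored at an iteration that starts a
  new epoch.  The constants \<open>L\<^sup>-\<^sup>1\<close>, \<open>x\<^sup>-\<^sup>1\<close> and the initial check point are placeholders: since all
  flags are initially true they are never read.
\<close>
type_synonym 'm batches = "'m \<times> nat \<Rightarrow> nat set"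

definition init_state :: "('m::finite, 'a::euclidean_space) problem \<Rightarrow> 'm \<Rightarrow> 'a agent_state" where
  "init_state P i = \<lparr>cur = init P, prev = init P, track = 0, est = 0, lconst = 0, check = init P,
     flag = True, cnt = 0\<rparr>"

definition new_est ::
  "('m::finite, 'a::euclidean_space) problem \<Rightarrow> 'm \<Rightarrow> nat set \<Rightarrow> 'a agent_state \<Rightarrow> 'a" where
  "new_est P i B s = (if flag s then grad (local_obj P i) (cur s)
     else est s + (1 / real (card B)) *\<^sub>R
            (\<Sum>j\<in>B. grad (loss P i j) (cur s) - grad (loss P i j) (prev s)))"

definition new_lconst ::
  "('m::finite, 'a::euclidean_space) problem \<Rightarrow> real \<Rightarrow> 'a agent_state \<Rightarrow> real" where
  "new_lconst P r0 s = (if flag s then Lip_max P (cball (cur s) r0) else lconst s)"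

definition step :: "('m::finite, 'a::euclidean_space) problem \<Rightarrow> real \<Rightarrow> real \<Rightarrow> real \<Rightarrow> real \<Rightarrow>
    ('m \<Rightarrow> nat set) \<Rightarrow> ('m \<Rightarrow> 'a agent_state) \<Rightarrow> 'm \<Rightarrow> 'a agent_state" where
  "step P \<delta> \<rho> \<theta> r0 B S i =
    (let g = new_est P i (B i) (S i);
         L = new_lconst P r0 (S i);
         ck = (if flag (S i) then cur (S i) else check (S i));
         k = (if flag (S i) then 0 else cnt (S i));
         y = (\<Sum>j\<in>UNIV. mixing P $ i $ j *\<^sub>R track (S j)) + g - est (S i);
         x' = (\<Sum>j\<in>UNIV. mixing P $ i $ j *\<^sub>R cur (S j)) - clip (\<theta> * L) \<delta> y;
         renew = (norm (x' - ck) \<ge> \<rho> \<or> k = epoch_length P i - 1)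
     in \<lparr>cur = x', prev = cur (S i), track = y, est = g, lconst = L, check = ck,
         flag = renew, cnt = (if renew then k else k + 1)\<rparr>)"

primrec run :: "('m::finite, 'a::euclidean_space) problem \<Rightarrow> real \<Rightarrow> real \<Rightarrow> real \<Rightarrow> real \<Rightarrow>
    'm batches \<Rightarrow> nat \<Rightarrow> 'm \<Rightarrow> 'a agent_state" where
  "run P \<delta> \<rho> \<theta> r0 \<omega> 0 = init_state P"
| "run P \<delta> \<rho> \<theta> r0 \<omega> (Suc t) = step P \<delta> \<rho> \<theta> r0 (\<lambda>i. \<omega> (i, t)) (run P \<delta> \<rho> \<theta> r0 \<omega> t)"

text \<open>
  A batch is a set of \<open>B\<^sub>i\<close> data indices drawn uniformly at random, independently over agents and
  iterations.
\<close>
definition admissible_batches :: "('m::finite, 'a::euclidean_space) problem \<Rightarrow> 'm \<Rightarrow> nat set set" where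
  "admissible_batches P i = {B. B \<subseteq> {..<data_size P i} \<and> card B = batch_size P i}"

definition batches_pmf ::
  "('m::finite, 'a::euclidean_space) problem \<Rightarrow> nat \<Rightarrow> 'm batches pmf" where
  "batches_pmf P T =
     Pi_pmf (UNIV \<times> {..<T}) {} (\<lambda>(i, t). pmf_of_set (admissible_batches P i))"


section \<open>Derived quantities\<close>

definition mean_iterate :: "('m::finite, 'a::euclidean_space) problem \<Rightarrow> real \<Rightarrow> real \<Rightarrow> real \<Rightarrow> real \<Rightarrow>
    'm batches \<Rightarrow> nat \<Rightarrow> 'a" where
  "mean_iterate P \<delta> \<rho> \<theta> r0 \<omega> t =
     (1 / real CARD('m)) *\<^sub>R (\<Sum>i\<in>UNIV. cur (run P \<delta> \<rho> \<theta> r0 \<omega> t i))"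

definition L_min :: "('m::finite, 'a::euclidean_space) problem \<Rightarrow> real \<Rightarrow> real \<Rightarrow> real \<Rightarrow> real \<Rightarrow>
    'm batches \<Rightarrow> nat \<Rightarrow> real" where
  "L_min P \<delta> \<rho> \<theta> r0 \<omega> t = (MIN i. new_lconst P r0 (run P \<delta> \<rho> \<theta> r0 \<omega> t i))"

definition grad_mapping :: "('m::finite, 'a::euclidean_space) problem \<Rightarrow> real \<Rightarrow> real \<Rightarrow> real \<Rightarrow> real \<Rightarrow>
    'm batches \<Rightarrow> nat \<Rightarrow> 'a" where
  "grad_mapping P \<delta> \<rho> \<theta> r0 \<omega> t =
     (let \<beta> = \<theta> * L_min P \<delta> \<rho> \<theta> r0 \<omega> t
      in \<beta> *\<^sub>R clip \<beta> \<delta> (grad (objective P) (mean_iterate P \<delta> \<rho> \<theta> r0 \<omega> t)))"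

lemma L_min_0: "L_min P \<delta> \<rho> \<theta> r0 \<omega> 0 = Lip_max P (cball (init P) r0)"
  by (simp add: L_min_def new_lconst_def init_state_def)

text \<open>By the lemma above, the last denominator contains \<open>L\<^bsub>min\<^esub>\<close> at time \<open>0\<close>.\<close>
definition Delta_f :: "('m::finite, 'a::euclidean_space) problem \<Rightarrow> real \<Rightarrow> real \<Rightarrow> real" where
  "Delta_f P \<eta> r0 = objective P (init P) - opt_value P +
     5 * (\<Sum>i\<in>UNIV. (norm (grad (objective P) (init P) - grad (local_obj P i) (init P)))\<^sup>2) /
       (2 * real CARD('m) * (1 - \<eta>) * Lip_max P (cball (init P) r0))"

text \<open>
  Iteration \<open>t\<close> ends with an early restart if the radius test fires while the counter (which is \<open>0\<close>
  at the first iteration of an epoch) is still below its final value.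
\<close>
definition early_restart :: "('m::finite, 'a::euclidean_space) problem \<Rightarrow> real \<Rightarrow> real \<Rightarrow> real \<Rightarrow> real \<Rightarrow>
    'm batches \<Rightarrow> 'm \<Rightarrow> nat \<Rightarrow> bool" where
  "early_restart P \<delta> \<rho> \<theta> r0 \<omega> i t \<longleftrightarrow>
     (let s = run P \<delta> \<rho> \<theta> r0 \<omega> t i; s' = run P \<delta> \<rho> \<theta> r0 \<omega> (Suc t) i
      in norm (cur s' - check s') \<ge> \<rho> \<and>
         (if flag s then 0 else cnt s) \<noteq> epoch_length P i - 1)"

definition num_early_restarts :: "('m::finite, 'a::euclidean_space) problem \<Rightarrow> real \<Rightarrow> real \<Rightarrow> real \<Rightarrow>
    real \<Rightarrow> nat \<Rightarrow> 'm batches \<Rightarrow> 'm \<Rightarrow> nat" where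
  "num_early_restarts P \<delta> \<rho> \<theta> r0 T \<omega> i = card {t. t < T \<and> early_restart P \<delta> \<rho> \<theta> r0 \<omega> i t}"

definition expected_early_restarts :: "('m::finite, 'a::euclidean_space) problem \<Rightarrow> real \<Rightarrow> real \<Rightarrow>
    real \<Rightarrow> real \<Rightarrow> nat \<Rightarrow> 'm \<Rightarrow> real" where
  "expected_early_restarts P \<delta> \<rho> \<theta> r0 T i =
     measure_pmf.expectation (batches_pmf P T)
       (\<lambda>\<omega>. real (num_early_restarts P \<delta> \<rho> \<theta> r0 T \<omega> i))"

text \<open>Starting an epoch consumes the full local data set, every other iteration one batch.\<close>
definition num_samples :: "('m::finite, 'a::euclidean_space) problem \<Rightarrow> real \<Rightarrow> real \<Rightarrow> real \<Rightarrow>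
    real \<Rightarrow> nat \<Rightarrow> 'm batches \<Rightarrow> nat" where
  "num_samples P \<delta> \<rho> \<theta> r0 T \<omega> = (\<Sum>i\<in>UNIV. \<Sum>t<T.
     if flag (run P \<delta> \<rho> \<theta> r0 \<omega> t i) then data_size P i else batch_size P i)"

definition expected_samples :: "('m::finite, 'a::euclidean_space) problem \<Rightarrow> real \<Rightarrow> real \<Rightarrow>
    real \<Rightarrow> real \<Rightarrow> nat \<Rightarrow> real" where
  "expected_samples P \<delta> \<rho> \<theta> r0 T =
     measure_pmf.expectation (batches_pmf P T) (\<lambda>\<omega>. real (num_samples P \<delta> \<rho> \<theta> r0 T \<omega>))"

text \<open>The output time is uniform on \<open>{0, \<dots>, T - 1}\<close> and independent of the batches.\<close>
definition expected_grad_mapping_sq :: "('m::finite, 'a::euclidean_space) problem \<Rightarrow> real \<Rightarrow> real \<Rightarrow>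
    real \<Rightarrow> real \<Rightarrow> nat \<Rightarrow> real" where
  "expected_grad_mapping_sq P \<delta> \<rho> \<theta> r0 T =
     measure_pmf.expectation (pair_pmf (batches_pmf P T) (pmf_of_set {..<T}))
       (\<lambda>(\<omega>, t_out). (norm (grad_mapping P \<delta> \<rho> \<theta> r0 \<omega> t_out))\<^sup>2)"

text \<open>The bound on \<open>L\<^bsub>min\<^esub>\<close> at all times and along every sample path that can occur.\<close>
definition L_min_bounded :: "('m::finite, 'a::euclidean_space) problem \<Rightarrow> real \<Rightarrow> real \<Rightarrow> real \<Rightarrow> real \<Rightarrow>
    real \<Rightarrow> bool" where
  "L_min_bounded P \<delta> \<rho> \<theta> r0 Lbar \<longleftrightarrow>
     (\<forall>\<omega>. (\<forall>i t. \<omega> (i, t) \<in> admissible_batches P i) \<longrightarrow> (\<forall>t. L_min P \<delta> \<rho> \<theta> r0 \<omega> t \<le> Lbar))"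

end

(*
Because W contracts deviations from the mean by \<eta> and clipping bounds every step by \<delta>, the agents
stay within c \<delta> / 2 of each other, so all iterates of times t and t+1 lie in every ball
B(x_i^c, r0): along the whole run the gradients are Lipschitz with constant l = L_min^t, and l changes
by a factor of at most \<gamma> per step, where \<gamma> \<eta> \<le> (1 + \<eta>) / 2.  Hence the l-weighted disagreement, the
weighted tracking error and the length of the moves are geometric convolutions of the weighted step
energy U = \<Sum> l \<Sum>_i |u_i|^2 and of the estimator error.  The latter is controlled only in expectation:
within an epoch the variance of the recursive estimator is the accumulated L_i^2 |x^(t+1) - x^t|^2 / B_i,
charged at most \<tau>_i = B_i times.  Feeding this into the descent inequality for f at the mean iterate
gives \<theta> E U \<le> 4 m \<Delta>_f.  An early restart forces the mean to travel \<rho> / 2 within an epoch and so costs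
energy \<rho>^2 / (4 \<tau>_i), and |G|^2 is bounded by the step energy plus the gradient error.
*)
theory Submission
  imports Defs
begin

text \<open>The estimates are circular: the step energy is bounded by the gradient error, that by
  the estimator error, that by the length of the moves, and the moves again by the step energy. The
  loop closes because the gradient error enters the descent inequality divided by
  \<open>2 * \<theta>\<close>, while the whole circuit multiplies the energy by at most
  \<open>33384 / (1 - \<eta>)^4\<close>; with \<open>9600 / (1 - \<eta>)^4 \<le> \<theta>\<close>
  the product is at most 2, which the leading coefficient \<open>\<theta> / 2\<close> absorbs. One
  link, the bound on the estimator error, holds only on average, although the epochs and weights are
  themselves random. All other links are therefore proved on every sample path, as inequalities
  linear in weighted sums, and only then averaged. Squared displacements are multiplied by
  \<open>lmin\<close> and squared gradients divided by it, so that all sums are in the unit of the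
  objective and can be added. Conditional expectations are replaced by redrawing one independent
  batch while all the others stay fixed.\<close>

section \<open>Spectral contraction of the mixing matrix\<close>

text \<open>The Rayleigh quotient attains its maximum on the compact unit sphere of
  \<open>S\<close>. The residual \<open>z\<close> of a maximizer stays in \<open>S\<close> and would
  be a direction of ascent unless it vanishes, so the maximizer is an eigenvector.\<close>

lemma symmetric_rayleigh_maximizer:
  fixes A :: "real^'n^'n"
  assumes sym: "transpose A = A" and S: "subspace S" and inv: "\<And>v. v \<in> S \<Longrightarrow> A *v v \<in> S"
    and nontriv: "S \<noteq> {0}"
  shows "\<exists>v \<mu>. v \<in> S \<and> v \<noteq> 0 \<and> A *v v = \<mu> *\<^sub>R v \<and> (\<forall>w\<in>S. w \<bullet> (A *v w) \<le> \<mu> * (w \<bullet> w))"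
proof -
  obtain s where s: "s \<in> S" "s \<noteq> 0" using nontriv S subspace_0 by fastforce
  let ?K = "S \<inter> sphere 0 1"
  have "(1 / norm s) *\<^sub>R s \<in> ?K"
    using s S by (simp add: subspace_scale)
  moreover have "compact ?K"
    using closed_subspace[OF S] by (intro closed_Int_compact) auto
  moreover have "continuous_on ?K (\<lambda>w. w \<bullet> (A *v w))"
    by (intro continuous_intros linear_continuous_on) (simp add: linear_linear)
  ultimately obtain v where v: "v \<in> ?K" "\<And>w. w \<in> ?K \<Longrightarrow> w \<bullet> (A *v w) \<le> v \<bullet> (A *v v)"
    using continuous_attains_sup[of ?K] by blast
  define \<mu> where "\<mu> = v \<bullet> (A *v v)"
  have vv: "v \<bullet> v = 1" "v \<in> S" using v(1) by (auto simp: dot_square_norm)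
  have max: "w \<bullet> (A *v w) \<le> \<mu> * (w \<bullet> w)" if w: "w \<in> S" for w
  proof (cases "w = 0")
    case False
    have "(1 / norm w) *\<^sub>R w \<in> ?K" using w S False by (simp add: subspace_scale)
    from v(2)[OF this] have "(w \<bullet> (A *v w)) / (norm w)\<^sup>2 \<le> \<mu>"
      by (simp add: \<mu>_def matrix_vector_mult_scaleR power2_eq_square)
    then show ?thesis using False by (simp add: dot_square_norm field_simps)
  qed simp
  define z where "z = A *v v - \<mu> *\<^sub>R v"
  have zS: "z \<in> S" using vv inv S by (simp add: z_def subspace_diff subspace_scale)
  define a where "a = z \<bullet> z"
  define c where "c = \<mu> * a - z \<bullet> (A *v z)"
  \<comment> \<open>The deficit \<open>\<mu> * (w \<bullet> w) - w \<bullet> (A *v w)\<close> is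
    nonnegative along \<open>w = v + t *\<^sub>R z\<close>, vanishes at \<open>t = 0\<close> and has
    slope \<open>- 2 * a\<close> there, which will force \<open>a\<close> to be zero.\<close>
  have quad: "0 \<le> - 2 * t * a + t\<^sup>2 * c" for t
  proof -
    have "v + t *\<^sub>R z \<in> S" using vv zS S by (simp add: subspace_add subspace_scale)
    from max[OF this] have "0 \<le> \<mu> * ((v + t *\<^sub>R z) \<bullet> (v + t *\<^sub>R z)) - (v + t *\<^sub>R z) \<bullet> (A *v (v + t *\<^sub>R z))"
      by simp
    also have "\<dots> = \<mu> * (1 + 2 * t * (v \<bullet> z) + t\<^sup>2 * a) - (\<mu> + 2 * t * (z \<bullet> (A *v v)) + t\<^sup>2 * (z \<bullet> (A *v z)))"
    proof -
      have "(v + t *\<^sub>R z) \<bullet> (v + t *\<^sub>R z) = 1 + 2 * t * (v \<bullet> z) + t\<^sup>2 * a"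
        using vv(1) by (simp add: inner_left_distrib inner_right_distrib a_def power2_eq_square
            inner_commute[of z v] algebra_simps)
      moreover have "(v + t *\<^sub>R z) \<bullet> (A *v (v + t *\<^sub>R z))
          = \<mu> + 2 * t * (z \<bullet> (A *v v)) + t\<^sup>2 * (z \<bullet> (A *v z))"
        using symmetric_matrix_inner[OF sym, of v z] inner_commute[of z "A *v v"]
        by (simp add: matrix_vector_right_distrib matrix_vector_mult_scaleR inner_left_distrib
          inner_right_distrib \<mu>_def power2_eq_square algebra_simps)
      ultimately show ?thesis by simp
    qed
    also have "\<dots> = 2 * t * (\<mu> * (v \<bullet> z) - z \<bullet> (A *v v)) + t\<^sup>2 * c"
      by (simp add: c_def algebra_simps)
    also have "\<mu> * (v \<bullet> z) - z \<bullet> (A *v v) = - a"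
    proof -
      have "a = z \<bullet> (A *v v) - \<mu> * (z \<bullet> v)"
        unfolding a_def by (subst (2) z_def) (simp add: inner_diff_right)
      then show ?thesis by (simp add: inner_commute[of v z])
    qed
    finally show ?thesis by simp
  qed
  have "a \<le> 0"
  proof (rule ccontr)
    assume "\<not> a \<le> 0"
    \<comment> \<open>Small enough that the quadratic term takes back at most half of the linear
      term \<open>2 * t * a\<close>.\<close>
    define t where "t = a / (1 + \<bar>c\<bar>)"
    have t: "t > 0" using \<open>\<not> a \<le> 0\<close> by (simp add: t_def add_pos_nonneg)
    have "t * c \<le> t * (1 + \<bar>c\<bar>)" using t by (intro mult_left_mono) auto
    also have "\<dots> = a" by (simp add: t_def)
    finally have tc: "t * c \<le> a" .
    have "0 \<le> t * (- 2 * a + t * c)"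
      using quad[of t] by (simp add: power2_eq_square algebra_simps)
    then have "0 \<le> - 2 * a + t * c" using t by (simp add: zero_le_mult_iff)
    then show False using tc \<open>\<not> a \<le> 0\<close> by simp
  qed
  then have "z = 0" using inner_ge_zero[of z] inner_eq_zero_iff[of z] unfolding a_def by linarith
  then have "A *v v = \<mu> *\<^sub>R v" by (simp add: z_def)
  moreover have "v \<noteq> 0" using vv by auto
  ultimately show ?thesis using vv(2) max by blast
qed

lemma dim_eigenspace_pos:
  fixes A :: "real^'n^'n"
  assumes "eigenvalue A \<mu>"
  shows "1 \<le> dim (eigenspace A \<mu>)"
proof -
  obtain v where "v \<noteq> 0" "v \<in> eigenspace A \<mu>"
    using assms by (auto simp: eigenvalue_def eigenspace_def)
  then have "dim (eigenspace A \<mu>) \<noteq> 0" by (auto simp: dim_eq_0)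
  then show ?thesis by linarith
qed

text \<open>For \<open>transpose W ** W\<close> the vector \<open>1\<close> already has the
  eigenvalue \<open>1 > \<eta>\<^sup>2\<close>. A top eigenvalue above \<open>\<eta>\<^sup>2\<close>
  on the orthogonal complement of \<open>1\<close> would give two eigenvalues, with multiplicity,
  above the second largest one.\<close>

lemma mixing_contracts_orthogonal:
  fixes W :: "real^'n^'n"
  assumes W: "W *v 1 = 1" "transpose W *v 1 = 1" and eta: "second_largest_modulus W \<eta>" "\<eta> < 1"
    and v: "v \<bullet> 1 = 0"
  shows "(W *v v) \<bullet> (W *v v) \<le> \<eta>\<^sup>2 * (v \<bullet> v)"
proof (cases "{v. v \<bullet> (1::real^'n) = 0} = {0}")
  case True
  then show ?thesis using v by (simp add: set_eq_iff)
next
  case False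
  let ?A = "transpose W ** W"
  have sym: "transpose ?A = ?A"
    by (simp add: matrix_transpose_mul)
  have A1: "?A *v 1 = 1" using W by (simp flip: matrix_vector_mul_assoc)
  have S: "subspace {v. v \<bullet> (1::real^'n) = 0}"
    by (auto simp: subspace_def inner_left_distrib)
  have inv: "?A *v w \<in> {v. v \<bullet> (1::real^'n) = 0}" if "w \<in> {v. v \<bullet> (1::real^'n) = 0}" for w
    using symmetric_matrix_inner[OF sym, of w 1] A1 that by simp
  obtain w \<mu> where wS: "w \<in> {v. v \<bullet> (1::real^'n) = 0}" "w \<noteq> 0" "?A *v w = \<mu> *\<^sub>R w"
    and max: "\<forall>v\<in>{v. v \<bullet> (1::real^'n) = 0}. v \<bullet> (?A *v v) \<le> \<mu> * (v \<bullet> v)"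
    using symmetric_rayleigh_maximizer[OF sym S inv False] by blast
  then have w: "w \<bullet> 1 = 0" "w \<noteq> 0" "?A *v w = \<mu> *\<^sub>R w" by auto
  have "\<mu> \<le> \<eta>\<^sup>2"
  proof (rule ccontr)
    assume "\<not> \<mu> \<le> \<eta>\<^sup>2"
    let ?E = "{\<nu>. eigenvalue ?A \<nu> \<and> \<nu> > \<eta>\<^sup>2}"
    have eta0: "0 \<le> \<eta>" and le2: "(\<Sum>\<nu>\<in>?E. dim (eigenspace ?A \<nu>)) < 2"
      using eta(1) by (simp_all add: second_largest_modulus_def second_largest_eigenvalue_def)
    have "finite ?E"
      using finite_eigenvalues_symmetric[OF sym] by (rule rev_finite_subset) auto
    have "\<eta>\<^sup>2 < 1" using eta0 eta(2) by (simp add: power_less_one_iff)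
    then have E1: "1 \<in> ?E" unfolding eigenvalue_def using A1 by (intro CollectI conjI exI[of _ 1]) auto
    have E2: "\<mu> \<in> ?E" unfolding eigenvalue_def using w \<open>\<not> \<mu> \<le> \<eta>\<^sup>2\<close> by (intro CollectI conjI exI[of _ w]) auto
    show False
    \<comment> \<open>If \<open>\<mu> = 1\<close>, both eigenvectors lie in one eigenspace and its
      dimension has to count them; otherwise they belong to two distinct eigenvalues.\<close>
    proof (cases "\<mu> = 1")
      case True
      have ind: "independent {w, 1}"
      proof (rule pairwise_orthogonal_independent)
        show "pairwise orthogonal {w, 1}"
          using w(1) by (auto simp: pairwise_def orthogonal_def inner_commute)
      qed (use w in auto)
      have "w \<noteq> 1" using w by auto
      have "{w, 1} \<subseteq> eigenspace ?A 1"
        using w A1 True by (auto simp: eigenspace_def)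
      then have "2 \<le> dim (eigenspace ?A 1)"
        using ind \<open>w \<noteq> 1\<close> independent_card_le_dim[of "{w, 1}" "eigenspace ?A 1"] by simp
      moreover have "dim (eigenspace ?A 1) \<le> (\<Sum>\<nu>\<in>?E. dim (eigenspace ?A \<nu>))"
        using \<open>finite ?E\<close> E1 by (intro member_le_sum) auto
      ultimately show False using le2 by simp
    next
      case False
      have "(\<Sum>\<nu>\<in>{1, \<mu>}. dim (eigenspace ?A \<nu>)) \<le> (\<Sum>\<nu>\<in>?E. dim (eigenspace ?A \<nu>))"
        using \<open>finite ?E\<close> E1 E2 by (intro sum_mono2) auto
      moreover have "1 \<le> dim (eigenspace ?A 1)" "1 \<le> dim (eigenspace ?A \<mu>)"
        using E1 E2 dim_eigenspace_pos by auto
      ultimately show False using le2 False by simp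
    qed
  qed
  have "(W *v v) \<bullet> (W *v v) = v \<bullet> (?A *v v)"
    using dot_lmul_matrix[of v "transpose W" "W *v v"]
    by (simp add: vector_transpose_matrix matrix_vector_mul_assoc)
  also have "\<dots> \<le> \<mu> * (v \<bullet> v)" using max v by simp
  also have "\<dots> \<le> \<eta>\<^sup>2 * (v \<bullet> v)" using \<open>\<mu> \<le> \<eta>\<^sup>2\<close> by (intro mult_right_mono) auto
  finally show ?thesis .
qed

section \<open>Families of vectors indexed by the agents\<close>

definition sq_sum :: "('m::finite \<Rightarrow> 'a::euclidean_space) \<Rightarrow> real" where
  "sq_sum v = (\<Sum>i\<in>UNIV. (norm (v i))\<^sup>2)"

definition mean :: "('m::finite \<Rightarrow> 'a::euclidean_space) \<Rightarrow> 'a" where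
  "mean v = (1 / real CARD('m)) *\<^sub>R (\<Sum>i\<in>UNIV. v i)"

definition deviation :: "('m::finite \<Rightarrow> 'a::euclidean_space) \<Rightarrow> 'm \<Rightarrow> 'a" where
  "deviation v i = v i - mean v"

text \<open>The Kronecker product of \<open>W\<close> with the identity of the ambient space, acting
  on the stacked vector.\<close>

definition mix :: "real^'m^'m \<Rightarrow> ('m::finite \<Rightarrow> 'a::euclidean_space) \<Rightarrow> 'm \<Rightarrow> 'a" where
  "mix W v i = (\<Sum>j\<in>UNIV. W $ i $ j *\<^sub>R v j)"

lemma mean_add: "mean (\<lambda>i. v i + w i) = mean v + mean w"
  by (simp add: mean_def sum.distrib scaleR_right_distrib)

lemma mean_diff: "mean (\<lambda>i. v i - w i) = mean v - mean w"
  by (simp add: mean_def sum_subtractf scaleR_right_diff_distrib)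

lemma deviation_add: "deviation (\<lambda>i. v i + w i) = (\<lambda>i. deviation v i + deviation w i)"
  by (simp add: fun_eq_iff deviation_def mean_add)

lemma sum_deviation: "(\<Sum>i\<in>UNIV. deviation v i) = 0"
  by (simp add: deviation_def sum_subtractf mean_def sum_constant_scaleR)

lemma sq_sum_nonneg: "0 \<le> sq_sum v"
  by (simp add: sq_sum_def sum_nonneg)

lemma norm_sq_le_sq_sum: "(norm (v i))\<^sup>2 \<le> sq_sum v"
  unfolding sq_sum_def by (rule member_le_sum) auto

text \<open>Counting two agents at once, rather than one agent twice, later keeps the distance
  between two agents within \<open>spread\<close>.\<close>

lemma norm_sq_add_le_add_sq_sum:
  assumes "i \<noteq> j"
  shows "(norm (v i))\<^sup>2 + (norm (v j))\<^sup>2 \<le> sq_sum v"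
proof -
  have "(\<Sum>k\<in>{i, j}. (norm (v k))\<^sup>2) \<le> sq_sum v"
    unfolding sq_sum_def by (rule sum_mono2) auto
  then show ?thesis using assms by simp
qed

text \<open>Pythagoras: the cross term vanishes because the deviations sum to zero.\<close>

lemma sq_sum_mean_deviation:
  fixes v :: "'m::finite \<Rightarrow> 'a::euclidean_space"
  shows "sq_sum v = sq_sum (deviation v) + real CARD('m) * (norm (mean v))\<^sup>2"
proof -
  have "(norm (v i))\<^sup>2 = (norm (deviation v i))\<^sup>2 + 2 * (deviation v i \<bullet> mean v) + (norm (mean v))\<^sup>2" for i
    unfolding power2_norm_eq_inner deviation_def by (simp add: algebra_simps inner_commute)
  then have "sq_sum v = sq_sum (deviation v) + 2 * ((\<Sum>i\<in>UNIV. deviation v i) \<bullet> mean v)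
      + real CARD('m) * (norm (mean v))\<^sup>2"
    unfolding sq_sum_def by (simp add: sum.distrib inner_sum_left sum_distrib_left)
  then show ?thesis by (simp add: sum_deviation)
qed

lemma sq_sum_deviation_le: "sq_sum (deviation v) \<le> sq_sum v"
  by (simp add: sq_sum_mean_deviation[of v])

lemma norm_mean_sq_le:
  fixes v :: "'m::finite \<Rightarrow> 'a::euclidean_space"
  shows "real CARD('m) * (norm (mean v))\<^sup>2 \<le> sq_sum v"
  using sq_sum_nonneg[of "deviation v"] by (simp add: sq_sum_mean_deviation[of v])

text \<open>Young's inequality with conjugate weights. Dividing by \<open>\<eta>\<close> turns a
  contraction factor \<open>\<eta>\<^sup>2\<close> of squared norms into \<open>\<eta>\<close>,
  which still contracts.\<close>

lemma norm_add_sq_weighted: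
  fixes v w :: "'a::real_inner"
  assumes "0 < \<eta>" "\<eta> < 1"
  shows "(norm (v + w))\<^sup>2 \<le> (norm v)\<^sup>2 / \<eta> + (norm w)\<^sup>2 / (1 - \<eta>)"
proof -
  have "(norm (v + w))\<^sup>2 \<le> (norm v + norm w)\<^sup>2"
    by (simp add: norm_triangle_ineq power_mono)
  also have "\<dots> \<le> (norm v)\<^sup>2 / \<eta> + (norm w)\<^sup>2 / (1 - \<eta>)"
  proof -
    have "(norm v)\<^sup>2 / \<eta> + (norm w)\<^sup>2 / (1 - \<eta>) - (norm v + norm w)\<^sup>2
        = ((1 - \<eta>) * norm v - \<eta> * norm w)\<^sup>2 / (\<eta> * (1 - \<eta>))"
      using assms by (simp add: field_simps power2_eq_square)
    also have "\<dots> \<ge> 0" using assms by simp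
    finally show ?thesis by simp
  qed
  finally show ?thesis .
qed

lemma sq_sum_add_weighted:
  assumes "0 < \<eta>" "\<eta> < 1"
  shows "sq_sum (\<lambda>i. v i + w i) \<le> sq_sum v / \<eta> + sq_sum w / (1 - \<eta>)"
  unfolding sq_sum_def sum_divide_distrib sum.distrib[symmetric]
  by (intro sum_mono norm_add_sq_weighted assms)

lemma norm_add3_sq_le:
  fixes a b c :: "'a::real_inner"
  shows "(norm (a + b + c))\<^sup>2 \<le> 3 * ((norm a)\<^sup>2 + (norm b)\<^sup>2 + (norm c)\<^sup>2)"
proof -
  have "(norm (a + b + c))\<^sup>2 \<le> 3 * ((norm a)\<^sup>2 + (norm b)\<^sup>2 + (norm c)\<^sup>2)
      - ((norm (a - b))\<^sup>2 + (norm (a - c))\<^sup>2 + (norm (b - c))\<^sup>2)"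
    unfolding power2_norm_eq_inner by (simp add: algebra_simps inner_commute)
  then show ?thesis by (smt (verit) zero_le_power2)
qed

lemma norm_sum_sq_le:
  fixes v :: "'i \<Rightarrow> 'a::real_normed_vector"
  shows "(norm (\<Sum>i\<in>I. v i))\<^sup>2 \<le> real (card I) * (\<Sum>i\<in>I. (norm (v i))\<^sup>2)"
proof -
  have "(norm (\<Sum>i\<in>I. v i))\<^sup>2 \<le> (\<Sum>i\<in>I. norm (v i))\<^sup>2"
    by (simp add: norm_sum power_mono)
  also have "\<dots> \<le> real (card I) * (\<Sum>i\<in>I. (norm (v i))\<^sup>2)"
    using sum_squared_le_sum_of_squares[of "\<lambda>i. norm (v i)" I] by (simp add: mult.commute)
  finally show ?thesis .
qed

lemma mean_mix:
  assumes "transpose W *v 1 = 1"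
  shows "mean (mix W v) = mean v"
proof -
  have W: "(\<Sum>i\<in>UNIV. W $ i $ j) = 1" for j
    using arg_cong[OF assms, of "\<lambda>v. v $ j"] by (simp add: matrix_vector_mult_def transpose_def)
  have "(\<Sum>i\<in>UNIV. mix W v i) = (\<Sum>j\<in>UNIV. (\<Sum>i\<in>UNIV. W $ i $ j) *\<^sub>R v j)"
    unfolding mix_def scaleR_left.sum by (rule sum.swap)
  then show ?thesis by (simp add: mean_def W)
qed

lemma mix_diff_const:
  assumes "W *v 1 = 1"
  shows "mix W (\<lambda>j. v j - c) i = mix W v i - c"
proof -
  have W: "(\<Sum>j\<in>UNIV. W $ i $ j) = 1"
    using arg_cong[OF assms, of "\<lambda>v. v $ i"] by (simp add: matrix_vector_mult_def)
  have "(\<Sum>j\<in>UNIV. W $ i $ j *\<^sub>R c) = c"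
    using W by (simp flip: scaleR_left.sum)
  then show ?thesis by (simp add: mix_def scaleR_right_diff_distrib sum_subtractf)
qed

text \<open>The scalar spectral bound applies in each coordinate of the basis, where the deviations
  form a vector orthogonal to \<open>1\<close>.\<close>

lemma sq_sum_mix_deviation_le:
  fixes W :: "real^'m^'m" and v :: "'m \<Rightarrow> 'a::euclidean_space"
  assumes W: "W *v 1 = 1" "transpose W *v 1 = 1" and eta: "second_largest_modulus W \<eta>" "\<eta> < 1"
  shows "sq_sum (mix W (deviation v)) \<le> \<eta>\<^sup>2 * sq_sum (deviation v)"
proof -
  define d where "d b = (\<chi> i. deviation v i \<bullet> b)" for b
  have coord: "sq_sum w = (\<Sum>b\<in>Basis. (\<chi> i. w i \<bullet> b) \<bullet> (\<chi> i. w i \<bullet> b))" for w :: "'m \<Rightarrow> 'a"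
    unfolding sq_sum_def power2_norm_eq_inner
    by (subst euclidean_inner) (simp add: inner_vec_def sum.swap[of _ Basis])
  have Wd: "(\<chi> i. mix W (deviation v) i \<bullet> b) = W *v d b" for b
    by (simp add: vec_eq_iff mix_def d_def inner_sum_left matrix_vector_mult_def)
  have d0: "d b \<bullet> 1 = 0" for b
    using sum_deviation[of v] by (simp add: d_def inner_vec_def flip: inner_sum_left)
  have "sq_sum (mix W (deviation v)) = (\<Sum>b\<in>Basis. (W *v d b) \<bullet> (W *v d b))"
    by (simp add: coord Wd)
  also have "\<dots> \<le> (\<Sum>b\<in>Basis. \<eta>\<^sup>2 * (d b \<bullet> d b))"
    by (intro sum_mono mixing_contracts_orthogonal W eta d0)
  also have "\<dots> = \<eta>\<^sup>2 * sq_sum (deviation v)"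
    by (simp add: coord[of "deviation v"] d_def sum_distrib_left)
  finally show ?thesis .
qed

text \<open>Serves two recursions: for the iterates \<open>w\<close> is the negative update, for the
  trackers it is the increment of the estimators.\<close>

lemma sq_sum_deviation_mix_add_le:
  fixes W :: "real^'m^'m" and v w :: "'m \<Rightarrow> 'a::euclidean_space"
  assumes W: "W *v 1 = 1" "transpose W *v 1 = 1" and eta: "second_largest_modulus W \<eta>" "0 < \<eta>" "\<eta> < 1"
  shows "sq_sum (deviation (\<lambda>i. mix W v i + w i)) \<le> \<eta> * sq_sum (deviation v) + sq_sum w / (1 - \<eta>)"
proof -
  have "deviation (\<lambda>i. mix W v i + w i) = (\<lambda>i. mix W (deviation v) i + deviation w i)"
    unfolding deviation_add
    by (simp add: fun_eq_iff deviation_def[of v, abs_def] mix_diff_const[OF W(1)])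
      (simp add: deviation_def mean_mix[OF W(2)])
  then have "sq_sum (deviation (\<lambda>i. mix W v i + w i))
      \<le> sq_sum (mix W (deviation v)) / \<eta> + sq_sum (deviation w) / (1 - \<eta>)"
    using sq_sum_add_weighted[OF eta(2,3)] by simp
  also have "\<dots> \<le> (\<eta>\<^sup>2 * sq_sum (deviation v)) / \<eta> + sq_sum w / (1 - \<eta>)"
    using eta by (intro add_mono divide_right_mono sq_sum_mix_deviation_le W sq_sum_deviation_le) auto
  also have "\<dots> = \<eta> * sq_sum (deviation v) + sq_sum w / (1 - \<eta>)"
    using eta by (simp add: power2_eq_square)
  finally show ?thesis .
qed

section \<open>Clipping, Hausdorff distance of balls, gradients\<close>

lemma norm_clip_le:
  assumes "0 < \<beta>" "0 < \<delta>"
  shows "norm (clip \<beta> \<delta> v) \<le> \<delta>"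
proof (cases "norm v \<le> \<beta> * \<delta>")
  case True
  then show ?thesis using assms by (simp add: clip_def field_simps)
next
  case False
  then have "norm v \<noteq> 0" using assms by (smt (verit) mult_pos_pos)
  then show ?thesis using assms False by (simp add: clip_def)
qed

text \<open>The scaled vector is the projection of \<open>v\<close> onto the ball of radius
  \<open>\<beta> * \<delta>\<close> around the origin.\<close>

lemma norm_scaled_clip:
  assumes "0 < \<beta>" "0 < \<delta>"
  shows "norm (\<beta> *\<^sub>R clip \<beta> \<delta> v) = min (norm v) (\<beta> * \<delta>)"
proof (cases "norm v \<le> \<beta> * \<delta>")
  case True
  then show ?thesis using assms by (simp add: clip_def)
next
  case False
  then have "norm v \<noteq> 0" using assms by (smt (verit) mult_pos_pos)
  then show ?thesis using assms False by (simp add: clip_def)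
qed

text \<open>Clipping multiplies \<open>v\<close> by a nonnegative scalar of at most
  \<open>1 / \<beta>\<close>, so \<open>v\<close> is at least \<open>\<beta>\<close> times as long
  as the clipped vector and has the same direction.\<close>

lemma inner_clip_ge:
  assumes "0 < \<beta>" "0 < \<delta>"
  shows "\<beta> * (norm (clip \<beta> \<delta> v))\<^sup>2 \<le> v \<bullet> clip \<beta> \<delta> v"
proof (cases "norm v \<le> \<beta> * \<delta>")
  case True
  have "v \<bullet> clip \<beta> \<delta> v = \<beta> * (norm (clip \<beta> \<delta> v))\<^sup>2"
    using assms True by (simp add: clip_def power2_eq_square dot_square_norm)
  then show ?thesis by simp
next
  case False
  then have v: "norm v > 0" "\<beta> * \<delta> \<le> norm v" using assms by (smt (verit) mult_pos_pos)+
  have "v \<bullet> clip \<beta> \<delta> v = \<delta> * norm v"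
    using v False by (simp add: clip_def dot_square_norm power2_eq_square)
  moreover have "(norm (clip \<beta> \<delta> v))\<^sup>2 = \<delta> * \<delta>"
    using v False assms by (simp add: clip_def power2_eq_square)
  moreover have "\<beta> * (\<delta> * \<delta>) \<le> \<delta> * norm v"
    using mult_left_mono[OF v(2), of \<delta>] assms by (simp add: ac_simps)
  ultimately show ?thesis by simp
qed

lemma infdist_cball_le:
  fixes a b x :: "'a::euclidean_space"
  assumes "x \<in> cball a r"
  shows "infdist x (cball b r) \<le> dist a b"
proof -
  have "x + (b - a) \<in> cball b r" using assms by (simp add: dist_norm algebra_simps)
  then have "infdist x (cball b r) \<le> dist x (x + (b - a))" by (rule infdist_le)
  also have "\<dots> = dist a b" by (simp add: dist_norm norm_minus_commute)
  finally show ?thesis .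
qed

lemma hausdorff_dist_cball_le:
  fixes a b :: "'a::euclidean_space"
  assumes "0 \<le> r"
  shows "hausdorff_dist (cball a r) (cball b r) \<le> dist a b"
proof -
  have "(SUP x\<in>cball a r. infdist x (cball b r)) \<le> dist a b"
    using assms by (intro cSUP_least infdist_cball_le) auto
  moreover have "(SUP y\<in>cball b r. infdist y (cball a r)) \<le> dist b a"
    using assms by (intro cSUP_least infdist_cball_le) auto
  ultimately show ?thesis by (simp add: hausdorff_dist_def dist_commute)
qed

lemma GDERIV_unique:
  fixes x :: "'a::euclidean_space"
  assumes "GDERIV f x :> D" "GDERIV f x :> E"
  shows "D = E"
proof -
  have "(\<lambda>h. h \<bullet> D) = (\<lambda>h. h \<bullet> E)"
    using assms unfolding gderiv_def by (rule has_derivative_unique)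
  then have "h \<bullet> (D - E) = 0" for h by (simp add: fun_eq_iff inner_diff_right)
  from this[of "D - E"] show ?thesis by simp
qed

lemma grad_eqI:
  assumes "GDERIV f x :> D"
  shows "grad f x = D"
  unfolding grad_def using assms by (rule the_equality) (use assms GDERIV_unique in blast)

text \<open>Riesz representation: the vector whose coordinates are the values of the derivative on
  the basis is the gradient.\<close>

lemma GDERIV_grad:
  fixes x :: "'a::euclidean_space"
  assumes "f differentiable (at x)"
  shows "GDERIV f x :> grad f x"
proof -
  obtain D where D: "(f has_derivative D) (at x)" using assms by (auto simp: differentiable_def)
  interpret linear D using D by (rule has_derivative_linear)
  define g where "g = (\<Sum>b\<in>Basis. D b *\<^sub>R b)"
  have "D = (\<lambda>h. h \<bullet> g)"
  proof
    fix h
    have "D h = D (\<Sum>b\<in>Basis. (h \<bullet> b) *\<^sub>R b)" by (simp add: euclidean_representation)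
    also have "\<dots> = h \<bullet> g" by (simp add: sum scaleR g_def inner_sum_right mult.commute)
    finally show "D h = h \<bullet> g" .
  qed
  then have "GDERIV f x :> g" using D by (simp add: gderiv_def)
  then show ?thesis using grad_eqI by metis
qed

lemma GDERIV_average:
  assumes "\<And>i. i \<in> I \<Longrightarrow> GDERIV (f i) x :> D i"
  shows "GDERIV (\<lambda>x. (\<Sum>i\<in>I. f i x) / n) x :> (1 / n) *\<^sub>R (\<Sum>i\<in>I. D i)"
proof -
  have "((\<lambda>x. (1 / n) *\<^sub>R (\<Sum>i\<in>I. f i x)) has_derivative (\<lambda>h. (1 / n) *\<^sub>R (\<Sum>i\<in>I. h \<bullet> D i))) (at x)"
    using assms unfolding gderiv_def by (intro has_derivative_scaleR_right has_derivative_sum)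
  then show ?thesis by (simp add: gderiv_def inner_sum_right)
qed

text \<open>Gradients are Lipschitz only locally here, so the bound is requested on the segment
  alone. Up to a constant, \<open>\<phi>\<close> is \<open>f\<close> along the segment minus the
  quadratic model, and the Lipschitz bound makes it nonincreasing.\<close>

lemma smooth_upper_bound:
  fixes x y :: "'a::euclidean_space"
  assumes G: "\<And>z. z \<in> closed_segment x y \<Longrightarrow> GDERIV f z :> G z"
    and L: "\<And>z. z \<in> closed_segment x y \<Longrightarrow> norm (G z - G x) \<le> L * norm (z - x)"
  shows "f y \<le> f x + G x \<bullet> (y - x) + L / 2 * (norm (y - x))\<^sup>2"
proof -
  define d where "d = y - x"
  define \<phi> where "\<phi> s = f (x + s *\<^sub>R d) - s * (G x \<bullet> d) - L * s\<^sup>2 / 2 * (norm d)\<^sup>2" for s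
  have seg: "x + s *\<^sub>R d \<in> closed_segment x y" if "0 \<le> s" "s \<le> 1" for s
    using that unfolding closed_segment_def d_def
    by (intro CollectI exI[of _ s]) (simp add: algebra_simps)
  have "\<phi> 1 \<le> \<phi> 0"
  proof (rule DERIV_nonpos_imp_nonincreasing[of 0 1 \<phi>])
    fix s :: real assume s: "0 \<le> s" "s \<le> 1"
    let ?z = "x + s *\<^sub>R d"
    have "((\<lambda>s. f (x + s *\<^sub>R d)) has_derivative (\<lambda>h. (h *\<^sub>R d) \<bullet> G ?z)) (at s)"
      by (rule has_derivative_compose[of "\<lambda>s. x + s *\<^sub>R d"])
        (use G[OF seg[OF s]] in \<open>auto simp: gderiv_def intro!: derivative_eq_intros\<close>)
    then have "((\<lambda>s. f (x + s *\<^sub>R d)) has_real_derivative (d \<bullet> G ?z)) (at s)"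
      by (simp add: has_field_derivative_def mult.commute[of _ "d \<bullet> G ?z"])
    then have "(\<phi> has_real_derivative (d \<bullet> G ?z - G x \<bullet> d - L * s * (norm d)\<^sup>2)) (at s)"
      unfolding \<phi>_def by (auto intro!: derivative_eq_intros simp: field_simps)
    moreover have "d \<bullet> G ?z - G x \<bullet> d - L * s * (norm d)\<^sup>2 \<le> 0"
    proof -
      have "d \<bullet> G ?z - G x \<bullet> d = d \<bullet> (G ?z - G x)" by (simp add: inner_diff_right inner_commute)
      also have "\<dots> \<le> norm d * norm (G ?z - G x)" by (rule norm_cauchy_schwarz)
      also have "\<dots> \<le> norm d * (L * norm (?z - x))"
        by (intro mult_left_mono L seg s) auto
      also have "\<dots> = L * s * (norm d)\<^sup>2" using s by (simp add: power2_eq_square)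
      finally show ?thesis by simp
    qed
    ultimately show "\<exists>y. (\<phi> has_real_derivative y) (at s) \<and> y \<le> 0" by blast
  qed simp
  then show ?thesis by (simp add: \<phi>_def d_def)
qed

section \<open>Sampling without replacement\<close>

lemma card_subsets_containing:
  assumes "finite A" "S \<subseteq> A" "card S \<le> k"
  shows "card {B. B \<subseteq> A \<and> card B = k \<and> S \<subseteq> B} = (card A - card S) choose (k - card S)"
proof -
  have fS: "finite S" using assms finite_subset by blast
  have "bij_betw (\<lambda>B. B - S) {B. B \<subseteq> A \<and> card B = k \<and> S \<subseteq> B} {C. C \<subseteq> A - S \<and> card C = k - card S}"
  proof (rule bij_betwI[where g = "\<lambda>C. C \<union> S"])
    show "(\<lambda>B. B - S) \<in> {B. B \<subseteq> A \<and> card B = k \<and> S \<subseteq> B} \<rightarrow> {C. C \<subseteq> A - S \<and> card C = k - card S}"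
      using fS by (auto simp: card_Diff_subset)
    show "(\<lambda>C. C \<union> S) \<in> {C. C \<subseteq> A - S \<and> card C = k - card S} \<rightarrow> {B. B \<subseteq> A \<and> card B = k \<and> S \<subseteq> B}"
    proof
      fix C assume C: "C \<in> {C. C \<subseteq> A - S \<and> card C = k - card S}"
      then have "finite C" "C \<inter> S = {}" using assms(1) finite_subset by blast+
      then have "card (C \<union> S) = k" using C fS assms(3) by (simp add: card_Un_disjoint)
      then show "C \<union> S \<in> {B. B \<subseteq> A \<and> card B = k \<and> S \<subseteq> B}" using C assms(2) by auto
    qed
  qed auto
  then have "card {B. B \<subseteq> A \<and> card B = k \<and> S \<subseteq> B} = card {C. C \<subseteq> A - S \<and> card C = k - card S}"
    by (rule bij_betw_same_card)
  also have "\<dots> = (card A - card S) choose (k - card S)"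
    using assms fS by (simp add: n_subsets card_Diff_subset)
  finally show ?thesis .
qed

lemma sum_subsets_swap:
  fixes f :: "'b \<Rightarrow> 'c::real_vector"
  assumes "finite A"
  shows "(\<Sum>B | B \<subseteq> A \<and> card B = k. \<Sum>j\<in>B. f j)
    = (\<Sum>j\<in>A. real (card {B. B \<subseteq> A \<and> card B = k \<and> {j} \<subseteq> B}) *\<^sub>R f j)"
proof -
  let ?F = "{B. B \<subseteq> A \<and> card B = k}"
  have fin: "finite ?F" using assms by simp
  have "(\<Sum>B\<in>?F. \<Sum>j\<in>B. f j) = (\<Sum>B\<in>?F. \<Sum>j\<in>A. if j \<in> B then f j else 0)"
    using assms by (intro sum.cong refl sum.mono_neutral_cong_left) (auto simp: subset_iff)
  also have "\<dots> = (\<Sum>j\<in>A. \<Sum>B\<in>?F. if j \<in> B then f j else 0)"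
    by (rule sum.swap)
  also have "\<dots> = (\<Sum>j\<in>A. \<Sum>B | B \<subseteq> A \<and> card B = k \<and> {j} \<subseteq> B. f j)"
  proof (rule sum.cong[OF refl])
    fix j
    have "?F \<inter> {B. j \<in> B} = {B. B \<subseteq> A \<and> card B = k \<and> {j} \<subseteq> B}" by auto
    then show "(\<Sum>B\<in>?F. if j \<in> B then f j else 0) = (\<Sum>B | B \<subseteq> A \<and> card B = k \<and> {j} \<subseteq> B. f j)"
      using fin by (simp add: sum.If_cases)
  qed
  finally show ?thesis by (simp add: sum_constant_scaleR)
qed

text \<open>Sampling without replacement is symmetric: all pairs of distinct indices lie in the same
  number \<open>N2\<close> of batches. The cross terms assemble to \<open>N2\<close> times the
  square of the total sum, which is zero, and the remaining diagonal coefficient is at most the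
  number of batches through one index.\<close>

lemma sum_subsets_norm_sq_le:
  fixes b :: "'b \<Rightarrow> 'a::real_inner"
  assumes A: "finite A" and k: "1 \<le> k" "k \<le> card A" and b: "(\<Sum>j\<in>A. b j) = 0"
  shows "(\<Sum>B | B \<subseteq> A \<and> card B = k. (norm (\<Sum>j\<in>B. b j))\<^sup>2)
    \<le> real ((card A - 1) choose (k - 1)) * (\<Sum>j\<in>A. (norm (b j))\<^sup>2)"
proof -
  let ?F = "{B. B \<subseteq> A \<and> card B = k}"
  let ?N = "\<lambda>S. card {B. B \<subseteq> A \<and> card B = k \<and> S \<subseteq> B}"
  have fin: "finite ?F" using A by simp
  obtain N2 where N2: "\<And>j l. j \<in> A \<Longrightarrow> l \<in> A \<Longrightarrow> j \<noteq> l \<Longrightarrow> ?N {j, l} = N2"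
  \<comment> \<open>A batch of one index contains no pair, whereas the binomial formula with the
    truncated \<open>k - 2\<close> would count one.\<close>
  proof (cases "k = 1")
    case True
    have "{B. B \<subseteq> A \<and> card B = k \<and> {j, l} \<subseteq> B} = {}" if "j \<noteq> l" for j l
      using True that by (auto simp: card_1_singleton_iff)
    then have "?N {j, l} = 0" if "j \<noteq> l" for j l
      using that by (metis card.empty)
    then show ?thesis using that by blast
  next
    case False
    then have "?N {j, l} = (card A - 2) choose (k - 2)" if "j \<in> A" "l \<in> A" "j \<noteq> l" for j l
      using card_subsets_containing[OF A, of "{j, l}" k] that k by (simp add: numeral_2_eq_2)
    then show ?thesis using that by blast
  qed
  have N1: "?N {j} = (card A - 1) choose (k - 1)" if "j \<in> A" for j
    using card_subsets_containing[OF A, of "{j}" k] that k by simp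
  have "(norm (\<Sum>j\<in>B. b j))\<^sup>2 = (\<Sum>j\<in>A. \<Sum>l\<in>A. if j \<in> B \<and> l \<in> B then b j \<bullet> b l else 0)"
    if B: "B \<in> ?F" for B
  proof -
    have "(norm (\<Sum>j\<in>B. b j))\<^sup>2 = (\<Sum>j\<in>B. \<Sum>l\<in>B. b j \<bullet> b l)"
      unfolding power2_norm_eq_inner inner_sum_left inner_sum_right by (rule sum.swap)
    also have "\<dots> = (\<Sum>j\<in>B. \<Sum>l\<in>A. if j \<in> B \<and> l \<in> B then b j \<bullet> b l else 0)"
      using A B by (intro sum.cong refl sum.mono_neutral_cong_left) auto
    also have "\<dots> = (\<Sum>j\<in>A. \<Sum>l\<in>A. if j \<in> B \<and> l \<in> B then b j \<bullet> b l else 0)"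
      using A B by (intro sum.mono_neutral_left) auto
    finally show ?thesis .
  qed
  then have "(\<Sum>B\<in>?F. (norm (\<Sum>j\<in>B. b j))\<^sup>2)
      = (\<Sum>B\<in>?F. \<Sum>j\<in>A. \<Sum>l\<in>A. if j \<in> B \<and> l \<in> B then b j \<bullet> b l else 0)"
    by (intro sum.cong) auto
  also have "\<dots> = (\<Sum>j\<in>A. \<Sum>l\<in>A. \<Sum>B\<in>?F. if j \<in> B \<and> l \<in> B then b j \<bullet> b l else 0)"
    by (subst sum.swap, intro sum.cong refl, rule sum.swap)
  also have "\<dots> = (\<Sum>j\<in>A. \<Sum>l\<in>A. real (?N {j, l}) * (b j \<bullet> b l))"
  proof (intro sum.cong refl)
    fix j l
    have "?F \<inter> {B. j \<in> B \<and> l \<in> B} = {B. B \<subseteq> A \<and> card B = k \<and> {j, l} \<subseteq> B}" by auto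
    then show "(\<Sum>B\<in>?F. if j \<in> B \<and> l \<in> B then b j \<bullet> b l else 0) = real (?N {j, l}) * (b j \<bullet> b l)"
      using fin by (simp add: sum.If_cases)
  qed
  also have "\<dots> = (\<Sum>j\<in>A. \<Sum>l\<in>A. real N2 * (b j \<bullet> b l)
      + (if l = j then (real ((card A - 1) choose (k - 1)) - real N2) * (norm (b j))\<^sup>2 else 0))"
  proof (intro sum.cong refl)
    fix j l assume jl: "j \<in> A" "l \<in> A"
    show "real (?N {j, l}) * (b j \<bullet> b l) = real N2 * (b j \<bullet> b l)
      + (if l = j then (real ((card A - 1) choose (k - 1)) - real N2) * (norm (b j))\<^sup>2 else 0)"
    proof (cases "l = j")
      case True
      then have "?N {j, l} = (card A - 1) choose (k - 1)"
        using N1[OF jl(1)] by (simp only: insert_absorb2)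
      then show ?thesis using True by (simp add: power2_norm_eq_inner algebra_simps)
    next
      case False
      then have "?N {j, l} = N2" using N2[OF jl] by blast
      then show ?thesis using False by simp
    qed
  qed
  also have "\<dots> = real N2 * ((\<Sum>j\<in>A. b j) \<bullet> (\<Sum>l\<in>A. b l))
      + (real ((card A - 1) choose (k - 1)) - real N2) * (\<Sum>j\<in>A. (norm (b j))\<^sup>2)"
    unfolding inner_sum_left inner_sum_right sum.distrib
    using A by (subst sum.swap) (simp add: sum_distrib_left)
  also have "\<dots> \<le> real ((card A - 1) choose (k - 1)) * (\<Sum>j\<in>A. (norm (b j))\<^sup>2)"
    using b by (simp add: mult_right_mono sum_nonneg)
  finally show ?thesis .
qed

text \<open>The batch average is an unbiased estimate of the full average, so \<open>e\<close> and
  the noise are orthogonal on average; centring the vectors \<open>a j\<close> at their mean only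
  lowers their sum of squares.\<close>

lemma expectation_batch_norm_sq_le:
  fixes a :: "'b \<Rightarrow> 'a::real_inner"
  assumes A: "finite A" and k: "1 \<le> k" "k \<le> card A"
  shows "measure_pmf.expectation (pmf_of_set {B. B \<subseteq> A \<and> card B = k})
      (\<lambda>B. (norm (e + ((1 / real k) *\<^sub>R (\<Sum>j\<in>B. a j) - (1 / real (card A)) *\<^sub>R (\<Sum>j\<in>A. a j))))\<^sup>2)
    \<le> (norm e)\<^sup>2 + (1 / real k) * ((\<Sum>j\<in>A. (norm (a j))\<^sup>2) / real (card A))"
proof -
  let ?F = "{B. B \<subseteq> A \<and> card B = k}"
  define n where "n = card A"
  have n: "n \<ge> 1" "A \<noteq> {}" using k by (auto simp: n_def)
  define m where "m = (1 / real n) *\<^sub>R (\<Sum>j\<in>A. a j)"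
  define b where "b j = a j - m" for j
  define N1 where "N1 = (n - 1) choose (k - 1)"
  define N where "N = n choose k"
  have fin: "finite ?F" using A by simp
  have cF: "card ?F = N" using n_subsets[OF A] by (simp add: N_def n_def)
  have N: "N > 0" using k by (simp add: N_def n_def)
  have kN: "k * N = n * N1"
    using k n times_binomial_minus1_eq[of k n] by (simp add: N_def N1_def)
  have F: "?F \<noteq> {}" using N fin cF by (metis card.empty less_irrefl)
  have b0: "(\<Sum>j\<in>A. b j) = 0"
    using n by (simp add: b_def sum_subtractf m_def n_def[symmetric] sum_constant_scaleR)
  have bB: "(1 / real k) *\<^sub>R (\<Sum>j\<in>B. a j) - m = (1 / real k) *\<^sub>R (\<Sum>j\<in>B. b j)" if "B \<in> ?F" for B
    using that k by (simp add: b_def sum_subtractf sum_constant_scaleR scaleR_right_diff_distrib)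
  have mean0: "(\<Sum>B\<in>?F. \<Sum>j\<in>B. b j) = 0"
  proof -
    have "(\<Sum>B\<in>?F. \<Sum>j\<in>B. b j) = (\<Sum>j\<in>A. real N1 *\<^sub>R b j)"
      unfolding sum_subsets_swap[OF A]
      by (intro sum.cong refl) (use card_subsets_containing[OF A, of "{_}" k] k in \<open>simp add: N1_def n_def\<close>)
    then show ?thesis using b0 by (simp flip: scaleR_right.sum)
  qed
  have bsq: "(\<Sum>j\<in>A. (norm (b j))\<^sup>2) \<le> (\<Sum>j\<in>A. (norm (a j))\<^sup>2)"
  proof -
    have "(norm (a j))\<^sup>2 = (norm (b j))\<^sup>2 + 2 * (b j \<bullet> m) + (norm m)\<^sup>2" for j
      unfolding power2_norm_eq_inner b_def by (simp add: algebra_simps inner_commute)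
    then have "(\<Sum>j\<in>A. (norm (a j))\<^sup>2)
        = (\<Sum>j\<in>A. (norm (b j))\<^sup>2) + 2 * ((\<Sum>j\<in>A. b j) \<bullet> m) + real n * (norm m)\<^sup>2"
      by (simp add: sum.distrib inner_sum_left sum_distrib_left n_def)
    then show ?thesis using b0 by simp
  qed
  have "(\<Sum>B\<in>?F. (norm (e + ((1 / real k) *\<^sub>R (\<Sum>j\<in>B. a j) - m)))\<^sup>2)
      = (\<Sum>B\<in>?F. (norm e)\<^sup>2 + (2 / real k) * (e \<bullet> (\<Sum>j\<in>B. b j)) + (1 / (real k)\<^sup>2) * (norm (\<Sum>j\<in>B. b j))\<^sup>2)"
  proof (rule sum.cong[OF refl])
    fix B assume "B \<in> ?F"
    show "(norm (e + ((1 / real k) *\<^sub>R (\<Sum>j\<in>B. a j) - m)))\<^sup>2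
      = (norm e)\<^sup>2 + (2 / real k) * (e \<bullet> (\<Sum>j\<in>B. b j)) + (1 / (real k)\<^sup>2) * (norm (\<Sum>j\<in>B. b j))\<^sup>2"
      unfolding bB[OF \<open>B \<in> ?F\<close>] power2_norm_eq_inner
      by (simp add: inner_add_left inner_add_right inner_commute power2_eq_square)
  qed
  also have "\<dots> = real N * (norm e)\<^sup>2 + (2 / real k) * (e \<bullet> (\<Sum>B\<in>?F. \<Sum>j\<in>B. b j))
      + (1 / (real k)\<^sup>2) * (\<Sum>B\<in>?F. (norm (\<Sum>j\<in>B. b j))\<^sup>2)"
    unfolding sum.distrib by (simp add: cF sum_distrib_left inner_sum_right)
  also have "\<dots> \<le> real N * (norm e)\<^sup>2 + (1 / (real k)\<^sup>2) * (real N1 * (\<Sum>j\<in>A. (norm (a j))\<^sup>2))"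
  proof -
    have "(\<Sum>B\<in>?F. (norm (\<Sum>j\<in>B. b j))\<^sup>2) \<le> real N1 * (\<Sum>j\<in>A. (norm (b j))\<^sup>2)"
      using sum_subsets_norm_sq_le[OF A k b0] by (simp add: N1_def n_def)
    also have "\<dots> \<le> real N1 * (\<Sum>j\<in>A. (norm (a j))\<^sup>2)"
      using bsq by (intro mult_left_mono) auto
    finally show ?thesis unfolding mean0 by (simp add: divide_right_mono)
  qed
  also have "\<dots> = real N * ((norm e)\<^sup>2 + (1 / real k) * ((\<Sum>j\<in>A. (norm (a j))\<^sup>2) / real n))"
  proof -
    have "real N1 / (real k)\<^sup>2 = real N / (real k * real n)"
      using k n arg_cong[OF kN, of real] by (simp add: field_simps power2_eq_square)
    then have "(1 / (real k)\<^sup>2) * (real N1 * s) = real N * ((1 / real k) * (s / real n))" for s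
    proof -
      have "(1 / (real k)\<^sup>2) * (real N1 * s) = real N1 / (real k)\<^sup>2 * s" by simp
      also have "\<dots> = real N * ((1 / real k) * (s / real n))"
        unfolding \<open>real N1 / (real k)\<^sup>2 = real N / (real k * real n)\<close> by simp
      finally show ?thesis .
    qed
    then show ?thesis by (simp add: distrib_left)
  qed
  finally have "(\<Sum>B\<in>?F. (norm (e + ((1 / real k) *\<^sub>R (\<Sum>j\<in>B. a j) - m)))\<^sup>2) / real N
      \<le> (norm e)\<^sup>2 + (1 / real k) * ((\<Sum>j\<in>A. (norm (a j))\<^sup>2) / real n)"
    using N by (simp add: divide_le_eq mult.commute)
  then show ?thesis
    unfolding integral_pmf_of_set[OF F fin] cF m_def n_def .
qed

text \<open>The coordinates are independent, so a fresh draw of one of them does not change the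
  law.\<close>

lemma Pi_pmf_resample:
  assumes "finite A" "a \<in> A"
  shows "Pi_pmf A d p = Pi_pmf A d p \<bind> (\<lambda>w. map_pmf (\<lambda>b. w(a := b)) (p a))"
proof -
  have A: "A = insert a (A - {a})" using assms by auto
  have ins: "Pi_pmf A d p = p a \<bind> (\<lambda>y. Pi_pmf (A - {a}) d p \<bind> (\<lambda>f. return_pmf (f(a := y))))"
    by (subst A, subst Pi_pmf_insert') (use assms in auto)
  have "Pi_pmf A d p \<bind> (\<lambda>w. map_pmf (\<lambda>b. w(a := b)) (p a))
      = Pi_pmf (A - {a}) d p \<bind> (\<lambda>f. p a \<bind> (\<lambda>b. return_pmf (f(a := b))))"
    unfolding ins by (simp add: bind_assoc_pmf bind_return_pmf map_pmf_def)
  also have "\<dots> = Pi_pmf A d p"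
    unfolding ins by (rule bind_commute_pmf)
  finally show ?thesis by simp
qed

text \<open>The substitute for conditioning on the past: only averages over coordinate
  \<open>a\<close>, with all other coordinates frozen, have to be compared.\<close>

lemma expectation_Pi_pmf_resample_mono:
  fixes F G :: "('i \<Rightarrow> 'b) \<Rightarrow> real"
  assumes A: "finite A" "a \<in> A" and fin: "\<And>i. i \<in> A \<Longrightarrow> finite (set_pmf (p i))"
    and le: "\<And>w. w \<in> set_pmf (Pi_pmf A d p) \<Longrightarrow>
      measure_pmf.expectation (p a) (\<lambda>b. F (w(a := b))) \<le> measure_pmf.expectation (p a) (\<lambda>b. G (w(a := b)))"
  shows "measure_pmf.expectation (Pi_pmf A d p) F \<le> measure_pmf.expectation (Pi_pmf A d p) G"
proof -
  have finP: "finite (set_pmf (Pi_pmf A d p))"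
    using A fin by (simp add: set_Pi_pmf finite_PiE_dflt)
  have E: "measure_pmf.expectation (Pi_pmf A d p) H
      = (\<Sum>w\<in>set_pmf (Pi_pmf A d p). pmf (Pi_pmf A d p) w * measure_pmf.expectation (p a) (\<lambda>b. H (w(a := b))))"
    for H :: "('i \<Rightarrow> 'b) \<Rightarrow> real"
    by (subst Pi_pmf_resample[OF A], subst pmf_expectation_bind[OF finP])
      (use A fin in auto)
  show ?thesis unfolding E by (intro sum_mono mult_left_mono le) auto
qed

section \<open>Sample paths of the algorithm\<close>

locale cgtvr =
  fixes P :: "('m::finite, 'a::euclidean_space) problem" and \<eta> \<delta> \<rho> \<theta> r0 :: real
  assumes eta: "0 < \<eta>" "\<eta> < 1" and delta: "0 < \<delta>" and rho: "0 < \<rho>"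
    and radius: "(2 * sqrt (2 * real CARD('m)) / (1 - \<eta>) + 1) * \<delta> + \<rho> \<le> r0"
    and theta: "28 + 1424 / (1 - \<eta>)^2 + 9600 / (1 - \<eta>)^4 \<le> \<theta>"
    and drift: "2 * sqrt (2 * real CARD('m)) / (1 - \<eta>) * \<delta> \<le> \<rho> / 2"
    and standing: "standing_assumptions P \<eta>"
    and ruc: "RUC_radius P \<eta> r0"
begin

section \<open>Gradients and Lipschitz constants of a fixed problem\<close>

lemma loss_differentiable: "j < data_size P i \<Longrightarrow> loss P i j differentiable (at x)"
  using standing by (simp add: standing_assumptions_def differentiable_losses_def)

lemma data_size_pos: "1 \<le> data_size P i"
  using standing by (simp add: standing_assumptions_def differentiable_losses_def)

lemma objective_ge_opt_value: "opt_value P \<le> objective P x"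
  unfolding opt_value_def using standing
  by (intro cINF_lower) (simp_all add: standing_assumptions_def A3_def)

lemma mixing_rows: "mixing P *v 1 = 1" "transpose (mixing P) *v 1 = 1"
  and mixing_nonneg: "0 \<le> mixing P $ i $ j"
  and mixing_modulus: "second_largest_modulus (mixing P) \<eta>"
  using standing unfolding standing_assumptions_def A4_def by (metis order.refl less_imp_le)+

lemma sum_mixing_row: "(\<Sum>j\<in>UNIV. mixing P $ i $ j) = 1"
  using arg_cong[OF mixing_rows(1), of "\<lambda>v. v $ i"] by (simp add: matrix_vector_mult_def)

lemma theta_pos: "28 \<le> \<theta>"
  and theta_ge: "9600 / (1 - \<eta>)^4 \<le> \<theta>"
proof -
  have "0 \<le> 1424 / (1 - \<eta>)^2" "0 \<le> 9600 / (1 - \<eta>)^4" by simp_all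
  then show "28 \<le> \<theta>" "9600 / (1 - \<eta>)^4 \<le> \<theta>" using theta by linarith+
qed

lemma r0_pos: "0 < r0"
  using ruc by (simp add: RUC_radius_def)

lemma GDERIV_local_obj:
  "GDERIV (local_obj P i) x :> (1 / real (data_size P i)) *\<^sub>R (\<Sum>j<data_size P i. grad (loss P i j) x)"
  unfolding local_obj_def[abs_def]
  by (intro GDERIV_average GDERIV_grad loss_differentiable) simp

lemmas grad_local_obj = grad_eqI[OF GDERIV_local_obj]

lemma GDERIV_objective: "GDERIV (objective P) x :> mean (\<lambda>i. grad (local_obj P i) x)"
  unfolding objective_def[abs_def] mean_def
  by (intro GDERIV_average) (use GDERIV_local_obj grad_local_obj in metis)

lemmas grad_objective = grad_eqI[OF GDERIV_objective]

lemma cball_compact: "cball x r0 \<in> nonempty_compacts"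
  using r0_pos by (simp add: nonempty_compacts_def)

lemma Lip_le_Lip_max: "Lip P i X \<le> Lip_max P X"
  by (simp add: Lip_max_def)

lemma Lip_ge_1: "1 \<le> Lip P i (cball x r0)"
  using standing cball_compact[of x] unfolding standing_assumptions_def A1_def by blast

lemma Lip_max_ge_1: "1 \<le> Lip_max P (cball x r0)"
  using Lip_ge_1 Lip_le_Lip_max order_trans by blast

lemma Lip_pos: "0 < Lip P i (cball x r0)"
  using Lip_ge_1[of i x] by simp

text \<open>The second entry keeps \<open>\<gamma> * \<eta>\<close> below one; the cap 2 takes over
  for small \<open>\<eta>\<close>, where that entry is unbounded, and gives absolute
  constants.\<close>

definition \<gamma> :: real where "\<gamma> = min 2 ((1 + \<eta>) / (2 * \<eta>))"

lemma gamma: "0 < \<gamma>" "\<gamma> \<le> 2" "\<gamma> * \<eta> \<le> (1 + \<eta>) / 2"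
proof -
  show "0 < \<gamma>" "\<gamma> \<le> 2" using eta by (auto simp: \<gamma>_def)
  have "\<gamma> * \<eta> \<le> (1 + \<eta>) / (2 * \<eta>) * \<eta>"
    using eta by (intro mult_right_mono) (auto simp: \<gamma>_def)
  also have "\<dots> = (1 + \<eta>) / 2" using eta by simp
  finally show "\<gamma> * \<eta> \<le> (1 + \<eta>) / 2" .
qed

text \<open>Balls of equal radius have Hausdorff distance at most that of their centers, so the
  radius condition applies to each agent, and the maximum over the agents inherits the
  factor.\<close>

lemma Lip_max_cball_le:
  assumes "dist a b \<le> r0"
  shows "Lip_max P (cball a r0) \<le> \<gamma> * Lip_max P (cball b r0)"
proof -
  have "hausdorff_dist (cball a r0) (cball b r0) \<le> r0"
    using hausdorff_dist_cball_le[of r0 a b] r0_pos assms by simp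
  then have "Lip P i (cball a r0) / Lip P i (cball b r0) \<le> \<gamma>" for i
    using ruc cball_compact[of a] cball_compact[of b] by (auto simp: RUC_radius_def Let_def \<gamma>_def)
  then have "Lip P i (cball a r0) \<le> \<gamma> * Lip P i (cball b r0)" for i
    using Lip_pos[of i b] by (simp add: divide_le_eq)
  also have "\<gamma> * Lip P i (cball b r0) \<le> \<gamma> * Lip_max P (cball b r0)" for i
    using gamma(1) Lip_le_Lip_max[of i "cball b r0"] by simp
  finally show ?thesis unfolding Lip_max_def by simp
qed

lemma losses_Lipschitz:
  assumes "x \<in> cball z r0" "x' \<in> cball z r0"
  shows "(\<Sum>j<data_size P i. (norm (grad (loss P i j) x - grad (loss P i j) x'))\<^sup>2) / real (data_size P i)
    \<le> (Lip_max P (cball z r0))\<^sup>2 * (norm (x - x'))\<^sup>2"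
proof -
  have "(\<Sum>j<data_size P i. (norm (grad (loss P i j) x - grad (loss P i j) x'))\<^sup>2) / real (data_size P i)
    \<le> (Lip P i (cball z r0))\<^sup>2 * (norm (x - x'))\<^sup>2"
    using standing cball_compact[of z] assms unfolding standing_assumptions_def A1_def by blast
  also have "\<dots> \<le> (Lip_max P (cball z r0))\<^sup>2 * (norm (x - x'))\<^sup>2"
    using Lip_le_Lip_max[of i "cball z r0"] Lip_pos[of i z] by (intro mult_right_mono power_mono) auto
  finally show ?thesis .
qed

text \<open>By Cauchy-Schwarz the average gradient inherits the mean-square bound. The constant is
  the maximum over all agents because later the ball comes from the check point of one agent and the
  function from another.\<close>

lemma grad_local_obj_Lipschitz:
  assumes "x \<in> cball z r0" "x' \<in> cball z r0"
  shows "norm (grad (local_obj P i) x - grad (local_obj P i) x') \<le> Lip_max P (cball z r0) * norm (x - x')"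
proof (rule power2_le_imp_le)
  define n where "n = data_size P i"
  have n: "real n > 0" using data_size_pos[of i] by (simp add: n_def)
  have "(norm (grad (local_obj P i) x - grad (local_obj P i) x'))\<^sup>2
      = (norm (\<Sum>j<n. grad (loss P i j) x - grad (loss P i j) x'))\<^sup>2 / (real n)\<^sup>2"
    by (simp add: grad_local_obj n_def[symmetric] sum_subtractf power_divide flip: scaleR_right_diff_distrib)
  also have "\<dots> \<le> (real n * (\<Sum>j<n. (norm (grad (loss P i j) x - grad (loss P i j) x'))\<^sup>2)) / (real n)\<^sup>2"
    using norm_sum_sq_le[of "\<lambda>j. grad (loss P i j) x - grad (loss P i j) x'" "{..<n}"]
    by (intro divide_right_mono) auto
  also have "\<dots> = (\<Sum>j<n. (norm (grad (loss P i j) x - grad (loss P i j) x'))\<^sup>2) / real n"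
    using n by (simp add: power2_eq_square)
  also have "\<dots> \<le> (Lip_max P (cball z r0))\<^sup>2 * (norm (x - x'))\<^sup>2"
    using losses_Lipschitz[OF assms] by (simp add: n_def)
  finally show "(norm (grad (local_obj P i) x - grad (local_obj P i) x'))\<^sup>2
      \<le> (Lip_max P (cball z r0) * norm (x - x'))\<^sup>2"
    by (simp add: power_mult_distrib)
qed (use Lip_max_ge_1[of z] in simp)

lemma grad_objective_Lipschitz:
  assumes "x \<in> cball z r0" "x' \<in> cball z r0"
  shows "norm (grad (objective P) x - grad (objective P) x') \<le> Lip_max P (cball z r0) * norm (x - x')"
proof -
  have "norm (grad (objective P) x - grad (objective P) x')
      = norm (\<Sum>i\<in>UNIV. grad (local_obj P i) x - grad (local_obj P i) x') / real CARD('m)"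
    unfolding grad_objective mean_diff[symmetric] by (simp add: mean_def)
  also have "\<dots> \<le> (\<Sum>i\<in>(UNIV :: 'm set). Lip_max P (cball z r0) * norm (x - x')) / real CARD('m)"
    by (intro divide_right_mono sum_norm_le grad_local_obj_Lipschitz assms) simp
  finally show ?thesis by simp
qed

section \<open>The run in the time indexing of the algorithm\<close>

definition iter :: "'m batches \<Rightarrow> nat \<Rightarrow> 'm \<Rightarrow> 'a" where
  "iter w t i = cur (run P \<delta> \<rho> \<theta> r0 w t i)"

definition restart :: "'m batches \<Rightarrow> nat \<Rightarrow> 'm \<Rightarrow> bool" where
  "restart w t i = flag (run P \<delta> \<rho> \<theta> r0 w t i)"

text \<open>
  The state reached after iteration \<open>t\<close> holds the tracker, estimator, check point and Lipschitz constant
  that the paper indexes by \<open>t\<close>; hence the successor below.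
\<close>
definition tracker :: "'m batches \<Rightarrow> nat \<Rightarrow> 'm \<Rightarrow> 'a" where
  "tracker w t i = track (run P \<delta> \<rho> \<theta> r0 w (Suc t) i)"

definition estim :: "'m batches \<Rightarrow> nat \<Rightarrow> 'm \<Rightarrow> 'a" where
  "estim w t i = est (run P \<delta> \<rho> \<theta> r0 w (Suc t) i)"

definition chk :: "'m batches \<Rightarrow> nat \<Rightarrow> 'm \<Rightarrow> 'a" where
  "chk w t i = check (run P \<delta> \<rho> \<theta> r0 w (Suc t) i)"

definition lip :: "'m batches \<Rightarrow> nat \<Rightarrow> 'm \<Rightarrow> real" where
  "lip w t i = lconst (run P \<delta> \<rho> \<theta> r0 w (Suc t) i)"

text \<open>The position of iteration \<open>t\<close> in its epoch. A renewal leaves the stored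
  \<open>cnt\<close> at its old value and the next iteration reads it as 0, hence the case
  distinction.\<close>

definition count :: "'m batches \<Rightarrow> nat \<Rightarrow> 'm \<Rightarrow> nat" where
  "count w t i = (if restart w t i then 0 else cnt (run P \<delta> \<rho> \<theta> r0 w t i))"

definition upd :: "'m batches \<Rightarrow> nat \<Rightarrow> 'm \<Rightarrow> 'a" where
  "upd w t i = clip (\<theta> * lip w t i) \<delta> (tracker w t i)"

definition lmin :: "'m batches \<Rightarrow> nat \<Rightarrow> real" where
  "lmin w t = (MIN i. lip w t i)"

lemmas run_defs = iter_def restart_def tracker_def estim_def chk_def lip_def count_def upd_def

lemma iter_0: "iter w 0 i = init P"
  and restart_0: "restart w 0 i"
  and tracker_0: "tracker w 0 i = grad (local_obj P i) (init P)"
  by (simp_all add: run_defs init_state_def step_def Let_def new_est_def)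

text \<open>Written as a mixed family plus a perturbation, the shape that
  \<open>sq_sum_deviation_mix_add_le\<close> expects.\<close>

lemma iter_Suc: "iter w (Suc t) = (\<lambda>i. mix (mixing P) (iter w t) i + - upd w t i)"
  by (simp add: fun_eq_iff run_defs step_def Let_def mix_def new_lconst_def)

lemma tracker_Suc: "tracker w (Suc t) = (\<lambda>i. mix (mixing P) (tracker w t) i + (estim w (Suc t) i - estim w t i))"
  by (simp add: fun_eq_iff run_defs step_def Let_def mix_def)

lemma estim_restart: "restart w t i \<Longrightarrow> estim w t i = grad (local_obj P i) (iter w t i)"
  by (simp add: run_defs step_def Let_def new_est_def)

lemma estim_Suc: "\<not> restart w (Suc t) i \<Longrightarrow> estim w (Suc t) i = estim w t i +
    (1 / real (card (w (i, Suc t)))) *\<^sub>R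
      (\<Sum>j\<in>w (i, Suc t). grad (loss P i j) (iter w (Suc t) i) - grad (loss P i j) (iter w t i))"
  by (simp add: run_defs step_def Let_def new_est_def)

lemma chk_restart: "restart w t i \<Longrightarrow> chk w t i = iter w t i"
  and chk_Suc: "\<not> restart w (Suc t) i \<Longrightarrow> chk w (Suc t) i = chk w t i"
  by (simp_all add: run_defs step_def Let_def)

lemma restart_Suc: "restart w (Suc t) i \<longleftrightarrow>
    \<rho> \<le> norm (iter w (Suc t) i - chk w t i) \<or> count w t i = epoch_length P i - 1"
  by (simp add: run_defs step_def Let_def)

lemma count_restart: "restart w t i \<Longrightarrow> count w t i = 0"
  and count_Suc: "\<not> restart w (Suc t) i \<Longrightarrow> count w (Suc t) i = Suc (count w t i)"
  by (simp_all add: run_defs step_def Let_def)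

text \<open>The constant and the check point are refreshed at the same iterations, so the former is
  a function of the latter.\<close>

lemma lip_eq: "lip w t i = Lip_max P (cball (chk w t i) r0)"
proof (induction t)
  case 0
  then show ?case by (simp add: run_defs step_def Let_def new_lconst_def init_state_def)
next
  case (Suc t)
  have "lip w (Suc t) i = (if restart w (Suc t) i then Lip_max P (cball (iter w (Suc t) i) r0) else lip w t i)"
    by (simp add: run_defs step_def Let_def new_lconst_def)
  then show ?case using Suc chk_restart chk_Suc by simp
qed

lemma lip_Suc: "\<not> restart w (Suc t) i \<Longrightarrow> lip w (Suc t) i = lip w t i"
  by (simp add: lip_eq chk_Suc)

lemma L_min_eq: "L_min P \<delta> \<rho> \<theta> r0 w t = lmin w t"
  by (simp add: L_min_def lmin_def lip_def step_def Let_def)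

lemma lip_ge_1: "1 \<le> lip w t i"
  by (simp add: lip_eq Lip_max_ge_1)

lemma lip_pos: "0 < lip w t i"
  using lip_ge_1[of w t i] by simp

lemma lmin_le_lip: "lmin w t \<le> lip w t i"
  by (simp add: lmin_def)

lemma lmin_attained: obtains i where "lmin w t = lip w t i"
proof -
  have "lmin w t \<in> range (lip w t)" unfolding lmin_def by (intro Min_in) auto
  then show ?thesis using that by blast
qed

lemma lmin_ge_1: "1 \<le> lmin w t"
  using lmin_attained lip_ge_1 by metis

lemma lmin_pos: "0 < lmin w t"
  using lmin_ge_1[of w t] by simp

lemma lmin_0: "lmin w 0 = Lip_max P (cball (init P) r0)"
proof -
  have "lip w 0 i = Lip_max P (cball (init P) r0)" for i
    by (simp add: lip_eq chk_restart[OF restart_0] iter_0)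
  then show ?thesis using lmin_attained by metis
qed

section \<open>Confinement of the iterates and slow variation of the weights\<close>

lemma norm_upd_le: "norm (upd w t i) \<le> \<delta>"
  unfolding upd_def using lip_pos[of w t i] theta_pos delta by (intro norm_clip_le) auto

text \<open>The disagreement bound is \<open>c \<delta> / 2\<close> in the notation of the theorem.\<close>
definition spread :: real where "spread = sqrt (2 * real CARD('m)) / (1 - \<eta>) * \<delta>"

lemma spread_nonneg: "0 \<le> spread"
  using eta delta by (simp add: spread_def)

lemma spread_le: "2 * spread \<le> \<rho> / 2" "2 * spread + \<delta> + \<rho> \<le> r0"
  using drift radius by (simp_all add: spread_def algebra_simps)

lemma spread_sq: "spread\<^sup>2 = 2 * (real CARD('m) * \<delta>\<^sup>2 / (1 - \<eta>)\<^sup>2)"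
  by (simp add: spread_def power_mult_distrib power_divide)

lemma sq_sum_uminus: "sq_sum (\<lambda>i. - v i) = sq_sum v"
  by (simp add: sq_sum_def)

lemma disagreement_Suc_le:
  "sq_sum (deviation (iter w (Suc t))) \<le> \<eta> * sq_sum (deviation (iter w t)) + sq_sum (upd w t) / (1 - \<eta>)"
  using sq_sum_deviation_mix_add_le[OF mixing_rows mixing_modulus eta, of "iter w t" "\<lambda>i. - upd w t i"]
  by (simp add: iter_Suc sq_sum_uminus)

lemma disagreement_0: "sq_sum (deviation (iter w 0)) = 0"
proof -
  have "iter w 0 = (\<lambda>_. init P)" by (simp add: fun_eq_iff iter_0)
  then show ?thesis by (simp add: sq_sum_def deviation_def mean_def sum_constant_scaleR)
qed

lemma sq_sum_upd_le: "sq_sum (upd w t) \<le> real CARD('m) * \<delta>\<^sup>2"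
proof -
  have "sq_sum (upd w t) \<le> (\<Sum>i\<in>(UNIV :: 'm set). \<delta>\<^sup>2)"
    unfolding sq_sum_def by (intro sum_mono power_mono norm_upd_le) auto
  then show ?thesis by simp
qed

text \<open>With forcing \<open>m * \<delta>\<^sup>2 / (1 - \<eta>)\<close>, where \<open>m\<close>
  is the number of agents, the recursion has the fixed point
  \<open>m * \<delta>\<^sup>2 / (1 - \<eta>)\<^sup>2\<close>, half of \<open>spread\<^sup>2\<close>.
  The factor 2 is kept for distances between two agents.\<close>

lemma disagreement_le: "2 * sq_sum (deviation (iter w t)) \<le> spread\<^sup>2"
proof -
  have "sq_sum (deviation (iter w t)) \<le> real CARD('m) * \<delta>\<^sup>2 / (1 - \<eta>)\<^sup>2"
  proof (induction t)
    case 0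
    then show ?case by (simp add: disagreement_0)
  next
    case (Suc t)
    have "sq_sum (deviation (iter w (Suc t))) \<le>
        \<eta> * (real CARD('m) * \<delta>\<^sup>2 / (1 - \<eta>)\<^sup>2) + real CARD('m) * \<delta>\<^sup>2 / (1 - \<eta>)"
      using eta by (intro order_trans[OF disagreement_Suc_le] add_mono mult_left_mono Suc divide_right_mono sq_sum_upd_le) auto
    also have "\<dots> = real CARD('m) * \<delta>\<^sup>2 / (1 - \<eta>)\<^sup>2"
    proof -
      have "M / (1 - \<eta>) = (1 - \<eta>) * (M / (1 - \<eta>)\<^sup>2)" for M
        using eta by (simp add: power2_eq_square)
      then show ?thesis by (simp add: left_diff_distrib flip: add_divide_distrib)
    qed
    finally show ?case .
  qed
  then show ?thesis by (simp add: spread_sq)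
qed

lemma iter_mean_dist: "norm (iter w t i - mean (iter w t)) \<le> spread"
proof -
  have "(norm (deviation (iter w t) i))\<^sup>2 \<le> spread\<^sup>2"
    using norm_sq_le_sq_sum[of "deviation (iter w t)" i] disagreement_le[of w t]
      sq_sum_nonneg[of "deviation (iter w t)"] by linarith
  then show ?thesis using spread_nonneg power2_le_imp_le by (simp add: deviation_def)
qed

lemma iter_iter_dist: "norm (iter w t i - iter w t j) \<le> spread"
proof (cases "i = j")
  case False
  let ?d = "deviation (iter w t)"
  have "(norm (iter w t i - iter w t j))\<^sup>2 = (norm (?d i - ?d j))\<^sup>2" by (simp add: deviation_def)
  also have "\<dots> \<le> 2 * ((norm (?d i))\<^sup>2 + (norm (?d j))\<^sup>2)"
  proof -
    have "(norm (?d i - ?d j))\<^sup>2 + (norm (?d i + ?d j))\<^sup>2 = 2 * ((norm (?d i))\<^sup>2 + (norm (?d j))\<^sup>2)"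
      unfolding power2_norm_eq_inner by (simp add: algebra_simps)
    then show ?thesis by (smt (verit) zero_le_power2)
  qed
  also have "\<dots> \<le> spread\<^sup>2"
    by (rule order_trans[OF mult_left_mono[OF norm_sq_add_le_add_sq_sum[OF False]] disagreement_le]) simp
  finally show ?thesis using spread_nonneg power2_le_imp_le by blast
qed (simp add: spread_nonneg)

text \<open>A row of the mixing matrix forms a convex combination, which stays within
  \<open>spread\<close> of any old iterate; the clipped update adds at most
  \<open>\<delta>\<close>.\<close>

lemma iter_Suc_dist: "norm (iter w (Suc t) i - iter w t j) \<le> spread + \<delta>"
proof -
  have "iter w (Suc t) i - iter w t j = mix (mixing P) (\<lambda>k. iter w t k - iter w t j) i - upd w t i"
    by (simp add: iter_Suc mix_diff_const[OF mixing_rows(1)])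
  also have "norm \<dots> \<le> norm (mix (mixing P) (\<lambda>k. iter w t k - iter w t j) i) + norm (upd w t i)"
    by (rule norm_triangle_ineq4)
  also have "norm (mix (mixing P) (\<lambda>k. iter w t k - iter w t j) i) \<le> (\<Sum>k\<in>UNIV. mixing P $ i $ k * spread)"
    unfolding mix_def
    by (intro sum_norm_le) (simp add: mixing_nonneg iter_iter_dist mult_left_mono)
  also have "\<dots> = spread" by (simp add: sum_mixing_row flip: sum_distrib_right)
  finally show ?thesis using norm_upd_le[of w t i] by linarith
qed

text \<open>The radius test is made on the new iterate. If it fires, the check point moves to that
  very iterate in the next iteration, so a larger distance never survives.\<close>

lemma iter_chk_dist: "norm (iter w t i - chk w t i) \<le> \<rho>"
proof (cases "restart w t i")
  case True
  then show ?thesis using rho by (simp add: chk_restart)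
next
  case False
  then obtain s where s: "t = Suc s" using restart_0 by (cases t) auto
  then show ?thesis using False restart_Suc[of w s i] by (simp add: chk_Suc)
qed

lemma iter_in_ball: "iter w t j \<in> cball (chk w t i) r0"
proof -
  have "norm (iter w t j - chk w t i) \<le> norm (iter w t j - iter w t i) + norm (iter w t i - chk w t i)"
    by (metis diff_add_cancel add_diff_eq norm_triangle_ineq)
  then show ?thesis
    using iter_iter_dist[of w t j i] iter_chk_dist[of w t i] spread_le(2) spread_nonneg delta
    by (simp add: dist_norm norm_minus_commute)
qed

lemma iter_Suc_in_ball: "iter w (Suc t) j \<in> cball (chk w t i) r0"
proof -
  have "norm (iter w (Suc t) j - chk w t i) \<le> norm (iter w (Suc t) j - iter w t i) + norm (iter w t i - chk w t i)"
    by (metis diff_add_cancel add_diff_eq norm_triangle_ineq)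
  then show ?thesis
    using iter_Suc_dist[of w t j i] iter_chk_dist[of w t i] spread_le(2) spread_nonneg
    by (simp add: dist_norm norm_minus_commute)
qed

lemma mean_in_cball:
  assumes "\<And>j. v j \<in> cball z r"
  shows "mean (v :: 'm \<Rightarrow> 'a) \<in> cball z r"
proof -
  have "(\<Sum>j\<in>UNIV. (1 / real CARD('m)) *\<^sub>R v j) \<in> cball z r"
    using assms by (intro convex_sum) auto
  then show ?thesis by (simp add: mean_def scaleR_right.sum)
qed

lemma mean_in_ball: "mean (iter w t) \<in> cball (chk w t i) r0"
  by (intro mean_in_cball iter_in_ball)

lemma mean_Suc_in_ball: "mean (iter w (Suc t)) \<in> cball (chk w t i) r0"
  by (intro mean_in_cball iter_Suc_in_ball)

text \<open>Two check points are only known to be within \<open>2 * r0\<close> of each other. A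
  current iterate is within \<open>r0\<close> of both, and the detour through its ball costs
  \<open>\<gamma>\<close> twice.\<close>

lemma lip_le_4_lmin: "lip w t i \<le> 4 * lmin w t"
proof -
  obtain j where j: "lmin w t = lip w t j" by (rule lmin_attained)
  let ?a = "iter w t i"
  have a: "dist (chk w t i) ?a \<le> r0" "dist ?a (chk w t j) \<le> r0"
    using iter_in_ball[of w t i i] iter_in_ball[of w t i j] by (simp_all add: dist_commute)
  have "lip w t i \<le> \<gamma> * Lip_max P (cball ?a r0)"
    unfolding lip_eq by (rule Lip_max_cball_le[OF a(1)])
  also have "\<dots> \<le> \<gamma> * (\<gamma> * lip w t j)"
    unfolding lip_eq using gamma by (intro mult_left_mono Lip_max_cball_le[OF a(2)]) auto
  also have "\<dots> \<le> 2 * (2 * lip w t j)"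
    using gamma lip_pos[of w t j] by (intro mult_mono) auto
  finally show ?thesis using j by simp
qed

text \<open>The check point either stays or jumps to the new iterate, which still lies in the old
  ball.\<close>

lemma chk_chk_Suc_dist: "dist (chk w t i) (chk w (Suc t) i) \<le> r0"
  using iter_Suc_in_ball[of w t i i] chk_restart[of w "Suc t" i] chk_Suc[of w t i] r0_pos
  by (cases "restart w (Suc t) i") auto

lemma lmin_Suc_le: "lmin w (Suc t) \<le> \<gamma> * lmin w t"
proof -
  obtain j where j: "lmin w t = lip w t j" by (rule lmin_attained)
  have "lmin w (Suc t) \<le> lip w (Suc t) j" by (rule lmin_le_lip)
  also have "\<dots> \<le> \<gamma> * lip w t j"
    unfolding lip_eq using chk_chk_Suc_dist[of w t j] by (intro Lip_max_cball_le) (simp add: dist_commute)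
  finally show ?thesis using j by simp
qed

lemma lmin_le_Suc: "lmin w t \<le> \<gamma> * lmin w (Suc t)"
proof -
  obtain j where j: "lmin w (Suc t) = lip w (Suc t) j" by (rule lmin_attained)
  have "lmin w t \<le> lip w t j" by (rule lmin_le_lip)
  also have "\<dots> \<le> \<gamma> * lip w (Suc t) j"
    unfolding lip_eq using chk_chk_Suc_dist[of w t j] by (intro Lip_max_cball_le)
  finally show ?thesis using j by simp
qed

end

section \<open>Energy estimates along a sample path\<close>

text \<open>Summation telescopes, since each step leaves a surplus
  \<open>(1 - \<eta>) / 2 * a t\<close>. No step follows the last term, so the perturbations are
  summed only below \<open>N\<close>.\<close>

lemma sum_contraction_le:
  fixes a b :: "nat \<Rightarrow> real"
  assumes "0 < \<eta>" "\<eta> < 1" and step: "\<And>t. a (Suc t) \<le> (1 + \<eta>) / 2 * a t + b t"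
    and nonneg: "\<And>t. 0 \<le> a t"
  shows "(\<Sum>t<Suc N. a t) \<le> 2 / (1 - \<eta>) * (a 0 + (\<Sum>t<N. b t))"
proof -
  have "(1 - \<eta>) / 2 * (\<Sum>t<N. a t) + a N \<le> a 0 + (\<Sum>t<N. b t)"
  proof (induction N)
    case (Suc N)
    have "(1 - \<eta>) / 2 * a N + a (Suc N) \<le> a N + b N"
      using step[of N] by (simp add: field_simps)
    then show ?case using Suc by (simp add: distrib_left)
  qed simp
  moreover have "(1 - \<eta>) / 2 * a N \<le> a N"
    using assms(1,2) nonneg[of N] by (intro mult_left_le_one_le) auto
  ultimately have "(1 - \<eta>) / 2 * (\<Sum>t<Suc N. a t) \<le> a 0 + (\<Sum>t<N. b t)"
    by (simp add: distrib_left)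
  then show ?thesis using assms(2) by (simp add: field_simps)
qed

context cgtvr
begin

definition sum_upd :: "'m batches \<Rightarrow> nat \<Rightarrow> real" where
  "sum_upd w T = (\<Sum>t<T. lmin w t * sq_sum (upd w t))"

definition sum_disagreement :: "'m batches \<Rightarrow> nat \<Rightarrow> real" where
  "sum_disagreement w T = (\<Sum>t<T. lmin w t * sq_sum (deviation (iter w t)))"

definition move :: "'m batches \<Rightarrow> nat \<Rightarrow> 'm \<Rightarrow> 'a" where
  "move w t i = iter w (Suc t) i - iter w t i"

definition sum_move :: "'m batches \<Rightarrow> nat \<Rightarrow> real" where
  "sum_move w T = (\<Sum>t<T. lmin w t * sq_sum (move w t))"

definition est_err :: "'m batches \<Rightarrow> nat \<Rightarrow> 'm \<Rightarrow> 'a" where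
  "est_err w t i = estim w t i - grad (local_obj P i) (iter w t i)"

definition sum_est_err :: "'m batches \<Rightarrow> nat \<Rightarrow> real" where
  "sum_est_err w T = (\<Sum>t<T. sq_sum (est_err w t) / lmin w t)"

definition sum_track_dev :: "'m batches \<Rightarrow> nat \<Rightarrow> real" where
  "sum_track_dev w T = (\<Sum>t<T. sq_sum (deviation (tracker w t)) / lmin w t)"

definition grad_err :: "'m batches \<Rightarrow> nat \<Rightarrow> 'm \<Rightarrow> 'a" where
  "grad_err w t i = tracker w t i - grad (objective P) (mean (iter w t))"

definition sum_grad_err :: "'m batches \<Rightarrow> nat \<Rightarrow> real" where
  "sum_grad_err w T = (\<Sum>t<T. sq_sum (grad_err w t) / lmin w t)"

text \<open>The second term of \<open>Delta_f\<close> without its constants; it enters as the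
  initial tracking error, see \<open>track_dev_0\<close>.\<close>

definition initial_heterogeneity :: real where
  "initial_heterogeneity =
    (\<Sum>i\<in>UNIV. (norm (grad (objective P) (init P) - grad (local_obj P i) (init P)))\<^sup>2)
      / Lip_max P (cball (init P) r0)"

lemma Delta_f_eq: "real CARD('m) * Delta_f P \<eta> r0
    = real CARD('m) * (objective P (init P) - opt_value P) + 5 * initial_heterogeneity / (2 * (1 - \<eta>))"
  using eta Lip_max_ge_1[of "init P"] by (simp add: Delta_f_def initial_heterogeneity_def field_simps)

lemma initial_heterogeneity_nonneg: "0 \<le> initial_heterogeneity"
  unfolding initial_heterogeneity_def using Lip_max_ge_1[of "init P"] by (simp add: sum_nonneg)

lemma gap: "0 < 1 - \<eta>" "1 - \<eta> \<le> 1"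
  using eta by auto

lemma lmin_mono_factor:
  assumes "0 \<le> s"
  shows "lmin w (Suc t) * s \<le> \<gamma> * (lmin w t * s)" "s / lmin w (Suc t) \<le> \<gamma> * (s / lmin w t)"
proof -
  show "lmin w (Suc t) * s \<le> \<gamma> * (lmin w t * s)"
    using mult_right_mono[OF lmin_Suc_le assms] by (simp add: mult.assoc)
  have "s * lmin w t \<le> s * (\<gamma> * lmin w (Suc t))"
    by (rule mult_left_mono[OF lmin_le_Suc assms])
  then show "s / lmin w (Suc t) \<le> \<gamma> * (s / lmin w t)"
    using lmin_pos[of w t] lmin_pos[of w "Suc t"] by (simp add: field_simps)
qed

lemma sum_upd_nonneg: "0 \<le> sum_upd w T"
  unfolding sum_upd_def by (intro sum_nonneg mult_nonneg_nonneg sq_sum_nonneg less_imp_le lmin_pos)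

section \<open>Weighted disagreement and moves\<close>

lemma sum_disagreement_le: "sum_disagreement w T \<le> 4 / (1 - \<eta>)\<^sup>2 * sum_upd w T"
proof (cases T)
  case 0
  then show ?thesis by (simp add: sum_disagreement_def sum_upd_def)
next
  case (Suc N)
  let ?X = "\<lambda>t. sq_sum (deviation (iter w t))"
  have "lmin w (Suc t) * ?X (Suc t)
      \<le> (1 + \<eta>) / 2 * (lmin w t * ?X t) + 2 / (1 - \<eta>) * (lmin w t * sq_sum (upd w t))" for t
  proof -
    let ?R = "\<eta> * ?X t + sq_sum (upd w t) / (1 - \<eta>)"
    have l: "0 \<le> lmin w t * ?X t" "0 \<le> lmin w t * sq_sum (upd w t)"
      using lmin_pos[of w t] sq_sum_nonneg by (auto intro!: mult_nonneg_nonneg)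
    have "lmin w (Suc t) * ?X (Suc t) \<le> lmin w (Suc t) * ?R"
      using lmin_pos[of w "Suc t"] by (intro mult_left_mono disagreement_Suc_le) auto
    also have "\<dots> \<le> \<gamma> * (lmin w t * ?R)"
      using eta by (intro lmin_mono_factor add_nonneg_nonneg mult_nonneg_nonneg divide_nonneg_nonneg sq_sum_nonneg) auto
    also have "\<dots> = (\<gamma> * \<eta>) * (lmin w t * ?X t) + \<gamma> * (lmin w t * sq_sum (upd w t) / (1 - \<eta>))"
      by (simp add: algebra_simps)
    \<comment> \<open>The possible growth of the weight is absorbed by the contraction in the first
      term and bounded by 2 in the second.\<close>
    also have "\<dots> \<le> (1 + \<eta>) / 2 * (lmin w t * ?X t) + 2 * (lmin w t * sq_sum (upd w t) / (1 - \<eta>))"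
      using l gap gamma by (intro add_mono mult_right_mono) auto
    finally show ?thesis by simp
  qed
  then have "sum_disagreement w (Suc N) \<le> 2 / (1 - \<eta>) * (lmin w 0 * ?X 0
      + (\<Sum>t<N. 2 / (1 - \<eta>) * (lmin w t * sq_sum (upd w t))))"
    unfolding sum_disagreement_def
    by (intro sum_contraction_le eta mult_nonneg_nonneg sq_sum_nonneg less_imp_le[OF lmin_pos])
  also have "\<dots> = 4 / (1 - \<eta>)\<^sup>2 * sum_upd w N"
    unfolding sum_upd_def sum_distrib_left[symmetric] disagreement_0 by (simp add: power2_eq_square)
  also have "\<dots> \<le> 4 / (1 - \<eta>)\<^sup>2 * sum_upd w (Suc N)"
    using lmin_pos[of w N] sq_sum_nonneg[of "upd w N"] by (intro mult_left_mono) (auto simp: sum_upd_def)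
  finally show ?thesis by (simp add: Suc)
qed

text \<open>Mixing fixes constant families, so the mean can be subtracted first: a move consists of
  mixed disagreement, disagreement and update.\<close>

lemma sq_sum_move_le: "sq_sum (move w t) \<le> 6 * sq_sum (deviation (iter w t)) + 3 * sq_sum (upd w t)"
proof -
  let ?d = "deviation (iter w t)"
  have "move w t i = mix (mixing P) ?d i + - ?d i + - upd w t i" for i
    by (simp add: move_def iter_Suc deviation_def[abs_def] mix_diff_const[OF mixing_rows(1)])
  then have "sq_sum (move w t) \<le> (\<Sum>i\<in>UNIV. 3 * ((norm (mix (mixing P) ?d i))\<^sup>2 + (norm (?d i))\<^sup>2 + (norm (upd w t i))\<^sup>2))"
    unfolding sq_sum_def by (intro sum_mono) (metis norm_add3_sq_le norm_minus_cancel)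
  also have "\<dots> = 3 * (sq_sum (mix (mixing P) ?d) + sq_sum ?d + sq_sum (upd w t))"
    by (simp add: sq_sum_def sum.distrib flip: sum_distrib_left)
  also have "\<dots> \<le> 3 * (sq_sum ?d + sq_sum ?d + sq_sum (upd w t))"
  proof -
    have "sq_sum (mix (mixing P) ?d) \<le> \<eta>\<^sup>2 * sq_sum ?d"
      by (rule sq_sum_mix_deviation_le[OF mixing_rows mixing_modulus eta(2)])
    also have "\<dots> \<le> sq_sum ?d"
      using eta sq_sum_nonneg by (intro mult_left_le_one_le) (auto simp: power_le_one)
    finally show ?thesis by simp
  qed
  finally show ?thesis by simp
qed

lemma sum_move_le: "sum_move w T \<le> 27 / (1 - \<eta>)\<^sup>2 * sum_upd w T"
proof -
  have "sum_move w T \<le> (\<Sum>t<T. lmin w t * (6 * sq_sum (deviation (iter w t)) + 3 * sq_sum (upd w t)))"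
    unfolding sum_move_def using lmin_pos[of w] by (intro sum_mono mult_left_mono sq_sum_move_le less_imp_le)
  also have "\<dots> = 6 * sum_disagreement w T + 3 * sum_upd w T"
    by (simp add: sum_disagreement_def sum_upd_def distrib_left sum.distrib sum_distrib_left mult.left_commute)
  also have "\<dots> \<le> 6 * (4 / (1 - \<eta>)\<^sup>2 * sum_upd w T) + 3 * (1 / (1 - \<eta>)\<^sup>2 * sum_upd w T)"
  proof -
    have "1 \<le> 1 / (1 - \<eta>)\<^sup>2" using gap by (simp add: power_le_one)
    then have "sum_upd w T \<le> 1 / (1 - \<eta>)\<^sup>2 * sum_upd w T"
      using mult_right_mono[OF _ sum_upd_nonneg] by fastforce
    then show ?thesis by (intro add_mono mult_left_mono sum_disagreement_le) auto
  qed
  finally show ?thesis by (simp add: algebra_simps flip: add_divide_distrib)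
qed

text \<open>Both points lie in all balls, in particular in that of the agent with the smallest
  constant; the constant of this ball is valid for the gradients of every agent.\<close>

lemma grad_local_obj_diff_le:
  assumes "\<And>i. x \<in> cball (chk w t i) r0" "\<And>i. x' \<in> cball (chk w t i) r0"
  shows "(norm (grad (local_obj P j) x - grad (local_obj P j) x'))\<^sup>2 \<le> (lmin w t)\<^sup>2 * (norm (x - x'))\<^sup>2"
proof -
  obtain i where i: "lmin w t = lip w t i" by (rule lmin_attained)
  have "norm (grad (local_obj P j) x - grad (local_obj P j) x') \<le> lmin w t * norm (x - x')"
    unfolding i lip_eq by (intro grad_local_obj_Lipschitz assms)
  then have "(norm (grad (local_obj P j) x - grad (local_obj P j) x'))\<^sup>2 \<le> (lmin w t * norm (x - x'))\<^sup>2"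
    by (intro power_mono) auto
  then show ?thesis by (simp add: power_mult_distrib)
qed

section \<open>Tracking error\<close>

text \<open>The increment of an estimator is the new error minus the old error plus the increment of
  the true gradient.\<close>

lemma sq_sum_estim_diff_le:
  "sq_sum (\<lambda>i. estim w (Suc t) i - estim w t i)
    \<le> 3 * (sq_sum (est_err w (Suc t)) + sq_sum (est_err w t) + (lmin w t)\<^sup>2 * sq_sum (move w t))"
proof -
  let ?G = "\<lambda>i. grad (local_obj P i) (iter w (Suc t) i) - grad (local_obj P i) (iter w t i)"
  have "(norm (estim w (Suc t) i - estim w t i))\<^sup>2
      \<le> 3 * ((norm (est_err w (Suc t) i))\<^sup>2 + (norm (est_err w t i))\<^sup>2 + (lmin w t)\<^sup>2 * (norm (move w t i))\<^sup>2)" for i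
  proof -
    have "estim w (Suc t) i - estim w t i = est_err w (Suc t) i + - est_err w t i + ?G i"
      by (simp add: est_err_def)
    then have "(norm (estim w (Suc t) i - estim w t i))\<^sup>2
        \<le> 3 * ((norm (est_err w (Suc t) i))\<^sup>2 + (norm (est_err w t i))\<^sup>2 + (norm (?G i))\<^sup>2)"
      by (metis norm_add3_sq_le norm_minus_cancel)
    also have "\<dots> \<le> 3 * ((norm (est_err w (Suc t) i))\<^sup>2 + (norm (est_err w t i))\<^sup>2 + (lmin w t)\<^sup>2 * (norm (move w t i))\<^sup>2)"
      unfolding move_def
      by (intro mult_left_mono add_mono grad_local_obj_diff_le iter_in_ball iter_Suc_in_ball) auto
    finally show ?thesis .
  qed
  then have "sq_sum (\<lambda>i. estim w (Suc t) i - estim w t i) \<le>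
    (\<Sum>i\<in>UNIV. 3 * ((norm (est_err w (Suc t) i))\<^sup>2 + (norm (est_err w t i))\<^sup>2 + (lmin w t)\<^sup>2 * (norm (move w t i))\<^sup>2))"
    unfolding sq_sum_def by (intro sum_mono)
  then show ?thesis by (simp add: sq_sum_def sum.distrib flip: sum_distrib_left)
qed

lemma track_dev_Suc_le:
  "sq_sum (deviation (tracker w (Suc t))) / lmin w (Suc t)
    \<le> (1 + \<eta>) / 2 * (sq_sum (deviation (tracker w t)) / lmin w t)
      + 6 / (1 - \<eta>) * (sq_sum (est_err w (Suc t)) / lmin w (Suc t) + sq_sum (est_err w t) / lmin w t
          + lmin w t * sq_sum (move w t))"
proof -
  let ?Y = "sq_sum (deviation (tracker w t))" and ?Z = "sq_sum (est_err w t)"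
    and ?Z' = "sq_sum (est_err w (Suc t))" and ?D = "sq_sum (move w t)"
    and ?l = "lmin w t" and ?l' = "lmin w (Suc t)"
  have pos: "0 < ?l" "0 < ?l'" "0 \<le> ?Y" "0 \<le> ?Z" "0 \<le> ?Z'" "0 \<le> ?D"
    by (auto simp: lmin_pos sq_sum_nonneg)
  have "sq_sum (deviation (tracker w (Suc t)))
      \<le> \<eta> * ?Y + sq_sum (\<lambda>i. estim w (Suc t) i - estim w t i) / (1 - \<eta>)"
    unfolding tracker_Suc by (rule sq_sum_deviation_mix_add_le[OF mixing_rows mixing_modulus eta])
  also have "\<dots> \<le> \<eta> * ?Y + 3 * (?Z' + ?Z + ?l\<^sup>2 * ?D) / (1 - \<eta>)"
    using gap by (intro add_left_mono divide_right_mono sq_sum_estim_diff_le) auto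
  finally have "sq_sum (deviation (tracker w (Suc t))) / ?l'
      \<le> (\<eta> * ?Y + 3 * (?Z' + ?Z + ?l\<^sup>2 * ?D) / (1 - \<eta>)) / ?l'"
    using pos by (intro divide_right_mono) auto
  also have "\<dots> = \<eta> * (?Y / ?l') + 3 / (1 - \<eta>) * (?Z' / ?l' + ?Z / ?l' + ?l\<^sup>2 * ?D / ?l')"
    by (simp add: add_divide_distrib distrib_left mult.commute)
  also have "\<dots> \<le> \<eta> * (\<gamma> * (?Y / ?l)) + 3 / (1 - \<eta>) * (2 * (?Z' / ?l') + 2 * (?Z / ?l) + 2 * (?l * ?D))"
  proof -
    have "?Z / ?l' \<le> 2 * (?Z / ?l)"
      using lmin_mono_factor(2)[OF pos(4)] mult_right_mono[OF gamma(2), of "?Z / ?l"] pos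
      by (meson divide_nonneg_pos order_trans)
    moreover have "?l\<^sup>2 * ?D / ?l' \<le> 2 * (?l * ?D)"
    proof -
      have "?l\<^sup>2 * ?D / ?l' \<le> \<gamma> * (?l\<^sup>2 * ?D / ?l)"
        using pos by (intro lmin_mono_factor) auto
      also have "\<dots> \<le> 2 * (?l\<^sup>2 * ?D / ?l)"
        using pos gamma by (intro mult_right_mono) auto
      also have "\<dots> = 2 * (?l * ?D)" using pos by (simp add: power2_eq_square)
      finally show ?thesis .
    qed
    moreover have "?Z' / ?l' \<le> 2 * (?Z' / ?l')" using divide_nonneg_pos[OF pos(5,2)] by linarith
    ultimately show ?thesis
      using pos gap eta by (intro add_mono mult_left_mono lmin_mono_factor) auto
  qed
  also have "\<eta> * (\<gamma> * (?Y / ?l)) \<le> (1 + \<eta>) / 2 * (?Y / ?l)"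
    using mult_right_mono[OF gamma(3), of "?Y / ?l"] pos by (simp add: mult.assoc mult.left_commute)
  finally show ?thesis by (simp add: distrib_left)
qed

text \<open>The invariant of gradient tracking: trackers and estimators coincide at time 0, mixing
  preserves the mean, and each step adds exactly the increments of the estimators.\<close>

lemma mean_tracker: "mean (tracker w t) = mean (estim w t)"
proof (induction t)
  case 0
  have "tracker w 0 = estim w 0"
    by (simp add: fun_eq_iff tracker_0 estim_restart[OF restart_0] iter_0)
  then show ?case by simp
next
  case (Suc t)
  then show ?case by (simp add: tracker_Suc mean_add mean_diff mean_mix[OF mixing_rows(2)])
qed

lemma track_dev_0: "sq_sum (deviation (tracker w 0)) / lmin w 0 = initial_heterogeneity"
proof -
  have "deviation (tracker w 0) i = grad (local_obj P i) (init P) - grad (objective P) (init P)" for i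
  proof -
    have "tracker w 0 = (\<lambda>i. grad (local_obj P i) (init P))" by (simp add: fun_eq_iff tracker_0)
    then show ?thesis by (simp add: deviation_def grad_objective)
  qed
  then show ?thesis by (simp add: sq_sum_def initial_heterogeneity_def lmin_0 norm_minus_commute)
qed

lemma est_err_nonneg: "0 \<le> sq_sum (est_err w t) / lmin w t"
  and move_nonneg: "0 \<le> lmin w t * sq_sum (move w t)"
  using lmin_pos[of w t] sq_sum_nonneg[of "est_err w t"] sq_sum_nonneg[of "move w t"] by auto

text \<open>Each step involves the estimator errors of two consecutive times, hence twice
  \<open>sum_est_err\<close>.\<close>

lemma sum_track_dev_le:
  "sum_track_dev w T \<le> 2 / (1 - \<eta>) * initial_heterogeneity
    + 12 / (1 - \<eta>)\<^sup>2 * (2 * sum_est_err w T + sum_move w T)"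
proof (cases T)
  case 0
  then show ?thesis
    using initial_heterogeneity_nonneg gap by (simp add: sum_track_dev_def sum_est_err_def sum_move_def)
next
  case (Suc N)
  let ?z = "\<lambda>t. sq_sum (est_err w t) / lmin w t" and ?d = "\<lambda>t. lmin w t * sq_sum (move w t)"
  have "sum_track_dev w (Suc N) \<le> 2 / (1 - \<eta>) * (sq_sum (deviation (tracker w 0)) / lmin w 0
      + (\<Sum>t<N. 6 / (1 - \<eta>) * (?z (Suc t) + ?z t + ?d t)))"
    unfolding sum_track_dev_def
    using lmin_pos[of w] sq_sum_nonneg
    by (intro sum_contraction_le eta track_dev_Suc_le) (auto intro!: divide_nonneg_pos)
  also have "\<dots> = 2 / (1 - \<eta>) * (initial_heterogeneity
      + 6 / (1 - \<eta>) * ((\<Sum>t<N. ?z (Suc t)) + (\<Sum>t<N. ?z t) + (\<Sum>t<N. ?d t)))"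
    unfolding track_dev_0 sum_distrib_left[symmetric] sum.distrib ..
  also have "\<dots> \<le> 2 / (1 - \<eta>) * (initial_heterogeneity
      + 6 / (1 - \<eta>) * (sum_est_err w (Suc N) + sum_est_err w (Suc N) + sum_move w (Suc N)))"
  proof -
    have "(\<Sum>t<N. ?z (Suc t)) \<le> sum_est_err w (Suc N)"
      unfolding sum_est_err_def sum.lessThan_Suc_shift using est_err_nonneg by simp
    moreover have "(\<Sum>t<N. ?z t) \<le> sum_est_err w (Suc N)"
      unfolding sum_est_err_def using est_err_nonneg by simp
    moreover have "(\<Sum>t<N. ?d t) \<le> sum_move w (Suc N)"
      unfolding sum_move_def using move_nonneg by simp
    ultimately show ?thesis using gap by (intro mult_left_mono add_mono order_refl) auto
  qed
  finally show ?thesis by (simp add: Suc distrib_left power2_eq_square)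
qed

section \<open>Gradient error and descent at the mean iterate\<close>

text \<open>By the tracking invariant the error splits into the deviation of the tracker from its
  mean, the mean estimator error, and the mean effect of taking local gradients at the iterates of
  the agents instead of the mean iterate.\<close>

lemma sq_sum_grad_err_le:
  "sq_sum (grad_err w t) / lmin w t \<le> 3 * (sq_sum (deviation (tracker w t)) / lmin w t
    + sq_sum (est_err w t) / lmin w t + lmin w t * sq_sum (deviation (iter w t)))"
proof -
  let ?m = "real CARD('m)" and ?x = "mean (iter w t)"
  define H where "H j = grad (local_obj P j) (iter w t j) - grad (local_obj P j) ?x" for j
  have "grad_err w t i = deviation (tracker w t) i + mean (est_err w t) + mean H" for i
    unfolding grad_err_def deviation_def est_err_def[abs_def] H_def[abs_def] mean_diff grad_objective
    by (simp add: mean_tracker)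
  then have "sq_sum (grad_err w t)
      \<le> (\<Sum>i\<in>(UNIV :: 'm set). 3 * ((norm (deviation (tracker w t) i))\<^sup>2 + (norm (mean (est_err w t)))\<^sup>2 + (norm (mean H))\<^sup>2))"
    unfolding sq_sum_def by (intro sum_mono) (metis norm_add3_sq_le)
  also have "\<dots> = 3 * (sq_sum (deviation (tracker w t)) + ?m * (norm (mean (est_err w t)))\<^sup>2 + ?m * (norm (mean H))\<^sup>2)"
    by (simp add: sq_sum_def sum.distrib flip: sum_distrib_left)
  also have "\<dots> \<le> 3 * (sq_sum (deviation (tracker w t)) + sq_sum (est_err w t)
      + (lmin w t)\<^sup>2 * sq_sum (deviation (iter w t)))"
  proof -
    have "?m * (norm (mean H))\<^sup>2 \<le> sq_sum H" by (rule norm_mean_sq_le)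
    also have "\<dots> \<le> (\<Sum>j\<in>UNIV. (lmin w t)\<^sup>2 * (norm (deviation (iter w t) j))\<^sup>2)"
      unfolding sq_sum_def H_def deviation_def
      by (intro sum_mono grad_local_obj_diff_le iter_in_ball mean_in_ball)
    also have "\<dots> = (lmin w t)\<^sup>2 * sq_sum (deviation (iter w t))"
      by (simp add: sq_sum_def sum_distrib_left)
    finally show ?thesis using norm_mean_sq_le[of "est_err w t"] by simp
  qed
  finally have "sq_sum (grad_err w t) / lmin w t \<le> 3 * (sq_sum (deviation (tracker w t)) + sq_sum (est_err w t)
      + (lmin w t)\<^sup>2 * sq_sum (deviation (iter w t))) / lmin w t"
    using lmin_pos[of w t] by (intro divide_right_mono) auto
  also have "\<dots> = 3 * (sq_sum (deviation (tracker w t)) / lmin w t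
    + sq_sum (est_err w t) / lmin w t + lmin w t * sq_sum (deviation (iter w t)))"
    using lmin_pos[of w t] by (simp add: field_simps power2_eq_square)
  finally show ?thesis .
qed

lemma sum_grad_err_le_parts:
  "sum_grad_err w T \<le> 3 * (sum_track_dev w T + sum_est_err w T + sum_disagreement w T)"
proof -
  have "sum_grad_err w T \<le> (\<Sum>t<T. 3 * (sq_sum (deviation (tracker w t)) / lmin w t
    + sq_sum (est_err w t) / lmin w t + lmin w t * sq_sum (deviation (iter w t))))"
    unfolding sum_grad_err_def by (intro sum_mono sq_sum_grad_err_le)
  then show ?thesis
    unfolding sum_track_dev_def sum_est_err_def sum_disagreement_def sum_distrib_left[symmetric] sum.distrib .
qed

lemma mean_iter_Suc: "mean (iter w (Suc t)) = mean (iter w t) - mean (upd w t)"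
  using mean_diff[of "mix (mixing P) (iter w t)" "upd w t"]
  by (simp add: iter_Suc mean_mix[OF mixing_rows(2)])

text \<open>Clipping gives a gain of \<open>\<theta> * lmin\<close> times the squared update.
  Young's inequality spends half of it against the gradient error, and smoothness costs a further
  \<open>1 / 2\<close>.\<close>

lemma objective_descent:
  "objective P (mean (iter w (Suc t))) \<le> objective P (mean (iter w t))
    + (sq_sum (grad_err w t) / lmin w t / (2 * \<theta>) - (\<theta> / 2 - 1 / 2) * (lmin w t * sq_sum (upd w t))) / real CARD('m)"
proof -
  let ?x = "mean (iter w t)" and ?x' = "mean (iter w (Suc t))" and ?m = "real CARD('m)"
    and ?l = "lmin w t" and ?F = "grad (objective P)"
  obtain k where k: "?l = lip w t k" by (rule lmin_attained)
  have th: "0 < \<theta>" using theta_pos by simp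
  have l: "0 < ?l" by (rule lmin_pos)
  \<comment> \<open>The ball of the agent with the smallest constant is convex and contains both
    mean iterates, so \<open>lmin\<close> serves on the whole segment.\<close>
  have seg: "closed_segment ?x ?x' \<subseteq> cball (chk w t k) r0"
    by (intro closed_segment_subset mean_in_ball mean_Suc_in_ball convex_cball)
  have "objective P ?x' \<le> objective P ?x + ?F ?x \<bullet> (?x' - ?x) + ?l / 2 * (norm (?x' - ?x))\<^sup>2"
  proof (rule smooth_upper_bound)
    fix z assume "z \<in> closed_segment ?x ?x'"
    then have z: "z \<in> cball (chk w t k) r0" using seg by blast
    show "GDERIV (objective P) z :> ?F z" using GDERIV_objective grad_objective by metis
    show "norm (?F z - ?F ?x) \<le> ?l * norm (z - ?x)"
      unfolding k lip_eq by (intro grad_objective_Lipschitz z mean_in_ball)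
  qed
  also have "?x' - ?x = - mean (upd w t)" by (simp add: mean_iter_Suc)
  also have "?F ?x \<bullet> (- mean (upd w t)) = (\<Sum>i\<in>UNIV. - (?F ?x \<bullet> upd w t i)) / ?m"
    by (simp add: mean_def inner_sum_right sum_negf)
  also have "\<dots> \<le> (\<Sum>i\<in>UNIV. (norm (grad_err w t i))\<^sup>2 / ?l / (2 * \<theta>) - \<theta> / 2 * (?l * (norm (upd w t i))\<^sup>2)) / ?m"
  proof (intro divide_right_mono sum_mono)
    fix i
    let ?u = "upd w t i" and ?e = "grad_err w t i"
    have "\<theta> * ?l * (norm ?u)\<^sup>2 \<le> \<theta> * lip w t i * (norm ?u)\<^sup>2"
      using th by (intro mult_right_mono mult_left_mono lmin_le_lip) auto
    also have "\<dots> \<le> tracker w t i \<bullet> ?u"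
      unfolding upd_def using th lip_pos[of w t i] delta by (intro inner_clip_ge) auto
    finally have y: "\<theta> * ?l * (norm ?u)\<^sup>2 \<le> tracker w t i \<bullet> ?u" .
    have e: "?e \<bullet> ?u \<le> (norm ?e)\<^sup>2 / ?l / (2 * \<theta>) + \<theta> / 2 * (?l * (norm ?u)\<^sup>2)"
    proof -
      have "?e \<bullet> ?u \<le> norm ?e * norm ?u" by (rule norm_cauchy_schwarz)
      also have "\<dots> \<le> (norm ?e)\<^sup>2 / ?l / (2 * \<theta>) + \<theta> / 2 * (?l * (norm ?u)\<^sup>2)"
      proof -
        have "(norm ?e)\<^sup>2 / ?l / (2 * \<theta>) + \<theta> / 2 * (?l * (norm ?u)\<^sup>2) - norm ?e * norm ?u
            = (norm ?e - \<theta> * ?l * norm ?u)\<^sup>2 / (2 * \<theta> * ?l)"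
          using th l by (simp add: field_simps power2_eq_square)
        also have "\<dots> \<ge> 0" using th l by simp
        finally show ?thesis by simp
      qed
      finally show ?thesis .
    qed
    have "?F ?x \<bullet> ?u = tracker w t i \<bullet> ?u - ?e \<bullet> ?u" by (simp add: grad_err_def inner_diff_left)
    then show "- (?F ?x \<bullet> ?u) \<le> (norm ?e)\<^sup>2 / ?l / (2 * \<theta>) - \<theta> / 2 * (?l * (norm ?u)\<^sup>2)"
      using y e by (simp add: mult.assoc)
  qed simp
  also have "(\<Sum>i\<in>UNIV. (norm (grad_err w t i))\<^sup>2 / ?l / (2 * \<theta>) - \<theta> / 2 * (?l * (norm (upd w t i))\<^sup>2))
      = sq_sum (grad_err w t) / ?l / (2 * \<theta>) - \<theta> / 2 * (?l * sq_sum (upd w t))"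
    by (simp add: sq_sum_def sum_subtractf sum_divide_distrib sum_distrib_left)
  also have "?l / 2 * (norm (- mean (upd w t)))\<^sup>2 \<le> 1 / 2 * (?l * sq_sum (upd w t)) / ?m"
  proof -
    have "(norm (mean (upd w t)))\<^sup>2 \<le> sq_sum (upd w t) / ?m"
      using norm_mean_sq_le[of "upd w t"] by (simp add: field_simps)
    then have "?l / 2 * (norm (mean (upd w t)))\<^sup>2 \<le> ?l / 2 * (sq_sum (upd w t) / ?m)"
      using l by (intro mult_left_mono) auto
    then show ?thesis by simp
  qed
  finally show ?thesis by (simp add: left_diff_distrib diff_divide_distrib)
qed

lemma sum_upd_le_gap:
  "(\<theta> / 2 - 1 / 2) * sum_upd w T
    \<le> real CARD('m) * (objective P (init P) - opt_value P) + sum_grad_err w T / (2 * \<theta>)"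
proof -
  let ?m = "real CARD('m)"
  have "objective P (mean (iter w T)) \<le> objective P (init P)
    + (sum_grad_err w T / (2 * \<theta>) - (\<theta> / 2 - 1 / 2) * sum_upd w T) / ?m"
  proof (induction T)
    case 0
    have "iter w 0 = (\<lambda>_. init P)" by (simp add: fun_eq_iff iter_0)
    then show ?case by (simp add: sum_grad_err_def sum_upd_def mean_def sum_constant_scaleR)
  next
    case (Suc T)
    have "sum_grad_err w (Suc T) / (2 * \<theta>) - (\<theta> / 2 - 1 / 2) * sum_upd w (Suc T)
      = (sum_grad_err w T / (2 * \<theta>) - (\<theta> / 2 - 1 / 2) * sum_upd w T)
      + (sq_sum (grad_err w T) / lmin w T / (2 * \<theta>) - (\<theta> / 2 - 1 / 2) * (lmin w T * sq_sum (upd w T)))"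
      by (simp add: sum_grad_err_def sum_upd_def add_divide_distrib distrib_left)
    then show ?case using objective_descent[of w T] Suc by (simp add: add_divide_distrib)
  qed
  then have "opt_value P \<le> objective P (init P)
      + (sum_grad_err w T / (2 * \<theta>) - (\<theta> / 2 - 1 / 2) * sum_upd w T) / ?m"
    using objective_ge_opt_value order_trans by blast
  then have "(opt_value P - objective P (init P)) * ?m \<le> sum_grad_err w T / (2 * \<theta>) - (\<theta> / 2 - 1 / 2) * sum_upd w T"
    by (simp add: pos_le_divide_eq[symmetric])
  then show ?thesis by (simp add: algebra_simps)
qed

end

section \<open>Averaging over the batches\<close>

context cgtvr
begin

lemma batch_size_bounds:
  "1 \<le> batch_size P i" "batch_size P i \<le> data_size P i"
  "sqrt (real (data_size P i)) \<le> real (batch_size P i)"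
  "real (batch_size P i) \<le> 2 * sqrt (real (data_size P i))"
proof -
  let ?s = "sqrt (real (data_size P i))"
  have n: "1 \<le> real (data_size P i)" using data_size_pos[of i] by simp
  then have s: "1 \<le> ?s" by simp
  have b: "real (batch_size P i) = of_int \<lceil>?s\<rceil>"
    using s by (simp add: batch_size_def)
  show ge: "?s \<le> real (batch_size P i)" unfolding b by simp
  show "1 \<le> batch_size P i" using ge s by linarith
  have "real (batch_size P i) < ?s + 1" unfolding b using ceiling_correct[of ?s] by linarith
  then show "real (batch_size P i) \<le> 2 * ?s" using s by linarith
  have "?s * 1 \<le> ?s * ?s" using s by (intro mult_left_mono) auto
  then have "?s \<le> real (data_size P i)" by simp
  then have "\<lceil>?s\<rceil> \<le> int (data_size P i)" by (simp add: ceiling_le_iff)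
  then show "batch_size P i \<le> data_size P i" unfolding batch_size_def by linarith
qed

lemma admissible_batches: "finite (admissible_batches P i)" "admissible_batches P i \<noteq> {}"
proof -
  show "finite (admissible_batches P i)"
    by (rule finite_subset[of _ "Pow {..<data_size P i}"]) (auto simp: admissible_batches_def)
  have "{..<batch_size P i} \<in> admissible_batches P i"
    using batch_size_bounds(2)[of i] by (auto simp: admissible_batches_def)
  then show "admissible_batches P i \<noteq> {}" by blast
qed

abbreviation avg :: "nat \<Rightarrow> ('m batches \<Rightarrow> real) \<Rightarrow> real" where
  "avg T F \<equiv> measure_pmf.expectation (batches_pmf P T) F"

lemma set_batches_pmf:
  "set_pmf (batches_pmf P T) = PiE_dflt (UNIV \<times> {..<T}) {} (\<lambda>(i, t). admissible_batches P i)"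
  unfolding batches_pmf_def
  by (subst set_Pi_pmf) (auto simp: PiE_dflt_def admissible_batches split: prod.splits)

lemma finite_set_batches_pmf: "finite (set_pmf (batches_pmf P T))"
  unfolding set_batches_pmf by (intro finite_PiE_dflt) (auto simp: admissible_batches)

lemma integrable_batches: "integrable (batches_pmf P T) (F :: 'm batches \<Rightarrow> real)"
  by (rule integrable_measure_pmf_finite[OF finite_set_batches_pmf])

lemma avg_mono_support: "(\<And>w. w \<in> set_pmf (batches_pmf P T) \<Longrightarrow> F w \<le> G w) \<Longrightarrow> avg T F \<le> avg T G"
  by (intro integral_mono_AE integrable_batches) (simp add: AE_measure_pmf_iff)

lemma avg_mono: "(\<And>w. F w \<le> G w) \<Longrightarrow> avg T F \<le> avg T G"
  by (rule avg_mono_support)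

lemma avg_add: "avg T (\<lambda>w. F w + G w) = avg T F + avg T G"
  by (intro Bochner_Integration.integral_add integrable_batches)

lemma avg_cmult: "avg T (\<lambda>w. c * F w) = c * avg T F"
  by simp

lemma avg_const: "avg T (\<lambda>w. c) = c"
  by simp

lemma avg_sum: "avg T (\<lambda>w. \<Sum>i\<in>I. F i w) = (\<Sum>i\<in>I. avg T (F i))"
  by (intro Bochner_Integration.integral_sum integrable_batches)

section \<open>Dependence of the run on the batches\<close>

lemma run_cong:
  assumes "\<And>s i. s < t \<Longrightarrow> w (i, s) = w' (i, s)"
  shows "run P \<delta> \<rho> \<theta> r0 w t = run P \<delta> \<rho> \<theta> r0 w' t"
  using assms
proof (induction t)
  case (Suc t)
  have "(\<lambda>i. w (i, t)) = (\<lambda>i. w' (i, t))" using Suc.prems by (simp add: fun_eq_iff)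
  then show ?case using Suc by simp
qed simp

text \<open>The batch of time \<open>Suc t\<close> first enters through the estimator of that time:
  the iterate and the restart signal of time \<open>Suc t\<close> are settled by earlier
  batches.\<close>

lemma resample_unchanged:
  fixes w :: "'m batches" and i t B
  defines "w' \<equiv> w((i, Suc t) := B)"
  shows "s \<le> Suc t \<Longrightarrow> iter w' s = iter w s" "s \<le> Suc t \<Longrightarrow> restart w' s = restart w s"
    and "s \<le> t \<Longrightarrow> estim w' s = estim w s" "s \<le> t \<Longrightarrow> lip w' s = lip w s"
    and "s \<le> t \<Longrightarrow> count w' s = count w s"
proof -
  have run: "run P \<delta> \<rho> \<theta> r0 w' s = run P \<delta> \<rho> \<theta> r0 w s" if "s \<le> Suc t" for s
    using that by (intro run_cong) (simp add: w'_def)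
  show "s \<le> Suc t \<Longrightarrow> iter w' s = iter w s" "s \<le> Suc t \<Longrightarrow> restart w' s = restart w s"
    and "s \<le> t \<Longrightarrow> estim w' s = estim w s" "s \<le> t \<Longrightarrow> lip w' s = lip w s"
    and "s \<le> t \<Longrightarrow> count w' s = count w s"
    by (simp_all only: fun_eq_iff run_defs run Suc_le_mono le_SucI simp_thms)
qed

lemma count_less: "count w t i < batch_size P i"
proof (induction t)
  case 0
  show ?case using batch_size_bounds(1)[of i] by (simp add: count_restart[OF restart_0])
next
  case (Suc t)
  show ?case
  proof (cases "restart w (Suc t) i")
    case True
    then show ?thesis using batch_size_bounds(1)[of i] by (simp add: count_restart)
  next
    case False
    then have "count w t i \<noteq> batch_size P i - 1" by (simp add: restart_Suc)
    then show ?thesis using False Suc by (simp add: count_Suc)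
  qed
qed

lemma est_err_restart: "restart w t i \<Longrightarrow> est_err w t i = 0"
  by (simp add: est_err_def estim_restart)

section \<open>Variance of the recursive estimator\<close>

text \<open>With the past frozen, the new error is the old one plus the centred noise of one batch,
  whose size is controlled by the Lipschitz constant of the agent's own ball.\<close>

lemma expectation_est_err_le:
  assumes "\<not> restart w (Suc t) i"
  shows "measure_pmf.expectation (pmf_of_set (admissible_batches P i))
      (\<lambda>B. (norm (est_err (w((i, Suc t) := B)) (Suc t) i))\<^sup>2)
    \<le> (norm (est_err w t i))\<^sup>2 + (1 / real (batch_size P i)) * ((lip w t i)\<^sup>2 * (norm (move w t i))\<^sup>2)"
proof -
  let ?b = "batch_size P i" and ?n = "data_size P i"
  define a where "a j = grad (loss P i j) (iter w (Suc t) i) - grad (loss P i j) (iter w t i)" for j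
  have adm: "admissible_batches P i = {B. B \<subseteq> {..<?n} \<and> card B = ?b}"
    by (simp add: admissible_batches_def)
  have err: "est_err (w((i, Suc t) := B)) (Suc t) i = est_err w t i +
      ((1 / real ?b) *\<^sub>R (\<Sum>j\<in>B. a j) - (1 / real ?n) *\<^sub>R (\<Sum>j<?n. a j))"
    if "B \<in> admissible_batches P i" for B
  proof -
    let ?w = "w((i, Suc t) := B)"
    have nr: "\<not> restart ?w (Suc t) i" using assms by (simp add: resample_unchanged)
    have cB: "card B = ?b" using that by (simp add: admissible_batches_def)
    have "estim ?w (Suc t) i = estim w t i + (1 / real ?b) *\<^sub>R (\<Sum>j\<in>B. a j)"
      using estim_Suc[OF nr] cB by (simp add: resample_unchanged a_def)
    moreover have "grad (local_obj P i) (iter w (Suc t) i) - grad (local_obj P i) (iter w t i)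
        = (1 / real ?n) *\<^sub>R (\<Sum>j<?n. a j)"
      by (simp add: grad_local_obj a_def sum_subtractf scaleR_right_diff_distrib)
    ultimately show ?thesis by (simp add: est_err_def resample_unchanged algebra_simps)
  qed
  have "measure_pmf.expectation (pmf_of_set (admissible_batches P i))
      (\<lambda>B. (norm (est_err (w((i, Suc t) := B)) (Suc t) i))\<^sup>2)
    = measure_pmf.expectation (pmf_of_set (admissible_batches P i))
      (\<lambda>B. (norm (est_err w t i + ((1 / real ?b) *\<^sub>R (\<Sum>j\<in>B. a j) - (1 / real ?n) *\<^sub>R (\<Sum>j<?n. a j))))\<^sup>2)"
    using admissible_batches[of i] err by (simp add: integral_pmf_of_set)
  also have "\<dots> \<le> (norm (est_err w t i))\<^sup>2 + (1 / real ?b) * ((\<Sum>j<?n. (norm (a j))\<^sup>2) / real ?n)"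
    using expectation_batch_norm_sq_le[of "{..<?n}" ?b "est_err w t i" a] batch_size_bounds[of i]
    unfolding adm by simp
  also have "\<dots> \<le> (norm (est_err w t i))\<^sup>2 + (1 / real ?b) * ((lip w t i)\<^sup>2 * (norm (move w t i))\<^sup>2)"
    unfolding a_def move_def lip_eq
    by (intro add_left_mono mult_left_mono losses_Lipschitz iter_in_ball iter_Suc_in_ball) simp
  finally show ?thesis .
qed

text \<open>The divisor is the agent's own constant, which is frozen during an epoch. With
  \<open>lmin\<close> the potential could pick up a factor \<open>\<gamma>\<close> at every
  step.\<close>

definition scaled_err :: "'m batches \<Rightarrow> nat \<Rightarrow> 'm \<Rightarrow> real" where
  "scaled_err w t i = (norm (est_err w t i))\<^sup>2 / lip w t i"

text \<open>
  An error made now is carried to the end of the epoch, so it is charged once for each iteration that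
  remains.
\<close>
definition potential :: "'m batches \<Rightarrow> nat \<Rightarrow> 'm \<Rightarrow> real" where
  "potential w t i = (real (batch_size P i) - real (count w t i)) * scaled_err w t i"

lemma scaled_err_nonneg: "0 \<le> scaled_err w t i"
  unfolding scaled_err_def using lip_pos[of w t i] by simp

lemma scaled_err_le_potential: "scaled_err w t i \<le> potential w t i"
proof -
  have "1 * scaled_err w t i \<le> potential w t i"
    unfolding potential_def using count_less[of w t i]
    by (intro mult_right_mono scaled_err_nonneg) linarith
  then show ?thesis by simp
qed

text \<open>A supermartingale-type inequality. At a restart the estimator is exact and the potential
  drops to zero; otherwise one unit of charge is released and fresh noise is charged for the rest of
  the epoch.\<close>

lemma expectation_potential_le:
  "measure_pmf.expectation (pmf_of_set (admissible_batches P i)) (\<lambda>B. potential (w((i, Suc t) := B)) (Suc t) i)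
    \<le> potential w t i - scaled_err w t i + lip w t i * (norm (move w t i))\<^sup>2"
proof (cases "restart w (Suc t) i")
  case True
  have "potential (w((i, Suc t) := B)) (Suc t) i = 0" for B
    unfolding potential_def scaled_err_def using True by (simp add: est_err_restart resample_unchanged)
  moreover have "0 \<le> lip w t i * (norm (move w t i))\<^sup>2" using lip_pos[of w t i] by simp
  ultimately show ?thesis using scaled_err_le_potential[of w t i] by simp
next
  case False
  let ?b = "real (batch_size P i)" and ?c = "real (count w t i)" and ?L = "lip w t i"
  let ?e = "(norm (est_err w t i))\<^sup>2" and ?d = "(norm (move w t i))\<^sup>2"
  have L: "?L > 0" by (rule lip_pos)
  have b: "?b > 0" using batch_size_bounds(1)[of i] by simp
  have c: "0 \<le> ?b - ?c - 1" using count_less[of w t i] by linarith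
  have pot: "potential (w((i, Suc t) := B)) (Suc t) i
      = (?b - ?c - 1) / ?L * (norm (est_err (w((i, Suc t) := B)) (Suc t) i))\<^sup>2" for B
    unfolding potential_def scaled_err_def using False
    by (simp add: lip_Suc count_Suc resample_unchanged)
  have "measure_pmf.expectation (pmf_of_set (admissible_batches P i)) (\<lambda>B. potential (w((i, Suc t) := B)) (Suc t) i)
      \<le> (?b - ?c - 1) / ?L * (?e + (1 / ?b) * (?L\<^sup>2 * ?d))"
    unfolding pot integral_mult_right_zero
    using c L by (intro mult_left_mono expectation_est_err_le False divide_nonneg_pos)
  also have "\<dots> = (?b - ?c - 1) * (?e / ?L) + (?b - ?c - 1) / ?b * (?L * ?d)"
    using L by (simp add: distrib_left power2_eq_square)
  \<comment> \<open>The fresh noise carries the factor \<open>1 / ?b\<close> and is charged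
    \<open>?b - ?c - 1\<close> times: batch size equal to epoch length keeps the total charge at
    most one.\<close>
  also have "\<dots> \<le> (?b - ?c - 1) * (?e / ?L) + 1 * (?L * ?d)"
    using L b by (intro add_left_mono mult_right_mono) (auto simp: divide_le_eq)
  also have "(?b - ?c - 1) * (?e / ?L) = potential w t i - scaled_err w t i"
    unfolding potential_def scaled_err_def by (simp only: left_diff_distrib mult_1)
  also have "1 * (?L * ?d) = ?L * ?d" by simp
  finally show ?thesis .
qed

text \<open>The induction step redraws only the coordinate \<open>(i, Suc t)\<close>, which is
  random because \<open>Suc t < T\<close>.\<close>

lemma avg_potential_le:
  "t < T \<Longrightarrow> avg T (\<lambda>w. (\<Sum>s<t. scaled_err w s i) + potential w t i)
    \<le> avg T (\<lambda>w. \<Sum>s<t. lip w s i * (norm (move w s i))\<^sup>2)"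
proof (induction t)
  case 0
  have "potential w 0 i = 0" for w
    unfolding potential_def scaled_err_def by (simp add: est_err_restart[OF restart_0])
  then show ?case by simp
next
  case (Suc t)
  let ?F = "\<lambda>w. (\<Sum>s<Suc t. scaled_err w s i) + potential w (Suc t) i"
  let ?G = "\<lambda>w. ((\<Sum>s<t. scaled_err w s i) + potential w t i) + lip w t i * (norm (move w t i))\<^sup>2"
  let ?p = "pmf_of_set (admissible_batches P i)"
  have se: "scaled_err (w((i, Suc t) := B)) s i = scaled_err w s i" if "s \<le> t" for w B s
    unfolding scaled_err_def est_err_def using that by (simp add: resample_unchanged)
  have "avg T ?F \<le> avg T ?G"
    unfolding batches_pmf_def
  proof (rule expectation_Pi_pmf_resample_mono[where a = "(i, Suc t)"])
    show "(i, Suc t) \<in> UNIV \<times> {..<T}" using Suc.prems by simp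
    show "finite (set_pmf (case x of (i, t) \<Rightarrow> pmf_of_set (admissible_batches P i)))" for x :: "'m \<times> nat"
      using admissible_batches by (cases x) simp
    fix w :: "'m batches"
    have int: "integrable ?p (H :: nat set \<Rightarrow> real)" for H
      by (rule integrable_measure_pmf_finite) (simp add: admissible_batches)
    have "measure_pmf.expectation ?p (\<lambda>B. ?F (w((i, Suc t) := B)))
        = (\<Sum>s<Suc t. scaled_err w s i) + measure_pmf.expectation ?p (\<lambda>B. potential (w((i, Suc t) := B)) (Suc t) i)"
      using int by (simp add: se)
    also have "\<dots> \<le> (\<Sum>s<Suc t. scaled_err w s i) + (potential w t i - scaled_err w t i + lip w t i * (norm (move w t i))\<^sup>2)"
      by (intro add_left_mono expectation_potential_le)
    also have "\<dots> = measure_pmf.expectation ?p (\<lambda>B. ?G (w((i, Suc t) := B)))"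
      by (simp add: se potential_def move_def resample_unchanged)
    finally show "measure_pmf.expectation (case (i, Suc t) of (i, t) \<Rightarrow> pmf_of_set (admissible_batches P i)) (\<lambda>B. ?F (w((i, Suc t) := B)))
      \<le> measure_pmf.expectation (case (i, Suc t) of (i, t) \<Rightarrow> pmf_of_set (admissible_batches P i)) (\<lambda>B. ?G (w((i, Suc t) := B)))"
      by simp
  qed simp
  also have "\<dots> = avg T (\<lambda>w. (\<Sum>s<t. scaled_err w s i) + potential w t i) + avg T (\<lambda>w. lip w t i * (norm (move w t i))\<^sup>2)"
    by (rule avg_add)
  also have "\<dots> \<le> avg T (\<lambda>w. \<Sum>s<t. lip w s i * (norm (move w s i))\<^sup>2) + avg T (\<lambda>w. lip w t i * (norm (move w t i))\<^sup>2)"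
    using Suc by simp
  also have "\<dots> = avg T (\<lambda>w. \<Sum>s<Suc t. lip w s i * (norm (move w s i))\<^sup>2)"
    by (simp add: avg_add[symmetric])
  finally show ?case .
qed

lemma avg_sum_scaled_err_le:
  "avg T (\<lambda>w. \<Sum>s<T. scaled_err w s i) \<le> avg T (\<lambda>w. \<Sum>s<T. lip w s i * (norm (move w s i))\<^sup>2)"
proof (cases T)
  case (Suc N)
  have "avg T (\<lambda>w. \<Sum>s<Suc N. scaled_err w s i) \<le> avg T (\<lambda>w. (\<Sum>s<N. scaled_err w s i) + potential w N i)"
    by (intro avg_mono) (simp add: scaled_err_le_potential)
  also have "\<dots> \<le> avg T (\<lambda>w. \<Sum>s<N. lip w s i * (norm (move w s i))\<^sup>2)"
    by (rule avg_potential_le) (simp add: Suc)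
  also have "\<dots> \<le> avg T (\<lambda>w. \<Sum>s<Suc N. lip w s i * (norm (move w s i))\<^sup>2)"
    using lip_pos by (intro avg_mono) (simp add: less_imp_le)
  finally show ?thesis by (simp only: Suc)
qed simp

text \<open>One factor 4 passes from \<open>lmin\<close> to the agent's own constant in the errors,
  another returns to \<open>lmin\<close> in the moves.\<close>

lemma avg_sum_est_err_le: "avg T (\<lambda>w. sum_est_err w T) \<le> 16 * avg T (\<lambda>w. sum_move w T)"
proof -
  have e: "sum_est_err w T \<le> 4 * (\<Sum>i\<in>UNIV. \<Sum>s<T. scaled_err w s i)" for w
  proof -
    have "(norm (est_err w t i))\<^sup>2 / lmin w t \<le> 4 * scaled_err w t i" for t i
    proof -
      have "1 / lmin w t \<le> 4 / lip w t i"
        using lip_le_4_lmin[of w t i] lip_pos[of w t i] lmin_pos[of w t] by (simp add: field_simps)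
      from mult_left_mono[OF this, of "(norm (est_err w t i))\<^sup>2"] show ?thesis
        by (simp add: scaled_err_def mult.commute)
    qed
    then have "sum_est_err w T \<le> (\<Sum>t<T. \<Sum>i\<in>UNIV. 4 * scaled_err w t i)"
      unfolding sum_est_err_def sq_sum_def sum_divide_distrib by (intro sum_mono)
    also have "\<dots> = 4 * (\<Sum>i\<in>UNIV. \<Sum>s<T. scaled_err w s i)"
      unfolding sum_distrib_left by (rule sum.swap)
    finally show ?thesis .
  qed
  have m: "(\<Sum>i\<in>UNIV. \<Sum>s<T. lip w s i * (norm (move w s i))\<^sup>2) \<le> 4 * sum_move w T" for w
  proof -
    have "(\<Sum>i\<in>UNIV. \<Sum>s<T. lip w s i * (norm (move w s i))\<^sup>2)
        \<le> (\<Sum>i\<in>UNIV. \<Sum>s<T. 4 * lmin w s * (norm (move w s i))\<^sup>2)"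
      by (intro sum_mono mult_right_mono lip_le_4_lmin) simp
    also have "\<dots> = 4 * sum_move w T"
      unfolding sum_move_def sq_sum_def sum_distrib_left mult.assoc by (rule sum.swap)
    finally show ?thesis .
  qed
  have "avg T (\<lambda>w. sum_est_err w T) \<le> 4 * (\<Sum>i\<in>UNIV. avg T (\<lambda>w. \<Sum>s<T. scaled_err w s i))"
    unfolding avg_sum[symmetric] avg_cmult[symmetric] by (intro avg_mono e)
  also have "\<dots> \<le> 4 * (\<Sum>i\<in>UNIV. avg T (\<lambda>w. \<Sum>s<T. lip w s i * (norm (move w s i))\<^sup>2))"
    by (intro mult_left_mono sum_mono avg_sum_scaled_err_le) simp
  also have "\<dots> \<le> 4 * (4 * avg T (\<lambda>w. sum_move w T))"
    unfolding avg_sum[symmetric] avg_cmult[symmetric] by (intro mult_left_mono avg_mono m) simp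
  finally show ?thesis by simp
qed

section \<open>Closing the energy inequality\<close>

lemma avg_sum_grad_err_le:
  "avg T (\<lambda>w. sum_grad_err w T)
    \<le> 6 / (1 - \<eta>) * initial_heterogeneity + 33384 / (1 - \<eta>)^4 * avg T (\<lambda>w. sum_upd w T)"
proof -
  define r where "r = 1 / (1 - \<eta>)\<^sup>2"
  define U where "U = avg T (\<lambda>w. sum_upd w T)"
  define M where "M = avg T (\<lambda>w. sum_move w T)"
  define Z where "Z = avg T (\<lambda>w. sum_est_err w T)"
  define h where "h = 6 / (1 - \<eta>) * initial_heterogeneity"
  have r: "1 \<le> r" using gap by (simp add: r_def power_le_one)
  have U: "0 \<le> U" unfolding U_def by (intro Bochner_Integration.integral_nonneg sum_upd_nonneg)
  have M: "M \<le> 27 * r * U"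
  proof -
    have "M \<le> avg T (\<lambda>w. 27 / (1 - \<eta>)\<^sup>2 * sum_upd w T)"
      unfolding M_def by (intro avg_mono sum_move_le)
    then show ?thesis unfolding avg_cmult by (simp add: U_def r_def)
  qed
  have Z: "Z \<le> 16 * M" using avg_sum_est_err_le by (simp add: Z_def M_def)
  have "sum_grad_err w T \<le> h + ((72 * r + 3) * sum_est_err w T + (36 * r * sum_move w T + 12 * r * sum_upd w T))" for w
  proof -
    have "sum_grad_err w T \<le> 3 * ((2 / (1 - \<eta>) * initial_heterogeneity
      + 12 / (1 - \<eta>)\<^sup>2 * (2 * sum_est_err w T + sum_move w T)) + sum_est_err w T + 4 / (1 - \<eta>)\<^sup>2 * sum_upd w T)"
      by (rule order_trans[OF sum_grad_err_le_parts])
        (intro mult_left_mono add_mono sum_track_dev_le sum_disagreement_le order_refl, simp)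
    also have "\<dots> = h + ((72 * r + 3) * sum_est_err w T + (36 * r * sum_move w T + 12 * r * sum_upd w T))"
      by (simp add: r_def h_def algebra_simps)
    finally show ?thesis .
  qed
  then have "avg T (\<lambda>w. sum_grad_err w T) \<le> avg T (\<lambda>w. h + ((72 * r + 3) * sum_est_err w T + (36 * r * sum_move w T + 12 * r * sum_upd w T)))"
    by (rule avg_mono)
  then have "avg T (\<lambda>w. sum_grad_err w T) \<le> h + ((72 * r + 3) * Z + (36 * r * M + 12 * r * U))"
    unfolding avg_add avg_cmult avg_const Z_def M_def U_def .
  \<comment> \<open>Since \<open>1 \<le> r\<close>, all terms can be collected at order
    \<open>r\<^sup>2\<close>; the total is
    \<open>75 * 16 * 27 + 36 * 27 + 12 = 33384\<close>.\<close>
  also have "\<dots> \<le> h + ((75 * r) * (16 * (27 * r * U)) + (36 * r * (27 * r * U) + 12 * r * (r * U)))"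
  proof -
    have MZ: "Z \<le> 16 * (27 * r * U)" using M Z by linarith
    have "0 \<le> 16 * (27 * r * U)" using r U by simp
    then have "(72 * r + 3) * (16 * (27 * r * U)) \<le> (75 * r) * (16 * (27 * r * U))"
      using r by (intro mult_right_mono) auto
    moreover have "(72 * r + 3) * Z \<le> (72 * r + 3) * (16 * (27 * r * U))"
      using r MZ by (intro mult_left_mono) auto
    moreover have "36 * r * M \<le> 36 * r * (27 * r * U)" using M r by (intro mult_left_mono) auto
    moreover have "12 * r * U \<le> 12 * r * (r * U)"
      using r U mult_right_mono[of 1 r U] by (intro mult_left_mono) auto
    ultimately show ?thesis by linarith
  qed
  also have "\<dots> = h + 33384 * r\<^sup>2 * U" by (simp add: power2_eq_square)
  also have "r\<^sup>2 = 1 / (1 - \<eta>)^4" by (simp add: r_def power_divide flip: power_mult)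
  finally show ?thesis by (simp add: h_def U_def)
qed

text \<open>At most \<open>2 * U\<close> returns through the gradient error, which leaves
  \<open>\<theta> / 2 - 5 / 2 \<ge> \<theta> / 4\<close> in front of the energy. The heterogeneity
  arrives with \<open>3 / \<theta>\<close>, below the \<open>5 / 2\<close> provided in
  \<open>Delta_f\<close>.\<close>

lemma avg_sum_upd_le: "avg T (\<lambda>w. sum_upd w T) \<le> 4 * real CARD('m) * Delta_f P \<eta> r0 / \<theta>"
proof -
  define U where "U = avg T (\<lambda>w. sum_upd w T)"
  define h where "h = initial_heterogeneity"
  define D where "D = real CARD('m) * (objective P (init P) - opt_value P)"
  have th: "0 < \<theta>" "28 \<le> \<theta>" using theta_pos by auto
  have U: "0 \<le> U" unfolding U_def by (intro Bochner_Integration.integral_nonneg sum_upd_nonneg)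
  have h: "0 \<le> h / (1 - \<eta>)" using gap initial_heterogeneity_nonneg by (simp add: h_def)
  have "(\<theta> / 2 - 1 / 2) * sum_upd w T \<le> D + (1 / (2 * \<theta>)) * sum_grad_err w T" for w
    using sum_upd_le_gap[of w T] by (simp add: D_def)
  then have "avg T (\<lambda>w. (\<theta> / 2 - 1 / 2) * sum_upd w T) \<le> avg T (\<lambda>w. D + (1 / (2 * \<theta>)) * sum_grad_err w T)"
    by (rule avg_mono)
  then have "(\<theta> / 2 - 1 / 2) * U \<le> D + (1 / (2 * \<theta>)) * avg T (\<lambda>w. sum_grad_err w T)"
    unfolding avg_add avg_cmult avg_const U_def .
  also have "\<dots> \<le> D + (1 / (2 * \<theta>)) * (6 / (1 - \<eta>) * h + 33384 / (1 - \<eta>)^4 * U)"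
    unfolding U_def h_def using th by (intro add_left_mono mult_left_mono avg_sum_grad_err_le) auto
  also have "\<dots> = D + 3 / \<theta> * (h / (1 - \<eta>)) + 16692 / (1 - \<eta>)^4 / \<theta> * U"
    by (simp add: distrib_left)
  also have "\<dots> \<le> D + 5 / 2 * (h / (1 - \<eta>)) + 2 * U"
  proof (intro add_mono mult_right_mono order_refl U h)
    show "3 / \<theta> \<le> 5 / 2" using th by (simp add: field_simps)
    have "16692 / (1 - \<eta>)^4 \<le> 19200 / (1 - \<eta>)^4" by (intro divide_right_mono) auto
    also have "\<dots> \<le> 2 * \<theta>" using theta_ge by simp
    finally show "16692 / (1 - \<eta>)^4 / \<theta> \<le> 2" unfolding pos_divide_le_eq[OF th(1)] .
  qed
  finally have "(\<theta> / 2 - 5 / 2) * U \<le> D + 5 / 2 * (h / (1 - \<eta>))"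
    by (simp add: left_diff_distrib)
  also have "\<dots> = real CARD('m) * Delta_f P \<eta> r0" by (simp add: Delta_f_eq D_def h_def)
  finally have "(\<theta> / 2 - 5 / 2) * U \<le> real CARD('m) * Delta_f P \<eta> r0" .
  moreover have "\<theta> / 4 * U \<le> (\<theta> / 2 - 5 / 2) * U" using th U by (intro mult_right_mono) auto
  ultimately have "\<theta> / 4 * U \<le> real CARD('m) * Delta_f P \<eta> r0" by linarith
  then show ?thesis using th by (simp add: U_def field_simps)
qed

lemma Delta_f_nonneg: "0 \<le> Delta_f P \<eta> r0"
  and initial_heterogeneity_le: "initial_heterogeneity \<le> 2 * (1 - \<eta>) / 5 * (real CARD('m) * Delta_f P \<eta> r0)"
proof -
  have gap0: "0 \<le> real CARD('m) * (objective P (init P) - opt_value P)"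
    using objective_ge_opt_value[of "init P"] by simp
  then have ge: "5 * initial_heterogeneity / (2 * (1 - \<eta>)) \<le> real CARD('m) * Delta_f P \<eta> r0"
    by (simp add: Delta_f_eq)
  then show "initial_heterogeneity \<le> 2 * (1 - \<eta>) / 5 * (real CARD('m) * Delta_f P \<eta> r0)"
    using gap by (simp add: field_simps)
  have "0 \<le> 5 * initial_heterogeneity / (2 * (1 - \<eta>))"
    using gap initial_heterogeneity_nonneg by simp
  then have "0 \<le> real CARD('m) * Delta_f P \<eta> r0" using ge by linarith
  then show "0 \<le> Delta_f P \<eta> r0" by (simp add: zero_le_mult_iff)
qed

end

section \<open>Restarts, samples and the gradient mapping\<close>

context cgtvr
begin

section \<open>Early restarts\<close>

definition early :: "'m batches \<Rightarrow> 'm \<Rightarrow> nat \<Rightarrow> bool" where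
  "early w i t \<longleftrightarrow> \<rho> \<le> norm (iter w (Suc t) i - chk w t i) \<and> count w t i \<noteq> batch_size P i - 1"

definition num_early :: "'m batches \<Rightarrow> 'm \<Rightarrow> nat \<Rightarrow> nat" where
  "num_early w i T = card {t. t < T \<and> early w i t}"

lemma early_restart_eq: "early_restart P \<delta> \<rho> \<theta> r0 w i t \<longleftrightarrow> early w i t"
  unfolding early_restart_def early_def run_defs Let_def by simp

lemma num_early_0: "num_early w i 0 = 0"
  by (simp add: num_early_def)

lemma num_early_Suc: "num_early w i (Suc t) = num_early w i t + (if early w i t then 1 else 0)"
proof -
  have "{s. s < Suc t \<and> early w i s} = {s. s < t \<and> early w i s} \<union> (if early w i t then {t} else {})"
    by (auto simp: less_Suc_eq)
  then show ?thesis by (simp add: num_early_def)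
qed

lemma early_imp_restart: "early w i t \<Longrightarrow> restart w (Suc t) i"
  by (simp add: early_def restart_Suc)

lemma count_le: "count w t i \<le> t"
proof (induction t)
  case (Suc t)
  then show ?case by (cases "restart w (Suc t) i") (simp_all add: count_restart count_Suc)
qed (simp add: count_restart[OF restart_0])

lemma chk_eq_iter: "chk w t i = iter w (t - count w t i) i"
proof (induction t)
  case (Suc t)
  then show ?case
    by (cases "restart w (Suc t) i") (simp_all add: chk_restart chk_Suc count_restart count_Suc)
qed (simp add: chk_restart[OF restart_0] count_restart[OF restart_0])

lemma mean_iter_diff:
  "s \<le> t \<Longrightarrow> mean (iter w s) - mean (iter w t) = (\<Sum>r\<in>{s..<t}. mean (upd w r))"
proof (induction t rule: dec_induct)
  case (step n)
  then show ?case by (simp add: mean_iter_Suc algebra_simps)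
qed simp

text \<open>
  An early restart means that agent \<open>i\<close> moved by \<open>\<rho>\<close> within an epoch; consensus makes the mean iterate
  move by \<open>\<rho> / 2\<close>, and Cauchy-Schwarz over the at most \<open>\<tau>\<^sub>i\<close> steps of the epoch bounds this.
\<close>
lemma early_epoch_energy:
  assumes "early w i t"
  shows "\<rho>\<^sup>2 / (4 * real (batch_size P i))
    \<le> (\<Sum>r\<in>{t - count w t i..<Suc t}. (norm (mean (upd w r)))\<^sup>2)"
proof -
  define s where "s = t - count w t i"
  define S where "S = (\<Sum>r\<in>{s..<Suc t}. (norm (mean (upd w r)))\<^sup>2)"
  let ?m = "mean (iter w s) - mean (iter w (Suc t))"
  have s: "s \<le> Suc t" "Suc t - s \<le> batch_size P i"
    using count_less[of w t i] count_le[of w t i] by (auto simp: s_def)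
  have "\<rho> \<le> norm (iter w (Suc t) i - iter w s i)"
    using assms by (simp add: early_def chk_eq_iter s_def)
  also have "iter w (Suc t) i - iter w s i = (iter w (Suc t) i - mean (iter w (Suc t)))
      + - (iter w s i - mean (iter w s)) + - ?m" by simp
  also have "norm \<dots> \<le> norm (iter w (Suc t) i - mean (iter w (Suc t))) + norm (iter w s i - mean (iter w s)) + norm ?m"
    by (metis norm_minus_cancel norm_triangle_ineq norm_triangle_mono order_refl)
  also have "\<dots> \<le> spread + spread + norm ?m"
    by (intro add_mono iter_mean_dist order_refl)
  finally have "\<rho> / 2 \<le> norm ?m" using spread_le(1) by linarith
  then have "(\<rho> / 2)\<^sup>2 \<le> (norm ?m)\<^sup>2" using rho by (intro power_mono) auto
  also have "\<dots> \<le> real (card {s..<Suc t}) * S"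
    unfolding mean_iter_diff[OF s(1)] S_def by (rule norm_sum_sq_le)
  also have "\<dots> \<le> real (batch_size P i) * S"
    using s(2) unfolding S_def by (intro mult_right_mono sum_nonneg) auto
  finally show ?thesis
    using batch_size_bounds(1)[of i] unfolding S_def s_def by (simp add: field_simps)
qed

text \<open>The sum stops at the start of the running epoch, so the steps of that epoch are still
  free to pay when it ends early; no step pays twice.\<close>

lemma num_early_energy:
  "real (num_early w i t) * (\<rho>\<^sup>2 / (4 * real (batch_size P i)))
    \<le> (\<Sum>r<t - count w t i. (norm (mean (upd w r)))\<^sup>2)"
proof (induction t)
  case 0
  then show ?case by (simp add: num_early_0 sum_nonneg)
next
  case (Suc t)
  let ?k = "\<rho>\<^sup>2 / (4 * real (batch_size P i))" and ?g = "\<lambda>r. (norm (mean (upd w r)))\<^sup>2"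
  let ?s = "t - count w t i"
  show ?case
  proof (cases "restart w (Suc t) i")
    case False
    then show ?thesis using Suc early_imp_restart by (auto simp: num_early_Suc count_Suc)
  next
    case True
    have split: "(\<Sum>r<Suc t. ?g r) = (\<Sum>r<?s. ?g r) + (\<Sum>r\<in>{?s..<Suc t}. ?g r)"
      using sum.atLeastLessThan_concat[of 0 ?s "Suc t" ?g] by (simp add: atLeast0LessThan)
    have "real (num_early w i (Suc t)) * ?k \<le> (\<Sum>r<Suc t. ?g r)"
    proof (cases "early w i t")
      case True
      then have "real (num_early w i (Suc t)) * ?k = real (num_early w i t) * ?k + ?k"
        by (simp only: num_early_Suc if_True of_nat_add of_nat_1 distrib_right mult_1)
      then show ?thesis unfolding split using Suc early_epoch_energy[OF True] by linarith
    next
      case False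
      then have "real (num_early w i (Suc t)) * ?k = real (num_early w i t) * ?k"
        by (simp add: num_early_Suc)
      moreover have "0 \<le> (\<Sum>r\<in>{?s..<Suc t}. ?g r)" by (intro sum_nonneg) simp
      ultimately show ?thesis unfolding split using Suc by linarith
    qed
    then show ?thesis using True by (simp add: count_restart)
  qed
qed

text \<open>The weights may be inserted because the Lipschitz constants are at least one; the
  squared mean update is at most the average squared update.\<close>

lemma num_early_le_sum_upd:
  "real (num_early w i T) \<le> 4 * real (batch_size P i) / (\<rho>\<^sup>2 * real CARD('m)) * sum_upd w T"
proof -
  let ?b = "real (batch_size P i)" and ?m = "real CARD('m)" and ?g = "\<lambda>r. (norm (mean (upd w r)))\<^sup>2"
  have b: "?b > 0" using batch_size_bounds(1)[of i] by simp
  have "real (num_early w i T) * (\<rho>\<^sup>2 / (4 * ?b)) \<le> (\<Sum>r<T - count w T i. ?g r)"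
    by (rule num_early_energy)
  also have "\<dots> \<le> (\<Sum>r<T. ?g r)"
    by (intro sum_mono2) auto
  also have "\<dots> \<le> (\<Sum>r<T. lmin w r * sq_sum (upd w r) / ?m)"
  proof (intro sum_mono)
    fix r
    have "?m * ?g r \<le> 1 * sq_sum (upd w r)" using norm_mean_sq_le[of "upd w r"] by simp
    also have "\<dots> \<le> lmin w r * sq_sum (upd w r)"
      by (intro mult_right_mono lmin_ge_1 sq_sum_nonneg)
    finally show "?g r \<le> lmin w r * sq_sum (upd w r) / ?m" by (simp add: field_simps)
  qed
  also have "\<dots> = sum_upd w T / ?m" by (simp add: sum_upd_def sum_divide_distrib)
  finally show ?thesis using b rho by (simp add: field_simps)
qed

lemma avg_num_early_le:
  "avg T (\<lambda>w. real (num_early w i T)) \<le> 16 * Delta_f P \<eta> r0 * real (batch_size P i) / (\<theta> * \<rho>\<^sup>2)"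
proof -
  let ?c = "4 * real (batch_size P i) / (\<rho>\<^sup>2 * real CARD('m))"
  have "avg T (\<lambda>w. real (num_early w i T)) \<le> avg T (\<lambda>w. ?c * sum_upd w T)"
    by (intro avg_mono num_early_le_sum_upd)
  also have "\<dots> \<le> ?c * (4 * real CARD('m) * Delta_f P \<eta> r0 / \<theta>)"
    unfolding avg_cmult by (intro mult_left_mono avg_sum_upd_le) simp
  also have "\<dots> = 16 * Delta_f P \<eta> r0 * real (batch_size P i) / (\<theta> * \<rho>\<^sup>2)"
    using rho theta_pos by (simp add: field_simps)
  finally show ?thesis .
qed

lemma expected_early_restarts_le:
  "expected_early_restarts P \<delta> \<rho> \<theta> r0 T i
    \<le> 16 * Delta_f P \<eta> r0 * real (batch_size P i) / (\<theta> * \<rho>\<^sup>2)"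
  using avg_num_early_le[of T i]
  by (simp add: expected_early_restarts_def num_early_restarts_def early_restart_eq num_early_def)

lemma early_bound_le:
  assumes "Delta_f P \<eta> r0 \<le> D"
  shows "16 * Delta_f P \<eta> r0 * real (batch_size P i) / (\<theta> * \<rho>\<^sup>2)
    \<le> 32 * \<bar>D\<bar> / (\<theta> * \<rho>\<^sup>2) * sqrt (real (data_size P i))"
proof -
  have "Delta_f P \<eta> r0 * real (batch_size P i) \<le> \<bar>D\<bar> * (2 * sqrt (real (data_size P i)))"
    using assms Delta_f_nonneg batch_size_bounds(4)[of i] by (intro mult_mono) auto
  then have "16 * (Delta_f P \<eta> r0 * real (batch_size P i)) / (\<theta> * \<rho>\<^sup>2)
      \<le> 16 * (\<bar>D\<bar> * (2 * sqrt (real (data_size P i)))) / (\<theta> * \<rho>\<^sup>2)"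
    using theta_pos by (intro divide_right_mono mult_left_mono) auto
  then show ?thesis by (simp add: mult_ac)
qed

section \<open>Counting samples\<close>

text \<open>An epoch that ends without an early restart lasts exactly \<open>batch_size P i\<close>
  iterations and pays for the next restart with them; the first epoch and the early restarts are
  counted separately.\<close>

lemma num_restarts_le:
  "batch_size P i * card {s. s < T \<and> restart w s i} \<le> batch_size P i * (1 + num_early w i T) + T"
proof (cases T)
  case (Suc N)
  let ?b = "batch_size P i" and ?R = "\<lambda>t. card {s. s < Suc t \<and> restart w s i}"
  have R: "?R (Suc t) = ?R t + (if restart w (Suc t) i then 1 else 0)" for t
  proof -
    have "{s. s < Suc (Suc t) \<and> restart w s i}
        = {s. s < Suc t \<and> restart w s i} \<union> (if restart w (Suc t) i then {Suc t} else {})"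
      by (auto simp: less_Suc_eq)
    then show ?thesis by simp
  qed
  \<comment> \<open>\<open>t - count w t i\<close> is the start of the running epoch: only completed
    epochs have paid.\<close>
  have "?b * ?R t \<le> ?b * (1 + num_early w i t) + (t - count w t i)" for t
  proof (induction t)
    case 0
    have "{s. s < Suc 0 \<and> restart w s i} = {0}" using restart_0 by auto
    then show ?case by (simp add: num_early_0)
  next
    case (Suc t)
    show ?case
    proof (cases "restart w (Suc t) i")
      case False
      then have "\<not> early w i t" using early_imp_restart by blast
      then show ?thesis using Suc False by (simp add: R num_early_Suc count_Suc)
    next
      case True
      show ?thesis
      proof (cases "early w i t")
        case True
        then show ?thesis using Suc \<open>restart w (Suc t) i\<close>
          by (simp add: R num_early_Suc count_restart)
      next
        case False
        then have "count w t i = ?b - 1"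
          using \<open>restart w (Suc t) i\<close> by (auto simp: early_def restart_Suc)
        then have total: "t - count w t i + ?b = Suc t"
          using count_le[of w t i] batch_size_bounds(1)[of i] by linarith
        have R': "?b * ?R (Suc t) = ?b * ?R t + ?b"
          using True by (simp only: R if_True distrib_left mult_1_right)
        have "num_early w i (Suc t) = num_early w i t"
          using False by (simp add: num_early_Suc)
        then show ?thesis unfolding R' count_restart[OF True] using Suc total by simp
      qed
    qed
  qed
  from this[of N] have "?b * ?R N \<le> ?b * (1 + num_early w i N) + N" by linarith
  also have "\<dots> \<le> ?b * (1 + num_early w i (Suc N)) + Suc N"
    by (intro add_mono mult_left_mono) (auto simp: num_early_Suc)
  finally show ?thesis by (simp add: Suc)
qed simp

text \<open>With \<open>n\<close> the data size, the full gradients of regular epochs cost at most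
  \<open>sqrt n * T\<close> and the batches at most \<open>2 * sqrt n * T\<close>, together the
  factor 3.\<close>

lemma num_samples_le:
  "real (num_samples P \<delta> \<rho> \<theta> r0 T w)
    \<le> (\<Sum>i\<in>UNIV. real (data_size P i) + real (data_size P i) * real (num_early w i T)
          + 3 * sqrt (real (data_size P i)) * real T)"
proof -
  have "(\<Sum>t<T. if restart w t i then data_size P i else batch_size P i)
      \<le> data_size P i * card {s. s < T \<and> restart w s i} + batch_size P i * T" for i
  proof -
    have "(\<Sum>t<T. if restart w t i then data_size P i else batch_size P i)
      \<le> (\<Sum>t<T. (if restart w t i then data_size P i else 0) + batch_size P i)"
      by (intro sum_mono) auto
    also have "\<dots> = data_size P i * card ({..<T} \<inter> {s. restart w s i}) + batch_size P i * T"
      by (simp add: sum.distrib sum.If_cases mult.commute)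
    also have "{..<T} \<inter> {s. restart w s i} = {s. s < T \<and> restart w s i}" by auto
    finally show ?thesis .
  qed
  moreover have "real (data_size P i * card {s. s < T \<and> restart w s i} + batch_size P i * T)
      \<le> real (data_size P i) + real (data_size P i) * real (num_early w i T)
          + 3 * sqrt (real (data_size P i)) * real T" for i
  proof -
    let ?b = "real (batch_size P i)" and ?n = "real (data_size P i)"
      and ?R = "real (card {s. s < T \<and> restart w s i})" and ?K = "real (num_early w i T)"
    have b: "0 < ?b" using batch_size_bounds(1)[of i] by simp
    have "real (batch_size P i * card {s. s < T \<and> restart w s i})
        \<le> real (batch_size P i * (1 + num_early w i T) + T)"
      using num_restarts_le by (rule of_nat_mono)
    then have "?b * ?R \<le> ?b * (1 + ?K) + real T" by (simp only: of_nat_mult of_nat_add of_nat_1)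
    then have "?R \<le> 1 + ?K + real T / ?b" using b by (simp add: field_simps)
    then have "?n * ?R \<le> ?n * (1 + ?K + real T / ?b)" by (intro mult_left_mono) auto
    also have "\<dots> = ?n + ?n * ?K + ?n / ?b * real T" by (simp add: algebra_simps)
    also have "?n / ?b * real T \<le> sqrt ?n * real T"
    proof (intro mult_right_mono)
      have "sqrt ?n * sqrt ?n \<le> sqrt ?n * ?b"
        using batch_size_bounds(3)[of i] by (intro mult_left_mono) auto
      then show "?n / ?b \<le> sqrt ?n" using b by (simp add: divide_le_eq)
    qed simp
    finally have "?n * ?R \<le> ?n + ?n * ?K + sqrt ?n * real T" by simp
    moreover have "?b * real T \<le> 2 * sqrt ?n * real T"
      using batch_size_bounds(4)[of i] by (intro mult_right_mono) auto
    ultimately show ?thesis by (simp add: algebra_simps)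
  qed
  ultimately show ?thesis
    unfolding num_samples_def restart_def[symmetric] of_nat_sum[where f = "\<lambda>i. \<Sum>t<T. if restart w t i then data_size P i else batch_size P i"]
    by (intro sum_mono) (meson of_nat_mono order_trans)
qed

lemma expected_samples_le:
  "expected_samples P \<delta> \<rho> \<theta> r0 T
    \<le> (\<Sum>i\<in>UNIV. real (data_size P i) + real (data_size P i) * (16 * Delta_f P \<eta> r0 * real (batch_size P i) / (\<theta> * \<rho>\<^sup>2))
          + 3 * sqrt (real (data_size P i)) * real T)"
proof -
  have "expected_samples P \<delta> \<rho> \<theta> r0 T \<le> avg T (\<lambda>w. \<Sum>i\<in>UNIV. real (data_size P i)
      + real (data_size P i) * real (num_early w i T) + 3 * sqrt (real (data_size P i)) * real T)"
    unfolding expected_samples_def by (intro avg_mono num_samples_le)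
  also have "\<dots> = (\<Sum>i\<in>UNIV. real (data_size P i) + real (data_size P i) * avg T (\<lambda>w. real (num_early w i T))
      + 3 * sqrt (real (data_size P i)) * real T)"
    unfolding avg_sum avg_add avg_cmult avg_const ..
  also have "\<dots> \<le> (\<Sum>i\<in>UNIV. real (data_size P i)
      + real (data_size P i) * (16 * Delta_f P \<eta> r0 * real (batch_size P i) / (\<theta> * \<rho>\<^sup>2))
      + 3 * sqrt (real (data_size P i)) * real T)"
    by (intro sum_mono add_mono mult_left_mono avg_num_early_le order_refl) auto
  finally show ?thesis .
qed

section \<open>The gradient mapping\<close>

text \<open>The norm of the gradient mapping is the gradient norm truncated at
  \<open>\<theta> * lmin * \<delta>\<close>. Truncation is 1-Lipschitz, so the tracker can replace
  the gradient at the cost of \<open>grad_err\<close>, and the truncated tracker is at most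
  \<open>4 * \<theta> * lmin\<close> times the update; \<open>32 = 2 * 4^2\<close>.\<close>

lemma norm_grad_mapping_sq_le:
  "real CARD('m) * (norm (grad_mapping P \<delta> \<rho> \<theta> r0 w t))\<^sup>2
    \<le> lmin w t * (32 * \<theta>\<^sup>2 * (lmin w t * sq_sum (upd w t)) + 2 * (sq_sum (grad_err w t) / lmin w t))"
proof -
  let ?\<beta> = "\<theta> * lmin w t" and ?F = "grad (objective P) (mean (iter w t))"
    and ?G = "grad_mapping P \<delta> \<rho> \<theta> r0 w t"
  have th: "0 < \<theta>" using theta_pos by simp
  have l: "0 < lmin w t" by (rule lmin_pos)
  have "mean_iterate P \<delta> \<rho> \<theta> r0 w t = mean (iter w t)"
    by (simp add: mean_iterate_def mean_def iter_def)
  then have G: "norm ?G = min (norm ?F) (?\<beta> * \<delta>)"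
    unfolding grad_mapping_def Let_def L_min_eq using th l delta norm_scaled_clip[of ?\<beta> \<delta> ?F] by simp
  have min_le: "min a d \<le> min b d + e" if "a \<le> b + e" "0 \<le> e" for a b d e :: real
    using that by (auto simp: min_def)
  have "(norm ?G)\<^sup>2 \<le> 32 * \<theta>\<^sup>2 * ((lmin w t)\<^sup>2 * (norm (upd w t i))\<^sup>2) + 2 * (norm (grad_err w t i))\<^sup>2" for i
  proof -
    have "norm ?F \<le> norm (tracker w t i) + norm (grad_err w t i)"
      unfolding grad_err_def by norm
    then have "norm ?G \<le> min (norm (tracker w t i)) (?\<beta> * \<delta>) + norm (grad_err w t i)"
      unfolding G using min_le[OF _ norm_ge_zero] by blast
    also have "min (norm (tracker w t i)) (?\<beta> * \<delta>) \<le> min (norm (tracker w t i)) (\<theta> * lip w t i * \<delta>)"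
      using th delta lmin_le_lip[of w t i] by (intro min.mono mult_right_mono mult_left_mono order_refl) auto
    also have "\<dots> = norm ((\<theta> * lip w t i) *\<^sub>R upd w t i)"
      unfolding upd_def using th lip_pos[of w t i] delta by (intro norm_scaled_clip[symmetric]) auto
    also have "\<dots> \<le> \<theta> * (4 * lmin w t) * norm (upd w t i)"
    proof -
      have "norm ((\<theta> * lip w t i) *\<^sub>R upd w t i) = \<theta> * lip w t i * norm (upd w t i)"
        using th lip_pos[of w t i] by simp
      also have "\<dots> \<le> \<theta> * (4 * lmin w t) * norm (upd w t i)"
        using th lip_le_4_lmin[of w t i] by (intro mult_right_mono mult_left_mono) auto
      finally show ?thesis .
    qed
    finally have "(norm ?G)\<^sup>2 \<le> (\<theta> * (4 * lmin w t) * norm (upd w t i) + norm (grad_err w t i))\<^sup>2"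
      by (intro power_mono) auto
    also have "\<dots> \<le> 2 * (\<theta> * (4 * lmin w t) * norm (upd w t i))\<^sup>2 + 2 * (norm (grad_err w t i))\<^sup>2"
      using sum_squares_bound[of "\<theta> * (4 * lmin w t) * norm (upd w t i)" "norm (grad_err w t i)"]
      by (simp add: power2_sum)
    finally show ?thesis by (simp add: power_mult_distrib mult_ac)
  qed
  then have "(\<Sum>i\<in>(UNIV::'m set). (norm ?G)\<^sup>2)
      \<le> (\<Sum>i\<in>UNIV. 32 * \<theta>\<^sup>2 * ((lmin w t)\<^sup>2 * (norm (upd w t i))\<^sup>2) + 2 * (norm (grad_err w t i))\<^sup>2)"
    by (intro sum_mono)
  also have "\<dots> = 32 * \<theta>\<^sup>2 * ((lmin w t)\<^sup>2 * sq_sum (upd w t)) + 2 * sq_sum (grad_err w t)"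
    by (simp add: sq_sum_def sum.distrib sum_distrib_left)
  also have "\<dots> = lmin w t * (32 * \<theta>\<^sup>2 * (lmin w t * sq_sum (upd w t)) + 2 * (sq_sum (grad_err w t) / lmin w t))"
    using l by (simp add: power2_eq_square algebra_simps)
  finally show ?thesis by simp
qed

text \<open>The bound is assumed for arrays that are admissible at all times, while arrays in the
  support carry the default \<open>{}\<close> from time \<open>T\<close> on. Filling up with
  admissible batches leaves the run before \<open>T\<close> unchanged.\<close>

lemma lmin_le_bound:
  assumes "L_min_bounded P \<delta> \<rho> \<theta> r0 Lbar" "w \<in> set_pmf (batches_pmf P T)" "t < T"
  shows "lmin w t \<le> Lbar"
proof -
  define w' :: "'m batches" where
    "w' = (\<lambda>(i, s). if s < T then w (i, s) else SOME B. B \<in> admissible_batches P i)"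
  have "w' (i, s) \<in> admissible_batches P i" for i s
    using assms(2) admissible_batches(2)[of i]
    by (auto simp: w'_def set_batches_pmf PiE_dflt_def some_in_eq)
  then have "L_min P \<delta> \<rho> \<theta> r0 w' t \<le> Lbar"
    using assms(1) by (simp add: L_min_bounded_def)
  moreover have "run P \<delta> \<rho> \<theta> r0 w t = run P \<delta> \<rho> \<theta> r0 w' t"
    using assms(3) by (intro run_cong) (simp add: w'_def)
  ultimately show ?thesis by (simp add: L_min_def flip: L_min_eq)
qed

lemma expected_grad_mapping_sq_eq:
  assumes "0 < T"
  shows "expected_grad_mapping_sq P \<delta> \<rho> \<theta> r0 T
    = avg T (\<lambda>w. \<Sum>t<T. (norm (grad_mapping P \<delta> \<rho> \<theta> r0 w t))\<^sup>2) / real T"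
proof -
  let ?p = "batches_pmf P T" and ?q = "pmf_of_set {..<T}"
  let ?h = "\<lambda>w t. (norm (grad_mapping P \<delta> \<rho> \<theta> r0 w t))\<^sup>2"
  have T: "{..<T} \<noteq> {}" using assms by (simp add: lessThan_empty_iff)
  have pair: "pair_pmf ?p ?q = ?p \<bind> (\<lambda>w. map_pmf (Pair w) ?q)"
    by (simp add: pair_pmf_def map_pmf_def)
  have "expected_grad_mapping_sq P \<delta> \<rho> \<theta> r0 T
      = (\<Sum>w\<in>set_pmf ?p. pmf ?p w * ((\<Sum>t<T. ?h w t) / real T))"
    unfolding expected_grad_mapping_sq_def pair
    by (subst pmf_expectation_bind[OF finite_set_batches_pmf])
      (use T in \<open>simp_all add: integral_pmf_of_set\<close>)
  also have "\<dots> = avg T (\<lambda>w. (\<Sum>t<T. ?h w t) / real T)"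
    by (subst integral_measure_pmf_real[OF finite_set_batches_pmf]) (simp_all add: mult.commute)
  finally show ?thesis by simp
qed

lemma expected_grad_mapping_sq_le:
  assumes "L_min_bounded P \<delta> \<rho> \<theta> r0 Lbar" "0 < T"
  shows "expected_grad_mapping_sq P \<delta> \<rho> \<theta> r0 T
    \<le> Lbar * (128 * \<theta> + 33) * Delta_f P \<eta> r0 / real T"
proof -
  let ?m = "real CARD('m)" and ?G = "\<lambda>w t. (norm (grad_mapping P \<delta> \<rho> \<theta> r0 w t))\<^sup>2"
  define M where "M = ?m * Delta_f P \<eta> r0"
  define U where "U = avg T (\<lambda>w. sum_upd w T)"
  have th: "0 < \<theta>" using theta_pos by simp
  have M: "0 \<le> M" using Delta_f_nonneg by (simp add: M_def)
  have U: "U \<le> 4 * M / \<theta>" using avg_sum_upd_le[of T] by (simp add: U_def M_def)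
  have Lbar: "0 \<le> Lbar"
  proof -
    obtain w where "w \<in> set_pmf (batches_pmf P T)" using set_pmf_not_empty[of "batches_pmf P T"] by blast
    then show ?thesis using lmin_le_bound[OF assms(1) _ assms(2)] lmin_pos[of w 0] by fastforce
  qed
  have path: "?m * (\<Sum>t<T. ?G w t) \<le> Lbar * (32 * \<theta>\<^sup>2 * sum_upd w T + 2 * sum_grad_err w T)"
    if w: "w \<in> set_pmf (batches_pmf P T)" for w
  proof -
    have "?m * ?G w t \<le> Lbar * (32 * \<theta>\<^sup>2 * (lmin w t * sq_sum (upd w t)) + 2 * (sq_sum (grad_err w t) / lmin w t))"
      if "t < T" for t
    proof (rule order_trans[OF norm_grad_mapping_sq_le mult_right_mono])
      show "lmin w t \<le> Lbar" by (rule lmin_le_bound[OF assms(1) w that])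
      show "0 \<le> 32 * \<theta>\<^sup>2 * (lmin w t * sq_sum (upd w t)) + 2 * (sq_sum (grad_err w t) / lmin w t)"
        by (intro add_nonneg_nonneg mult_nonneg_nonneg divide_nonneg_pos sq_sum_nonneg lmin_pos
            less_imp_le[OF lmin_pos]) auto
    qed
    then have "(\<Sum>t<T. ?m * ?G w t) \<le> (\<Sum>t<T. Lbar * (32 * \<theta>\<^sup>2 * (lmin w t * sq_sum (upd w t)) + 2 * (sq_sum (grad_err w t) / lmin w t)))"
      by (intro sum_mono) simp
    then show ?thesis
      unfolding sum_upd_def sum_grad_err_def sum_distrib_left[symmetric] sum.distrib .
  qed
  have "?m * avg T (\<lambda>w. \<Sum>t<T. ?G w t) \<le> Lbar * (32 * \<theta>\<^sup>2 * U + 2 * avg T (\<lambda>w. sum_grad_err w T))"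
  proof -
    have "avg T (\<lambda>w. ?m * (\<Sum>t<T. ?G w t)) \<le> avg T (\<lambda>w. Lbar * (32 * \<theta>\<^sup>2 * sum_upd w T + 2 * sum_grad_err w T))"
      by (rule avg_mono_support) (rule path)
    then show ?thesis unfolding avg_add avg_cmult U_def .
  qed
  also have "\<dots> \<le> Lbar * ((128 * \<theta> + 33) * M)"
  proof (rule mult_left_mono[OF _ Lbar])
    have "32 * \<theta>\<^sup>2 * U \<le> 32 * \<theta>\<^sup>2 * (4 * M / \<theta>)"
      using U by (intro mult_left_mono) auto
    also have "\<dots> = 128 * \<theta> * M" using th by (simp add: power2_eq_square)
    finally have 1: "32 * \<theta>\<^sup>2 * U \<le> 128 * \<theta> * M" .
    have 2: "6 / (1 - \<eta>) * initial_heterogeneity \<le> 12 / 5 * M"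
    proof -
      have "6 / (1 - \<eta>) * initial_heterogeneity \<le> 6 / (1 - \<eta>) * (2 * (1 - \<eta>) / 5 * M)"
        unfolding M_def using gap by (intro mult_left_mono initial_heterogeneity_le) auto
      moreover have "6 / q * (2 * q / 5 * M) = 12 / 5 * M" if "0 < q" for q :: real using that by simp
      ultimately show ?thesis using gap(1) by metis
    qed
    have 3: "33384 / (1 - \<eta>)^4 * U \<le> 14 * M"
    proof -
      have "33384 / (1 - \<eta>)^4 \<le> 33600 / (1 - \<eta>)^4" by (intro divide_right_mono) auto
      also have "\<dots> \<le> 7 / 2 * \<theta>" using theta_ge by simp
      finally have "33384 / (1 - \<eta>)^4 * U \<le> 7 / 2 * \<theta> * (4 * M / \<theta>)"
        using th M U by (intro mult_mono) (auto simp: U_def intro!: Bochner_Integration.integral_nonneg sum_upd_nonneg)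
      then show ?thesis using th by simp
    qed
    \<comment> \<open>The two parts of the gradient error count twice:
      \<open>2 * (12 / 5 + 14)\<close> is at most 33.\<close>
    show "32 * \<theta>\<^sup>2 * U + 2 * avg T (\<lambda>w. sum_grad_err w T) \<le> (128 * \<theta> + 33) * M"
      using avg_sum_grad_err_le[of T] 1 2 3 M unfolding U_def[symmetric] distrib_right by linarith
  qed
  also have "\<dots> = ?m * (Lbar * (128 * \<theta> + 33) * Delta_f P \<eta> r0)" by (simp add: M_def)
  finally have "avg T (\<lambda>w. \<Sum>t<T. ?G w t) \<le> Lbar * (128 * \<theta> + 33) * Delta_f P \<eta> r0"
    by simp
  then show ?thesis
    unfolding expected_grad_mapping_sq_eq[OF assms(2)] by (intro divide_right_mono) auto
qed

end

text \<open>The order of the quantifiers gives the O-notation its meaning: the constants and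
  \<open>T\<close> are fixed before the problem, so the bounds are uniform over all data sizes and
  all problems with \<open>Delta_f\<close> at most \<open>D\<close>.\<close>

theorem theorem4p7:
  fixes \<eta> c \<delta> \<rho> r0 \<theta> :: real
  defines "c \<equiv> 2 * sqrt (2 * real CARD('m::finite)) / (1 - \<eta>)"
  assumes "0 < \<eta>" "\<eta> < 1" "0 < \<delta>" "0 < \<rho>" "(c + 1) * \<delta> + \<rho> \<le> r0"
    and "\<theta> \<ge> 28 + 1424 / (1 - \<eta>)^2 + 9600 / (1 - \<eta>)^4"
    and "c * \<delta> \<le> \<rho> / 2"
  shows
    "(\<forall>P :: ('m, 'a::euclidean_space) problem.
        standing_assumptions P \<eta> \<and> RUC_radius P \<eta> r0 \<longrightarrow>
        (\<forall>T i. expected_early_restarts P \<delta> \<rho> \<theta> r0 T i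
            \<le> 16 * Delta_f P \<eta> r0 * real (epoch_length P i) / (\<theta> * \<rho>\<^sup>2)))
     \<and>
     (\<forall>D. \<exists>C>0. \<forall>P :: ('m, 'a) problem.
        standing_assumptions P \<eta> \<and> RUC_radius P \<eta> r0 \<and> Delta_f P \<eta> r0 \<le> D \<longrightarrow>
        (\<forall>i. 16 * Delta_f P \<eta> r0 * real (epoch_length P i) / (\<theta> * \<rho>\<^sup>2)
            \<le> C * sqrt (real (data_size P i))))
     \<and>
     (\<forall>D. \<forall>Lbar>0. \<exists>C\<^sub>1>0. \<exists>C\<^sub>2>0. \<forall>\<epsilon>>0. \<exists>T>0. \<forall>P :: ('m, 'a) problem.
        standing_assumptions P \<eta> \<and> RUC_radius P \<eta> r0 \<and> Delta_f P \<eta> r0 \<le> D \<and>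
        L_min_bounded P \<delta> \<rho> \<theta> r0 Lbar \<longrightarrow>
        expected_grad_mapping_sq P \<delta> \<rho> \<theta> r0 T \<le> C\<^sub>1 * \<epsilon> \<and>
        expected_samples P \<delta> \<rho> \<theta> r0 T
          \<le> (\<Sum>i\<in>UNIV. C\<^sub>2 * (real (data_size P i) powr (3/2)
                              + real (data_size P i) powr (1/2) / \<epsilon>)))"
proof (intro conjI allI impI)
  have cgtvr: "cgtvr P \<eta> \<delta> \<rho> \<theta> r0"
    if "standing_assumptions P \<eta>" "RUC_radius P \<eta> r0" for P :: "('m, 'a) problem"
    using that assms by unfold_locales auto
  define C0 where "C0 D = 32 * \<bar>D\<bar> / (\<theta> * \<rho>\<^sup>2)" for D
  have "0 \<le> 1424 / (1 - \<eta>)^2" "0 \<le> 9600 / (1 - \<eta>)^4" by simp_all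
  then have th: "0 < \<theta>" using assms by linarith
  have C0: "0 \<le> C0 D" for D using th by (simp add: C0_def)
  {
    fix P :: "('m, 'a) problem" and T i
    assume "standing_assumptions P \<eta> \<and> RUC_radius P \<eta> r0"
    then show "expected_early_restarts P \<delta> \<rho> \<theta> r0 T i
        \<le> 16 * Delta_f P \<eta> r0 * real (epoch_length P i) / (\<theta> * \<rho>\<^sup>2)"
      using cgtvr.expected_early_restarts_le[OF cgtvr] by blast
  next
    fix D :: real
    show "\<exists>C>0. \<forall>P :: ('m, 'a) problem.
        standing_assumptions P \<eta> \<and> RUC_radius P \<eta> r0 \<and> Delta_f P \<eta> r0 \<le> D \<longrightarrow>
        (\<forall>i. 16 * Delta_f P \<eta> r0 * real (epoch_length P i) / (\<theta> * \<rho>\<^sup>2)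
            \<le> C * sqrt (real (data_size P i)))"
    proof (intro exI[of _ "C0 D + 1"] conjI allI impI)
      show "0 < C0 D + 1" using C0[of D] by linarith
      fix P :: "('m, 'a) problem" and i
      assume "standing_assumptions P \<eta> \<and> RUC_radius P \<eta> r0 \<and> Delta_f P \<eta> r0 \<le> D"
      then have "16 * Delta_f P \<eta> r0 * real (epoch_length P i) / (\<theta> * \<rho>\<^sup>2)
          \<le> C0 D * sqrt (real (data_size P i))"
        unfolding C0_def using cgtvr.early_bound_le[OF cgtvr] by blast
      then show "16 * Delta_f P \<eta> r0 * real (epoch_length P i) / (\<theta> * \<rho>\<^sup>2)
          \<le> (C0 D + 1) * sqrt (real (data_size P i))"
        by (simp add: distrib_right add_increasing2)
    qed
  next
    fix D Lbar :: real assume Lbar: "0 < Lbar"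
    \<comment> \<open>The summand 1 keeps the constant positive when \<open>D = 0\<close>.\<close>
    define C1 where "C1 = Lbar * (128 * \<theta> + 33) * \<bar>D\<bar> + 1"
    define C2 where "C2 = C0 D + 4"
    have C1: "0 < C1" using Lbar th by (simp add: C1_def add_nonneg_pos)
    have C2: "0 < C2" using C0[of D] by (simp add: C2_def)
    show "\<exists>C\<^sub>1>0. \<exists>C\<^sub>2>0. \<forall>\<epsilon>>0. \<exists>T>0. \<forall>P :: ('m, 'a) problem.
        standing_assumptions P \<eta> \<and> RUC_radius P \<eta> r0 \<and> Delta_f P \<eta> r0 \<le> D \<and>
        L_min_bounded P \<delta> \<rho> \<theta> r0 Lbar \<longrightarrow>
        expected_grad_mapping_sq P \<delta> \<rho> \<theta> r0 T \<le> C\<^sub>1 * \<epsilon> \<and>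
        expected_samples P \<delta> \<rho> \<theta> r0 T
          \<le> (\<Sum>i\<in>UNIV. C\<^sub>2 * (real (data_size P i) powr (3/2)
                              + real (data_size P i) powr (1/2) / \<epsilon>))"
    proof (rule exI[of _ C1], intro conjI C1, rule exI[of _ C2], intro conjI C2 allI impI)
      fix \<epsilon> :: real assume eps: "0 < \<epsilon>"
      \<comment> \<open>Rounding up costs less than one iteration more than
        \<open>1 / \<epsilon>\<close>; its samples go into the term with exponent
        \<open>3/2\<close>.\<close>
      define T where "T = nat \<lceil>1 / \<epsilon>\<rceil>"
      have inv: "0 < 1 / \<epsilon>" using eps by simp
      have T: "0 < T" "1 / \<epsilon> \<le> real T" "real T \<le> 1 / \<epsilon> + 1"
        using inv ceiling_correct[of "1 / \<epsilon>"] by (auto simp: T_def less_ceiling_iff)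
      show "\<exists>T>0. \<forall>P :: ('m, 'a) problem.
        standing_assumptions P \<eta> \<and> RUC_radius P \<eta> r0 \<and> Delta_f P \<eta> r0 \<le> D \<and>
        L_min_bounded P \<delta> \<rho> \<theta> r0 Lbar \<longrightarrow>
        expected_grad_mapping_sq P \<delta> \<rho> \<theta> r0 T \<le> C1 * \<epsilon> \<and>
        expected_samples P \<delta> \<rho> \<theta> r0 T
          \<le> (\<Sum>i\<in>UNIV. C2 * (real (data_size P i) powr (3/2)
                              + real (data_size P i) powr (1/2) / \<epsilon>))"
      proof (rule exI[of _ T], rule conjI[OF T(1)], intro allI impI)
        fix P :: "('m, 'a) problem"
        assume P: "standing_assumptions P \<eta> \<and> RUC_radius P \<eta> r0 \<and> Delta_f P \<eta> r0 \<le> D \<and>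
          L_min_bounded P \<delta> \<rho> \<theta> r0 Lbar"
        then interpret cgtvr P \<eta> \<delta> \<rho> \<theta> r0 by (intro cgtvr) auto
        have "expected_grad_mapping_sq P \<delta> \<rho> \<theta> r0 T \<le> Lbar * (128 * \<theta> + 33) * Delta_f P \<eta> r0 / real T"
          using P T(1) by (intro expected_grad_mapping_sq_le) auto
        also have "\<dots> \<le> C1 / real T"
        proof (rule divide_right_mono)
          have "Lbar * (128 * \<theta> + 33) * Delta_f P \<eta> r0 \<le> Lbar * (128 * \<theta> + 33) * \<bar>D\<bar>"
            using P Lbar th by (intro mult_left_mono) auto
          then show "Lbar * (128 * \<theta> + 33) * Delta_f P \<eta> r0 \<le> C1" by (simp add: C1_def)
        qed simp
        also have "\<dots> \<le> C1 * \<epsilon>"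
        proof -
          have "1 / real T \<le> \<epsilon>" using T eps by (simp add: field_simps)
          from mult_left_mono[OF this, of C1] C1 show ?thesis by simp
        qed
        finally have G: "expected_grad_mapping_sq P \<delta> \<rho> \<theta> r0 T \<le> C1 * \<epsilon>" .
        have "expected_samples P \<delta> \<rho> \<theta> r0 T
          \<le> (\<Sum>i\<in>UNIV. real (data_size P i) + real (data_size P i) * (16 * Delta_f P \<eta> r0 * real (batch_size P i) / (\<theta> * \<rho>\<^sup>2))
            + 3 * sqrt (real (data_size P i)) * real T)"
          by (rule expected_samples_le)
        also have "\<dots> \<le> (\<Sum>i\<in>UNIV. C2 * (real (data_size P i) powr (3/2) + real (data_size P i) powr (1/2) / \<epsilon>))"
        proof (rule sum_mono)
          fix i
          let ?n = "real (data_size P i)" and ?s = "sqrt (real (data_size P i))"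
          have n: "1 \<le> ?n" using data_size_pos[of i] by simp
          then have s: "1 \<le> ?s" by simp
          have p1: "?n powr (1/2) = ?s" using n by (simp add: powr_half_sqrt)
          have "?n powr (1 + 1/2) = ?n powr 1 * ?n powr (1/2)" by (rule powr_add)
          then have p3: "?n powr (3/2) = ?n * ?s" using n p1 by simp
          have "?n * 1 \<le> ?n * ?s" "1 * ?s \<le> ?n * ?s"
            using n s by (intro mult_left_mono mult_right_mono; simp)+
          then have le: "?n \<le> ?n * ?s" "?s \<le> ?n * ?s" by simp_all
          have "?n * (16 * Delta_f P \<eta> r0 * real (batch_size P i) / (\<theta> * \<rho>\<^sup>2)) \<le> ?n * (C0 D * ?s)"
            unfolding C0_def using P by (intro mult_left_mono early_bound_le) auto
          moreover have "3 * ?s * real T \<le> 3 * ?s * (1 / \<epsilon> + 1)"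
            using T s by (intro mult_left_mono) auto
          \<comment> \<open>Padding that raises the coefficient of \<open>?s / \<epsilon>\<close>
            from 3 to that of \<open>?n * ?s\<close>, so that the single constant \<open>C2\<close>
            factors out.\<close>
          moreover have "0 \<le> C0 D * (?s / \<epsilon>)" "0 \<le> ?s / \<epsilon>" using C0 s eps by auto
          ultimately have "?n + ?n * (16 * Delta_f P \<eta> r0 * real (batch_size P i) / (\<theta> * \<rho>\<^sup>2)) + 3 * ?s * real T
              \<le> ?n * ?s + ?n * (C0 D * ?s) + (3 * (?s / \<epsilon>) + 3 * (?n * ?s)) + C0 D * (?s / \<epsilon>) + ?s / \<epsilon>"
            using le by (simp add: distrib_left)
          also have "\<dots> = C2 * (?n * ?s + ?s / \<epsilon>)" by (simp add: C2_def algebra_simps flip: add_divide_distrib)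
          finally show "?n + ?n * (16 * Delta_f P \<eta> r0 * real (batch_size P i) / (\<theta> * \<rho>\<^sup>2)) + 3 * ?s * real T
              \<le> C2 * (?n powr (3/2) + ?n powr (1/2) / \<epsilon>)"
            unfolding p1 p3 .
        qed
        finally show "expected_grad_mapping_sq P \<delta> \<rho> \<theta> r0 T \<le> C1 * \<epsilon> \<and> expected_samples P \<delta> \<rho> \<theta> r0 T
          \<le> (\<Sum>i\<in>UNIV. C2 * (real (data_size P i) powr (3/2) + real (data_size P i) powr (1/2) / \<epsilon>))"
          using G by blast
      qed
    qed
  }
qed

end
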